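(* If $(X,A)$ is a locally compact pair and $(P,\ast)$ is a pointed polyhedron, then the relation of homotopy for maps $(X,A)\to(P,\ast)$ is idealistic (as an equivalence relation on the Polish space of all maps $(X,A)\to(P,\ast)$).
   Context: A locally compact pair $(X,A)$ is a locally compact Polish space $X$ with a closed subspace $A$ (possibly empty). A pointed polyhedron $(P,\ast)$ is a space homeomorphic to the topological realization of a countable locally finite simplicial complex, with a distinguished point (vertex) $\ast$. A map $(X,A)\to(P,\ast)$ is a continuous $f:X\to P$ with $f(A)\subseteq\{\ast\}$; the space of these has the compact-open topology and is Polish. Two such maps $f,g$ are homotopic if there is a continuous $h:X\times[0,1]\to P$ with $h(-,0)=f$, $h(-,1)=g$, $h(A\times[0,1])\subseteq\{\ast\}$. An equivalence relation $E$ on a Polish space $Y$ is idealistic if there are an assignment $[y]\mapsto\mathcal F_{[y]}$ of a $\sigma$-filter of subsets of $[y]$ to each $E$-class $[y]$ and a Borel function $\zeta:Y\to Y$ with $\zeta(y)\,E\,y$ for all $y$, such that for every Borel $B\subseteq Y\times Y$ the set $\{y\in Y:\{y'\in[y]:(\zeta(y),y')\in B\}\in\mathcal F_{[y]}\}$ is Borel. A $\sigma$-filter of subsets of $C$ is a nonempty collection of nonempty subsets of $C$ closed under supersets and countable intersections. *)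

theory Defs
  imports "HOL-Analysis.Analysis"
begin

definition Polish_space :: "'a topology \<Rightarrow> bool" where
  "Polish_space X \<longleftrightarrow> separable_space X \<and> completely_metrizable_space X"

definition locally_compact_pair :: "'a topology \<Rightarrow> 'a set \<Rightarrow> bool" where
  "locally_compact_pair X A \<longleftrightarrow> Polish_space X \<and> locally_compact_space X \<and> closedin X A"


text \<open>Abstract simplicial complexes are represented by their sets of simplices. The empty
  set is not a simplex, and the vertices are the points \<open>v\<close> with \<open>{v} \<in> K\<close>.\<close>

definition abstract_simplicial_complex :: "'v set set \<Rightarrow> bool" where
  "abstract_simplicial_complex K \<longleftrightarrow>
     (\<forall>s\<in>K. finite s \<and> s \<noteq> {}) \<and> (\<forall>s\<in>K. \<forall>t. t \<subseteq> s \<and> t \<noteq> {} \<longrightarrow> t \<in> K)"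

definition locally_finite_complex :: "'v set set \<Rightarrow> bool" where
  "locally_finite_complex K \<longleftrightarrow> (\<forall>v. finite {s\<in>K. v \<in> s})"

text \<open>Points of the realization are given by their barycentric coordinates.\<close>

definition closed_simplex :: "'v set \<Rightarrow> ('v \<Rightarrow> real) set" where
  "closed_simplex s = {x. (\<forall>v. 0 \<le> x v) \<and> (\<forall>v. v \<notin> s \<longrightarrow> x v = 0) \<and> sum x s = 1}"

definition vertex_point :: "'v \<Rightarrow> 'v \<Rightarrow> real" where
  "vertex_point v = (\<lambda>w. if w = v then 1 else 0)"

text \<open>The realization carries the weak topology: a set is open iff its trace on every closed
  simplex is open there. On a single (finite) simplex, the product topology induces the
  usual Euclidean topology.\<close>

definition realization :: "'v set set \<Rightarrow> ('v \<Rightarrow> real) topology" where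
  "realization K = topology (\<lambda>U. U \<subseteq> (\<Union>s\<in>K. closed_simplex s) \<and>
     (\<forall>s\<in>K. openin (subtopology (powertop_real UNIV) (closed_simplex s)) (U \<inter> closed_simplex s)))"

lemma openin_realization:
  "openin (realization K) U \<longleftrightarrow> U \<subseteq> (\<Union>s\<in>K. closed_simplex s) \<and>
     (\<forall>s\<in>K. openin (subtopology (powertop_real UNIV) (closed_simplex s)) (U \<inter> closed_simplex s))"
proof -
  have "istopology (\<lambda>U. U \<subseteq> (\<Union>s\<in>K. closed_simplex s) \<and>
     (\<forall>s\<in>K. openin (subtopology (powertop_real UNIV) (closed_simplex s)) (U \<inter> closed_simplex s)))"
    (is "istopology ?T")
    unfolding istopology_def
  proof (intro conjI allI impI)
    fix S T assume S: "?T S" and T: "?T T"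
    show "S \<inter> T \<subseteq> (\<Union>s\<in>K. closed_simplex s)" using S by blast
    have eq: "S \<inter> T \<inter> C = (S \<inter> C) \<inter> (T \<inter> C)" for C by blast
    show "\<forall>s\<in>K. openin (subtopology (powertop_real UNIV) (closed_simplex s)) (S \<inter> T \<inter> closed_simplex s)"
      unfolding eq using S T by (blast intro: openin_Int)
  next
    fix \<K> assume \<K>: "\<forall>U\<in>\<K>. ?T U"
    then show "\<Union>\<K> \<subseteq> (\<Union>s\<in>K. closed_simplex s)" by blast
    have eq: "\<Union>\<K> \<inter> C = \<Union>((\<lambda>U. U \<inter> C) ` \<K>)" for C by blast
    show "\<forall>s\<in>K. openin (subtopology (powertop_real UNIV) (closed_simplex s)) (\<Union>\<K> \<inter> closed_simplex s)"
      unfolding eq using \<K> by (intro ballI openin_Union) auto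
  qed
  then show ?thesis
    by (simp add: realization_def topology_inverse')
qed

lemma topspace_realization: "topspace (realization K) = (\<Union>s\<in>K. closed_simplex s)"
proof -
  have "openin (subtopology (powertop_real UNIV) (closed_simplex s))
          ((\<Union>s\<in>K. closed_simplex s) \<inter> closed_simplex s)" if "s \<in> K" for s
  proof -
    have "(\<Union>s\<in>K. closed_simplex s) \<inter> closed_simplex s
        = topspace (subtopology (powertop_real UNIV) (closed_simplex s))"
      using that by auto
    then show ?thesis by (metis openin_topspace)
  qed
  then have "openin (realization K) (\<Union>s\<in>K. closed_simplex s)"
    by (simp add: openin_realization)
  then show ?thesis
    by (metis openin_realization openin_subset openin_topspace subset_antisym)
qed

text \<open>Taking the vertices to be natural numbers is no loss of generality: the vertex set of a
  countable complex is countable.\<close>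

definition pointed_polyhedron :: "'b topology \<Rightarrow> 'b \<Rightarrow> bool" where
  "pointed_polyhedron P p \<longleftrightarrow> p \<in> topspace P \<and>
     (\<exists>(K :: nat set set) h v. abstract_simplicial_complex K \<and> countable K \<and>
        locally_finite_complex K \<and> homeomorphic_map P (realization K) h \<and>
        {v} \<in> K \<and> h p = vertex_point v)"


text \<open>Functions between abstract topologies are total on the underlying type; requiring the maps
  to be extensional gives exactly one representative for each map on \<^term>\<open>topspace X\<close>.\<close>

definition pair_maps :: "'a topology \<Rightarrow> 'a set \<Rightarrow> 'b topology \<Rightarrow> 'b \<Rightarrow> ('a \<Rightarrow> 'b) set" where
  "pair_maps X A P p = {f \<in> extensional (topspace X). continuous_map X P f \<and> f ` A \<subseteq> {p}}"

definition compact_open_topology :: "'a topology \<Rightarrow> 'b topology \<Rightarrow> ('a \<Rightarrow> 'b) topology" where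
  "compact_open_topology X P = topology_generated_by
     {{f \<in> extensional (topspace X). continuous_map X P f \<and> f ` C \<subseteq> U} | C U. compactin X C \<and> openin P U}"

definition map_space :: "'a topology \<Rightarrow> 'a set \<Rightarrow> 'b topology \<Rightarrow> 'b \<Rightarrow> ('a \<Rightarrow> 'b) topology" where
  "map_space X A P p = subtopology (compact_open_topology X P) (pair_maps X A P p)"

lemma topspace_map_space: "topspace (map_space X A P p) = pair_maps X A P p"
proof -
  have "topspace (compact_open_topology X P) = {f \<in> extensional (topspace X). continuous_map X P f}"
    unfolding compact_open_topology_def topology_generated_by_topspace
    by (auto intro!: exI[of _ "{}"])
  then show ?thesis
    by (auto simp: map_space_def pair_maps_def)
qed

definition homotopy_rel :: "'a topology \<Rightarrow> 'a set \<Rightarrow> 'b topology \<Rightarrow> 'b \<Rightarrow> (('a \<Rightarrow> 'b) \<times> ('a \<Rightarrow> 'b)) set" where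
  "homotopy_rel X A P p = {(f, g). f \<in> pair_maps X A P p \<and> g \<in> pair_maps X A P p \<and>
     homotopic_with (\<lambda>k. k ` A \<subseteq> {p}) X P f g}"


definition borel_measure_of :: "'y topology \<Rightarrow> 'y measure" where
  "borel_measure_of Y = sigma (topspace Y) {U. openin Y U}"

definition sigma_filter_on :: "'y set \<Rightarrow> 'y set set \<Rightarrow> bool" where
  "sigma_filter_on C \<F> \<longleftrightarrow> \<F> \<noteq> {} \<and> (\<forall>S\<in>\<F>. S \<subseteq> C \<and> S \<noteq> {}) \<and>
     (\<forall>S\<in>\<F>. \<forall>T. S \<subseteq> T \<and> T \<subseteq> C \<longrightarrow> T \<in> \<F>) \<and>
     (\<forall>\<S>. \<S> \<subseteq> \<F> \<and> countable \<S> \<and> \<S> \<noteq> {} \<longrightarrow> \<Inter>\<S> \<in> \<F>)"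

text \<open>The class of \<open>y\<close> is \<open>E `` {y}\<close>, and \<open>\<F>\<close> depends on the class only.\<close>

definition idealistic :: "'y topology \<Rightarrow> ('y \<times> 'y) set \<Rightarrow> bool" where
  "idealistic Y E \<longleftrightarrow> Polish_space Y \<and> equiv (topspace Y) E \<and>
     (\<exists>\<F> \<zeta>. (\<forall>C \<in> topspace Y // E. sigma_filter_on C (\<F> C)) \<and>
        \<zeta> \<in> borel_measure_of Y \<rightarrow>\<^sub>M borel_measure_of Y \<and>
        (\<forall>y \<in> topspace Y. (\<zeta> y, y) \<in> E) \<and>
        (\<forall>B \<in> sets (borel_measure_of (prod_topology Y Y)).
           {y \<in> topspace Y. {y' \<in> E `` {y}. (\<zeta> y, y') \<in> B} \<in> \<F> (E `` {y})}
             \<in> sets (borel_measure_of Y)))"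

end

(* Take for zeta the identity. For a map y let H_y be the Polish space of homotopies starting at y, and
   e1 the evaluation at the end, so that the class of y is the image of e1. A polyhedron has a metric in
   which nearby points are joined by canonical short paths. With cutoff functions on X these paths show
   that the quotient topology of the class under e1 : H_y -> [y] does not depend on the choice of y in
   its class, and that e1 is open for it: two homotopies that are close on a large compact set can be
   connected through their common start where nothing is known about them. The sigma-filter of a class
   consists of its comeager subsets in this topology. Comeagerness of a Borel set can then be tested in
   H_y; as evaluation at the start is open on the space of all homotopies, the sets so obtained are Borel
   by the Montgomery-Novikov theorem. *)

theory Submission
  imports Defs
begin

section \<open>Baire category and Borel sets\<close>

text \<open>Nothing makes a homotopy class a Baire space in the compact-open topology, where it is
  only a continuous image of a space of homotopies. The finer topology makes this image an open one,
  and the class then inherits the Baire property from the complete space above it. The obstacle is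
  the lack of control at infinity: closeness on a compact set says nothing elsewhere, so short paths
  cannot simply be applied to whole maps. They are therefore defined for all pairs of points, but
  have to arrive only at distance at most 1, and a cutoff function makes the time at a point depend
  on the point, so that arrival is asked for only where the two values are close. Local finiteness
  of the complex enters twice: it identifies the weak topology with that of a metric, and it keeps
  limits of Cauchy sequences inside the complex. Nearby points need not share a simplex; the path
  between them passes through the normalized minimum of their coordinates, which lies in a common
  face of their carriers.\<close>

definition meager_in :: "'a topology \<Rightarrow> 'a set \<Rightarrow> bool" where
  "meager_in T S \<longleftrightarrow>
     (\<exists>\<N>. countable \<N> \<and> (\<forall>N\<in>\<N>. closedin T N \<and> T interior_of N = {}) \<and> S \<subseteq> \<Union>\<N>)"

lemma meager_in_subset: "meager_in T S \<Longrightarrow> R \<subseteq> S \<Longrightarrow> meager_in T R"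
  unfolding meager_in_def by (meson subset_trans)

lemma meager_in_empty [simp]: "meager_in T {}"
  unfolding meager_in_def by (rule exI[of _ "{}"]) auto

lemma meager_in_nowhere_dense: "closedin T N \<Longrightarrow> T interior_of N = {} \<Longrightarrow> meager_in T N"
  unfolding meager_in_def by (rule exI[of _ "{N}"]) auto

lemma meager_in_UN:
  assumes "countable I" "\<And>i. i \<in> I \<Longrightarrow> meager_in T (S i)"
  shows "meager_in T (\<Union>i\<in>I. S i)"
proof -
  have "\<forall>i\<in>I. \<exists>\<N>. countable \<N> \<and> (\<forall>N\<in>\<N>. closedin T N \<and> T interior_of N = {}) \<and> S i \<subseteq> \<Union>\<N>"
    using assms(2) unfolding meager_in_def by blast
  from bchoice[OF this] obtain \<N> where \<N>: "\<forall>i\<in>I. countable (\<N> i) \<and>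
      (\<forall>N\<in>\<N> i. closedin T N \<and> T interior_of N = {}) \<and> S i \<subseteq> \<Union>(\<N> i)" ..
  have "countable (\<Union>i\<in>I. \<N> i)" using \<N> assms(1) by (intro countable_UN) auto
  moreover have "\<forall>N\<in>(\<Union>i\<in>I. \<N> i). closedin T N \<and> T interior_of N = {}" using \<N> by blast
  moreover have "(\<Union>i\<in>I. S i) \<subseteq> \<Union>(\<Union>i\<in>I. \<N> i)"
  proof
    fix x assume "x \<in> (\<Union>i\<in>I. S i)"
    then obtain i where "i \<in> I" "x \<in> S i" by blast
    with \<N> have "x \<in> \<Union>(\<N> i)" by blast
    with \<open>i \<in> I\<close> show "x \<in> \<Union>(\<Union>i\<in>I. \<N> i)" by blast
  qed
  ultimately show ?thesis unfolding meager_in_def by blast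
qed

lemma meager_in_Un: "meager_in T R \<Longrightarrow> meager_in T S \<Longrightarrow> meager_in T (R \<union> S)"
  using meager_in_UN[of "{True, False}" T "\<lambda>b. if b then R else S"] by (auto simp: Un_commute)

lemma Baire_meager_openin:
  assumes "completely_metrizable_space T" "openin T U" "meager_in T U"
  shows "U = {}"
proof -
  obtain \<N> where "countable \<N>" "\<forall>N\<in>\<N>. closedin T N \<and> T interior_of N = {}" "U \<subseteq> \<Union>\<N>"
    using assms(3) unfolding meager_in_def by blast
  then have "T interior_of \<Union>\<N> = {}" using assms(1) by (intro Baire_category_alt) auto
  with \<open>U \<subseteq> \<Union>\<N>\<close> assms(2) show ?thesis by (metis interior_of_maximal subset_empty)
qed

text \<open>Openness of \<open>f\<close> is the point: the interior of the preimage of a nowhere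
  dense closed set has an open image inside that set, hence is empty.\<close>

lemma meager_in_vimage:
  assumes f: "continuous_map H T f" "open_map H T f" and "meager_in T S"
  shows "meager_in H {h \<in> topspace H. f h \<in> S}"
proof -
  obtain \<N> where \<N>: "countable \<N>" "\<forall>N\<in>\<N>. closedin T N \<and> T interior_of N = {}" "S \<subseteq> \<Union>\<N>"
    using assms(3) unfolding meager_in_def by blast
  have "meager_in H (\<Union>N\<in>\<N>. {h \<in> topspace H. f h \<in> N})"
  proof (intro meager_in_UN \<N>(1) meager_in_nowhere_dense)
    fix N assume N: "N \<in> \<N>"
    show "closedin H {h \<in> topspace H. f h \<in> N}"
      using f(1) N \<N>(2) by (blast intro: closedin_continuous_map_preimage)
    define O' where "O' = H interior_of {h \<in> topspace H. f h \<in> N}"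
    have "openin T (f ` O')" using f(2) unfolding open_map_def O'_def by simp
    moreover have "f ` O' \<subseteq> N" unfolding O'_def using interior_of_subset by force
    ultimately have "f ` O' \<subseteq> T interior_of N" by (simp add: interior_of_maximal)
    with \<N>(2) N have "O' = {}" by auto
    then show "H interior_of {h \<in> topspace H. f h \<in> N} = {}" by (simp add: O'_def)
  qed
  then show ?thesis by (rule meager_in_subset) (use \<N>(3) in auto)
qed

section \<open>Borel sets of an abstract topology and their category properties\<close>

lemma sets_borel_measure_of: "sets (borel_measure_of Y) = sigma_sets (topspace Y) {U. openin Y U}"
  unfolding borel_measure_of_def by (rule sets_measure_of) (auto dest: openin_subset)

lemma space_borel_measure_of [simp]: "space (borel_measure_of Y) = topspace Y"
  unfolding borel_measure_of_def by (rule space_measure_of) (auto dest: openin_subset)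

lemma openin_in_borel: "openin Y U \<Longrightarrow> U \<in> sets (borel_measure_of Y)"
  by (simp add: sets_borel_measure_of sigma_sets.Basic)

lemma continuous_map_borel_measurable:
  assumes "continuous_map S T f"
  shows "f \<in> borel_measure_of S \<rightarrow>\<^sub>M borel_measure_of T"
proof -
  have "f \<in> borel_measure_of S \<rightarrow>\<^sub>M sigma (topspace T) {U. openin T U}"
  proof (rule measurable_measure_of)
    show "{U. openin T U} \<subseteq> Pow (topspace T)" by (auto dest: openin_subset)
    show "f \<in> space (borel_measure_of S) \<rightarrow> topspace T"
      using assms by (auto simp: continuous_map_def)
  next
    fix U assume "U \<in> {U. openin T U}"
    then have "openin S {x \<in> topspace S. f x \<in> U}"
      using assms by (auto intro: openin_continuous_map_preimage)
    moreover have "f -` U \<inter> space (borel_measure_of S) = {x \<in> topspace S. f x \<in> U}" by auto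
    ultimately show "f -` U \<inter> space (borel_measure_of S) \<in> sets (borel_measure_of S)"
      by (simp add: openin_in_borel)
  qed
  then show ?thesis by (simp add: borel_measure_of_def)
qed

lemma borel_vimage:
  assumes "continuous_map S T f" "B \<in> sets (borel_measure_of T)"
  shows "{x \<in> topspace S. f x \<in> B} \<in> sets (borel_measure_of S)"
proof -
  have "f -` B \<inter> space (borel_measure_of S) \<in> sets (borel_measure_of S)"
    using continuous_map_borel_measurable[OF assms(1)] assms(2) by (rule measurable_sets)
  moreover have "f -` B \<inter> space (borel_measure_of S) = {x \<in> topspace S. f x \<in> B}" by auto
  ultimately show ?thesis by simp
qed

text \<open>This takes the place of the Baire property. Asking for it inside every open
  \<open>U\<close> at once is what lets the induction over the Borel sets pass through
  complements.\<close>

lemma borel_locally_comeager: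
  assumes sc: "second_countable T" and S: "S \<in> sets (borel_measure_of T)"
    and U: "openin T U" and nm: "\<not> meager_in T (S \<inter> U)"
  shows "\<exists>V. openin T V \<and> V \<noteq> {} \<and> V \<subseteq> U \<and> meager_in T (V - S)"
proof -
  obtain \<B> where \<B>: "countable \<B>" "\<And>V. V \<in> \<B> \<Longrightarrow> openin T V"
      "\<And>U x. openin T U \<Longrightarrow> x \<in> U \<Longrightarrow> \<exists>V\<in>\<B>. x \<in> V \<and> V \<subseteq> U"
    using sc unfolding second_countable_def by metis
  have "S \<in> sigma_sets (topspace T) {U. openin T U}" using S by (simp add: sets_borel_measure_of)
  then show ?thesis using U nm
  proof (induction arbitrary: U)
    case (Basic S)
    then have "openin T (S \<inter> U) \<and> S \<inter> U \<noteq> {} \<and> S \<inter> U \<subseteq> U \<and> meager_in T (S \<inter> U - S)"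
      by (metis Diff_eq_empty_iff Int_lower1 Int_lower2 meager_in_empty mem_Collect_eq openin_Int)
    then show ?case by blast
  next
    case Empty
    then show ?case by simp
  next
    case (Compl S)
    show ?case
    proof (rule ccontr)
      assume no: "\<not> ?case"
      \<comment> \<open>If the claim fails, then \<open>S\<close> is nonmeager in every nonempty
        open part of \<open>U\<close>, so by induction the basic sets on which \<open>S\<close> is
        comeager have a union that is dense in \<open>U\<close>. The rest of \<open>U\<close> is
        nowhere dense, and since the base is countable, \<open>U - S\<close> is meager, a
        contradiction.\<close>
      define \<G> where "\<G> = {V \<in> \<B>. V \<subseteq> U \<and> meager_in T (V - S)}"
      have "countable \<G>" using \<B>(1) by (simp add: \<G>_def)
      have sub: "\<Union>\<G> \<subseteq> U" by (auto simp: \<G>_def)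
      have opG: "openin T (\<Union>\<G>)" using \<B>(2) by (auto simp: \<G>_def)
      have hit: "V \<inter> \<Union>\<G> \<noteq> {}" if V: "openin T V" "V \<noteq> {}" "V \<subseteq> U" for V
      proof -
        have "V - (topspace T - S) = S \<inter> V" using openin_subset[OF V(1)] by auto
        then have "\<not> meager_in T (S \<inter> V)" using no V by metis
        from Compl.IH[OF V(1) this] obtain W where
          W: "openin T W" "W \<noteq> {}" "W \<subseteq> V" "meager_in T (W - S)" by blast
        obtain x where "x \<in> W" using W(2) by blast
        then obtain W' where W': "W' \<in> \<B>" "x \<in> W'" "W' \<subseteq> W" using \<B>(3)[OF W(1)] by blast
        then have "W' \<in> \<G>" using W V meager_in_subset[OF W(4), of "W' - S"] by (auto simp: \<G>_def)
        then show ?thesis using W' W by blast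
      qed
      have "meager_in T (T closure_of (\<Union>\<G>) - \<Union>\<G>)"
      proof (rule meager_in_nowhere_dense)
        show "closedin T (T closure_of \<Union>\<G> - \<Union>\<G>)" using opG by (simp add: closedin_diff)
        define O' where "O' = T interior_of (T closure_of \<Union>\<G> - \<Union>\<G>)"
        have "openin T O'" unfolding O'_def by simp
        moreover have "O' \<subseteq> T closure_of \<Union>\<G> - \<Union>\<G>"
          unfolding O'_def by (rule interior_of_subset)
        then have "O' \<subseteq> T closure_of \<Union>\<G>" "O' \<inter> \<Union>\<G> = {}" by blast+
        ultimately have "O' = {}"
          by (metis inf.absorb_iff1 openin_Int_closure_of_eq_empty)
        then show "T interior_of (T closure_of \<Union>\<G> - \<Union>\<G>) = {}" 
          by (simp add: O'_def)
      qed
      moreover have "meager_in T (\<Union>V\<in>\<G>. V - S)"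
        using \<open>countable \<G>\<close> by (rule meager_in_UN) (auto simp: \<G>_def)
      moreover have "U \<subseteq> T closure_of (\<Union>\<G>)"
      proof
        fix x assume "x \<in> U"
        have "\<exists>y\<in>\<Union>\<G>. y \<in> W" if "x \<in> W" "openin T W" for W
          using hit[of "W \<inter> U"] that \<open>x \<in> U\<close> Compl.prems(1) by (auto simp: openin_Int) 
        then show "x \<in> T closure_of \<Union>\<G>"
          using \<open>x \<in> U\<close> openin_subset[OF Compl.prems(1)] unfolding in_closure_of by blast
      qed
      ultimately have "meager_in T ((T closure_of (\<Union>\<G>) - \<Union>\<G>) \<union> (\<Union>V\<in>\<G>. V - S))"
        by (intro meager_in_Un)
      then have "meager_in T ((topspace T - S) \<inter> U)"
        by (rule meager_in_subset) (use \<open>U \<subseteq> T closure_of (\<Union>\<G>)\<close> in auto)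
      then show False using Compl.prems by simp
    qed
  next
    case (Union S)
    have eq: "(\<Union>i. S i) \<inter> U = (\<Union>i. S i \<inter> U)" by auto
    obtain i where "\<not> meager_in T (S i \<inter> U)"
      using meager_in_UN[of UNIV T "\<lambda>i. S i \<inter> U"] Union.prems(2) unfolding eq by auto
    from Union.IH[OF Union.prems(1) this] obtain V where
      V: "openin T V" "V \<noteq> {}" "V \<subseteq> U" "meager_in T (V - S i)" by blast
    then have "meager_in T (V - (\<Union>i. S i))" by (auto intro: meager_in_subset)
    with V show ?case by blast
  qed
qed

text \<open>The Montgomery--Novikov theorem on the category quantifier.\<close>

lemma borel_fibrewise_meager:
  fixes \<pi> :: "'h \<Rightarrow> 'y"
  defines "F \<equiv> \<lambda>H y. subtopology H {h \<in> topspace H. \<pi> h = y}"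
  assumes sc: "second_countable H" and om: "open_map H Y \<pi>"
    and cm: "\<And>y. y \<in> topspace Y \<Longrightarrow> completely_metrizable_space (F H y)"
    and S: "S \<in> sets (borel_measure_of H)" and U: "openin H U"
  shows "{y \<in> topspace Y. meager_in (F H y) {h \<in> S \<inter> U. \<pi> h = y}} \<in> sets (borel_measure_of Y)"
proof -
  obtain \<B> where \<B>: "countable \<B>" "\<And>V. V \<in> \<B> \<Longrightarrow> openin H V"
      "\<And>U x. openin H U \<Longrightarrow> x \<in> U \<Longrightarrow> \<exists>V\<in>\<B>. x \<in> V \<and> V \<subseteq> U"
    using sc unfolding second_countable_def by metis
  have opF: "openin (F H y) {h \<in> V. \<pi> h = y}" if "openin H V" for V y
    unfolding F_def openin_subtopology using that openin_subset[OF that] by (intro exI[of _ V]) auto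
  have top: "topspace Y \<in> sets (borel_measure_of Y)" by (simp add: openin_in_borel)
  \<comment> \<open>Fibres are Baire spaces, so an open set is meager in a fibre only if it misses
    the fibre. As \<open>\<pi>\<close> is open, this is a closed condition on
    \<open>y\<close>.\<close>
  have empt: "meager_in (F H y) {h \<in> V. \<pi> h = y} \<longleftrightarrow> y \<notin> \<pi> ` V" 
    if "openin H V" "y \<in> topspace Y" for V y
  proof
    assume "meager_in (F H y) {h \<in> V. \<pi> h = y}"
    then have "{h \<in> V. \<pi> h = y} = {}" using Baire_meager_openin cm opF that by blast
    then show "y \<notin> \<pi> ` V" by auto
  next
    assume "y \<notin> \<pi> ` V"
    then have e: "{h \<in> V. \<pi> h = y} = {}" by auto
    show "meager_in (F H y) {h \<in> V. \<pi> h = y}" unfolding e by (rule meager_in_empty)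
  qed
  have "S \<in> sigma_sets (topspace H) {U. openin H U}" using S by (simp add: sets_borel_measure_of)
  then show ?thesis using U
  proof (induction arbitrary: U)
    case (Basic S)
    then have o: "openin H (S \<inter> U)" by auto
    then have "openin Y (\<pi> ` (S \<inter> U))" using om by (simp add: open_map_def)
    moreover have "{y \<in> topspace Y. meager_in (F H y) {h \<in> S \<inter> U. \<pi> h = y}} = topspace Y - \<pi> ` (S \<inter> U)"
      using empt[OF o] by auto
    ultimately show ?case using top openin_in_borel by (metis sets.Diff)
  next
    case Empty
    then show ?case using top by simp
  next
    case (Compl S)
    define N where "N V = {y \<in> topspace Y. meager_in (F H y) {h \<in> S \<inter> V. \<pi> h = y}}" for V
    define \<U> where "\<U> = {V \<in> \<B>. V \<subseteq> U}"
    have Nb: "N V \<in> sets (borel_measure_of Y)" if "openin H V" for V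
      unfolding N_def using Compl.IH that by simp
    \<comment> \<open>Over \<open>y\<close>, the complement of \<open>S\<close> is nonmeager in
      \<open>U\<close> iff it is comeager in some basic \<open>V\<close> inside \<open>U\<close>
      that meets the fibre, that is, iff \<open>S\<close> is meager there. This needs the induction
      hypothesis for all \<open>V\<close>, and the base makes the union countable.\<close>
    have "{y \<in> topspace Y. meager_in (F H y) {h \<in> (topspace H - S) \<inter> U. \<pi> h = y}}
       = topspace Y - (\<Union>V\<in>\<U>. N V \<inter> \<pi> ` V)" (is "?L = ?R")
    proof (intro set_eqI iffI)
      fix y assume "y \<in> ?L"
      then have y: "y \<in> topspace Y" and m: "meager_in (F H y) {h \<in> (topspace H - S) \<inter> U. \<pi> h = y}" by auto
      have "y \<notin> N V \<inter> \<pi> ` V" if "V \<in> \<U>" for V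
      proof
        assume a: "y \<in> N V \<inter> \<pi> ` V"
        have V: "openin H V" "V \<subseteq> U" using that \<B>(2) by (auto simp: \<U>_def)
        have "meager_in (F H y) ({h \<in> (topspace H - S) \<inter> U. \<pi> h = y} \<union> {h \<in> S \<inter> V. \<pi> h = y})"
          using m a by (intro meager_in_Un) (auto simp: N_def)
        then have "meager_in (F H y) {h \<in> V. \<pi> h = y}"
          by (rule meager_in_subset) (use V openin_subset[OF V(1)] in auto)
        then show False using empt[OF V(1) y] a by auto
      qed
      then show "y \<in> ?R" using y by auto
    next
      fix y assume yR: "y \<in> ?R"
      then have y: "y \<in> topspace Y" by auto
      have "meager_in (F H y) {h \<in> (topspace H - S) \<inter> U. \<pi> h = y}"
      proof (rule ccontr)
        assume nm: "\<not> ?thesis"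
        have "topspace H - S \<in> sets (borel_measure_of H)"
          using Compl.hyps by (simp add: sets_borel_measure_of sigma_sets.Compl)
        moreover have "continuous_map (F H y) H (\<lambda>h. h)"
          unfolding F_def by (simp add: continuous_map_from_subtopology)
        ultimately have b: "{h \<in> topspace (F H y). h \<in> topspace H - S} \<in> sets (borel_measure_of (F H y))"
          by (intro borel_vimage)
        have scF: "second_countable (F H y)"
          using sc unfolding F_def by (rule second_countable_subtopology)
        have "{h \<in> topspace (F H y). h \<in> topspace H - S} \<inter> {h \<in> U. \<pi> h = y}
            = {h \<in> (topspace H - S) \<inter> U. \<pi> h = y}"
          using openin_subset[OF Compl.prems] by (auto simp: F_def)
        then obtain V where V: "openin (F H y) V" "V \<noteq> {}" "V \<subseteq> {h \<in> U. \<pi> h = y}"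
          "meager_in (F H y) (V - {h \<in> topspace (F H y). h \<in> topspace H - S})"
          using borel_locally_comeager[OF scF b opF[OF Compl.prems, of y]] nm by auto
        obtain V' where V': "openin H V'" "V = V' \<inter> {h \<in> topspace H. \<pi> h = y}"
          using V(1) unfolding F_def openin_subtopology by blast
        obtain x where x: "x \<in> V" using V(2) by blast
        have "openin H (V' \<inter> U)" "x \<in> V' \<inter> U" using V' V(3) x Compl.prems by auto
        then obtain W where W: "W \<in> \<B>" "x \<in> W" "W \<subseteq> V' \<inter> U" using \<B>(3) by meson
        have "{h \<in> S \<inter> W. \<pi> h = y} \<subseteq> V - {h \<in> topspace (F H y). h \<in> topspace H - S}"
          using W V' openin_subset[OF \<B>(2)[OF W(1)]] by auto
        then have "y \<in> N W" using y V(4) by (auto simp: N_def intro: meager_in_subset)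
        moreover have "y \<in> \<pi> ` W" using x V(3) W(2) by auto
        moreover have "W \<in> \<U>" using W by (simp add: \<U>_def)
        ultimately show False using yR by blast
      qed
      then show "y \<in> ?L" using y by simp
    qed
    moreover have "(\<Union>V\<in>\<U>. N V \<inter> \<pi> ` V) \<in> sets (borel_measure_of Y)"
    proof (rule sets.countable_UN'')
      show "countable \<U>" using \<B>(1) by (simp add: \<U>_def)
      fix V assume "V \<in> \<U>"
      then have V: "openin H V" using \<B>(2) by (simp add: \<U>_def)
      then have "openin Y (\<pi> ` V)" using om by (simp add: open_map_def)
      then show "N V \<inter> \<pi> ` V \<in> sets (borel_measure_of Y)"
        by (intro sets.Int Nb[OF V] openin_in_borel)
    qed
    ultimately show ?case using top by (metis sets.Diff)
  next
    case (Union S)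
    have "{y \<in> topspace Y. meager_in (F H y) {h \<in> (\<Union>i. S i) \<inter> U. \<pi> h = y}}
        = (\<Inter>i::nat. {y \<in> topspace Y. meager_in (F H y) {h \<in> S i \<inter> U. \<pi> h = y}})" (is "?L = ?R")
    proof
      show "?L \<subseteq> ?R" by (auto intro: meager_in_subset)
      show "?R \<subseteq> ?L"
      proof
        fix y assume y: "y \<in> ?R"
        have "{h \<in> (\<Union>i. S i) \<inter> U. \<pi> h = y} = (\<Union>i. {h \<in> S i \<inter> U. \<pi> h = y})" by auto
        moreover have "meager_in (F H y) (\<Union>i. {h \<in> S i \<inter> U. \<pi> h = y})"
          using y by (intro meager_in_UN) auto
        ultimately show "y \<in> ?L" using y by auto
      qed
    qed
    moreover have "?R \<in> sets (borel_measure_of Y)" using Union.IH Union.prems by blast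
    ultimately show ?case by simp
  qed
qed

text \<open>A subset of a class \<open>C\<close> is large if it is comeager in \<open>C\<close> with respect to \<open>\<tau>\<close>. As \<open>e1\<close> is
  continuous and open from the fibre of \<open>e0\<close> over any \<open>y \<in> C\<close> onto \<open>C\<close>, for Borel sets this can be
  tested in the fibre, where the category quantifier preserves Borel sets.\<close>

lemma idealistic_criterion:
  fixes Y :: "'y topology" and H :: "'h topology" and \<tau> :: "'y topology"
    and e0 e1 :: "'h \<Rightarrow> 'y" and E :: "('y \<times> 'y) set"
  defines "F \<equiv> \<lambda>y. subtopology H {h \<in> topspace H. e0 h = y}"
  assumes PY: "Polish_space Y" and eqv: "equiv (topspace Y) E"
    and sc: "second_countable H" and cm: "completely_metrizable_space H" and T1: "Hausdorff_space Y"
    and c0: "continuous_map H Y e0" and c1: "continuous_map H Y e1" and o0: "open_map H Y e0"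
    and E: "E = (\<lambda>h. (e0 h, e1 h)) ` topspace H"
    and fine: "\<And>U. openin Y U \<Longrightarrow> openin \<tau> U" and top: "topspace \<tau> = topspace Y"
    and cf: "\<And>y. y \<in> topspace Y \<Longrightarrow> continuous_map (F y) \<tau> e1"
    and of: "\<And>y. y \<in> topspace Y \<Longrightarrow> open_map (F y) \<tau> e1"
  shows "idealistic Y E"
proof -
  define T where "T C = subtopology \<tau> C" for C
  define \<F> where "\<F> C = {S. S \<subseteq> C \<and> meager_in (T C) (C - S)}" for C
  have sp0: "e0 h \<in> topspace Y" and sp1: "e1 h \<in> topspace Y" if "h \<in> topspace H" for h
    using c0 c1 that by (auto simp: continuous_map_def)
  have topF: "topspace (F y) = {h \<in> topspace H. e0 h = y}" for y by (auto simp: F_def)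
  have img: "e1 ` topspace (F y) = E `` {y}" for y
    unfolding topF E by auto
  have topT: "topspace (T (E `` {y})) = E `` {y}" for y
    unfolding T_def topspace_subtopology top using sp1 E by auto
  have cF: "continuous_map (F y) (T (E `` {y})) e1" if "y \<in> topspace Y" for y
    unfolding T_def continuous_map_in_subtopology using cf[OF that] img[of y] by auto
  have oF: "open_map (F y) (T (E `` {y})) e1" if "y \<in> topspace Y" for y
    unfolding T_def using of[OF that] img[of y]
    by (intro open_map_into_subtopology) (auto dest: openin_subset)
  have cmF: "completely_metrizable_space (F y)" if "y \<in> topspace Y" for y
  proof -
    have "closedin Y {y}" using T1 that by (simp add: closedin_Hausdorff_singleton)
    then have "closedin H {h \<in> topspace H. e0 h \<in> {y}}"
      using c0 by (rule closedin_continuous_map_preimage[rotated])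
    then show ?thesis unfolding F_def using cm by (simp add: completely_metrizable_space_closedin)
  qed
  have self: "y \<in> E `` {y}" if "y \<in> topspace Y" for y
    using eqv that by (auto simp: equiv_def refl_on_def)
  \<comment> \<open>The Baire property of the class comes from the completely metrizable fibre,
    since \<open>e1\<close> is a continuous open map of the fibre onto the class.\<close>
  have Baire: "meager_in (T (E `` {y})) V \<Longrightarrow> openin (T (E `` {y})) V \<Longrightarrow> V = {}" 
    if y: "y \<in> topspace Y" for y V
  proof -
    assume m: "meager_in (T (E `` {y})) V" and o: "openin (T (E `` {y})) V"
    have "meager_in (F y) {h \<in> topspace (F y). e1 h \<in> V}"
      using cF oF y m by (blast intro: meager_in_vimage)
    moreover have "openin (F y) {h \<in> topspace (F y). e1 h \<in> V}"
      using cF[OF y] o by (rule openin_continuous_map_preimage)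
    ultimately have "{h \<in> topspace (F y). e1 h \<in> V} = {}" using Baire_meager_openin cmF[OF y] by blast
    moreover have "V \<subseteq> e1 ` topspace (F y)" using openin_subset[OF o] topT[of y] img[of y] by simp
    ultimately show "V = {}" by blast
  qed
  have sf: "sigma_filter_on C (\<F> C)" if cls: "C \<in> topspace Y // E" for C
  proof -
    obtain y where y: "y \<in> topspace Y" and C: "C = E `` {y}" using cls by (auto elim: quotientE)
    have "openin (T C) C" using topT[of y] C openin_topspace by metis
    then have "\<not> meager_in (T C) C" using Baire[OF y, of C] self[OF y] C by auto
    then have ne: "S \<noteq> {}" if "S \<in> \<F> C" for S using that by (auto simp: \<F>_def)
    show ?thesis unfolding sigma_filter_on_def
    proof (intro conjI allI impI ballI)
      have "C \<in> \<F> C" by (simp add: \<F>_def)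
      then show "\<F> C \<noteq> {}" by blast
    next
      fix S assume "S \<in> \<F> C" then show "S \<subseteq> C" "S \<noteq> {}" using ne by (auto simp: \<F>_def)
    next
      fix S S' assume "S \<in> \<F> C" "S \<subseteq> S' \<and> S' \<subseteq> C"
      then show "S' \<in> \<F> C" by (auto simp: \<F>_def intro: meager_in_subset)
    next
      fix \<S> assume S: "\<S> \<subseteq> \<F> C \<and> countable \<S> \<and> \<S> \<noteq> {}"
      have "meager_in (T C) (\<Union>S\<in>\<S>. C - S)" using S by (intro meager_in_UN) (auto simp: \<F>_def)
      then have "meager_in (T C) (C - \<Inter>\<S>)" by (rule meager_in_subset) auto
      moreover have "\<Inter>\<S> \<subseteq> C" using S by (auto simp: \<F>_def)
      ultimately show "\<Inter>\<S> \<in> \<F> C" unfolding \<F>_def by blast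
    qed
  qed
  have bor: "{y \<in> topspace Y. {y' \<in> E `` {y}. (y, y') \<in> B} \<in> \<F> (E `` {y})} \<in> sets (borel_measure_of Y)"
    if B: "B \<in> sets (borel_measure_of (prod_topology Y Y))" for B
  proof -
    \<comment> \<open>The homotopies whose pair of ends avoids \<open>B\<close>. Over
      \<open>y\<close> they form the preimage under \<open>e1\<close> of the part of the class
      outside the section of \<open>B\<close> at \<open>y\<close>.\<close>
    define S where "S = {h \<in> topspace H. (e0 h, e1 h) \<in> topspace (prod_topology Y Y) - B}"
    have Bc: "topspace (prod_topology Y Y) - B \<in> sets (borel_measure_of (prod_topology Y Y))"
      using B openin_in_borel[OF openin_topspace] by (rule sets.Diff[rotated])
    have "continuous_map H (prod_topology Y Y) (\<lambda>h. (e0 h, e1 h))"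
      using c0 c1 by (simp add: continuous_map_pairedI)
    then have S: "S \<in> sets (borel_measure_of H)"
      unfolding S_def using Bc by (rule borel_vimage)
    have key: "{y' \<in> E `` {y}. (y, y') \<in> B} \<in> \<F> (E `` {y}) \<longleftrightarrow>
        meager_in (F y) {h \<in> S \<inter> topspace H. e0 h = y}" if y: "y \<in> topspace Y" for y
    proof -
      let ?C = "E `` {y}"
      define R where "R = ?C - {y' \<in> ?C. (y, y') \<in> B}"
      have Rpre: "{h \<in> topspace (F y). e1 h \<in> R} = {h \<in> S \<inter> topspace H. e0 h = y}"
        unfolding R_def S_def topF E using sp1 y by auto
      have "meager_in (T ?C) R \<longleftrightarrow> meager_in (F y) {h \<in> topspace (F y). e1 h \<in> R}"
      proof
        assume "meager_in (T ?C) R"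
        then show "meager_in (F y) {h \<in> topspace (F y). e1 h \<in> R}"
          using cF oF y by (blast intro: meager_in_vimage)
      next
        \<comment> \<open>Here it matters that \<open>R\<close> is Borel: a nonmeager
          \<open>R\<close> is comeager in a nonempty open \<open>V\<close>, and then the preimage of
          \<open>V\<close> is an open meager subset of the fibre, contradicting Baire's
          theorem.\<close>
        assume m: "meager_in (F y) {h \<in> topspace (F y). e1 h \<in> R}"
        have scT: "second_countable (T ?C)"
        proof -
          have "second_countable (F y)" using sc unfolding F_def by (rule second_countable_subtopology)
          moreover have "e1 ` topspace (F y) = topspace (T ?C)" using img topT by simp
          ultimately show ?thesis using second_countable_open_map_image cF[OF y] oF[OF y] by metis
        qed
        \<comment> \<open>\<open>B\<close> is Borel for the topology of \<open>Y\<close>; as the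
          class carries a finer topology, the sections of \<open>B\<close> remain Borel in
          it.\<close>
        have fineT: "continuous_map (T ?C) Y (\<lambda>y'. y')"
          unfolding continuous_map topT
        proof (intro conjI allI impI)
          show "(\<lambda>y'. y') ` ?C \<subseteq> topspace Y" using E sp1 by auto
          fix U assume "openin Y U"
          then have "openin \<tau> U" by (rule fine)
          moreover have "{y' \<in> ?C. y' \<in> U} = U \<inter> ?C" by auto
          ultimately show "openin (T ?C) {y' \<in> ?C. y' \<in> U}"
            unfolding T_def openin_subtopology by auto
        qed
        have "continuous_map (T ?C) (prod_topology Y Y) (\<lambda>y'. (y, y'))"
          using fineT y by (simp add: continuous_map_pairedI)
        from borel_vimage[OF this Bc] have "R \<in> sets (borel_measure_of (T ?C))"
        proof -
          have "{y' \<in> topspace (T ?C). (y, y') \<in> topspace (prod_topology Y Y) - B} = R"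
            unfolding topT R_def using E sp1 y by auto
          with borel_vimage[OF \<open>continuous_map (T ?C) (prod_topology Y Y) (\<lambda>y'. (y, y'))\<close> Bc]
          show ?thesis by simp
        qed
        show "meager_in (T ?C) R"
        proof (rule ccontr)
          assume nm: "\<not> meager_in (T ?C) R"
          have "R \<inter> ?C = R" by (auto simp: R_def)
          moreover have "openin (T ?C) ?C" using topT openin_topspace by metis
          ultimately obtain V where V: "openin (T ?C) V" "V \<noteq> {}" "meager_in (T ?C) (V - R)"
            using borel_locally_comeager[OF scT \<open>R \<in> sets (borel_measure_of (T ?C))\<close>, of ?C] nm by auto
          have "meager_in (F y) {h \<in> topspace (F y). e1 h \<in> V - R}"
            using cF oF y V(3) by (blast intro: meager_in_vimage)
          with m have "meager_in (F y) ({h \<in> topspace (F y). e1 h \<in> R} \<union> {h \<in> topspace (F y). e1 h \<in> V - R})"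
            by (rule meager_in_Un)
          then have "meager_in (F y) {h \<in> topspace (F y). e1 h \<in> V}"
            by (rule meager_in_subset) auto
          moreover have "openin (F y) {h \<in> topspace (F y). e1 h \<in> V}"
            using cF[OF y] V(1) by (rule openin_continuous_map_preimage)
          ultimately have "{h \<in> topspace (F y). e1 h \<in> V} = {}"
            using Baire_meager_openin cmF[OF y] by blast
          moreover have "V \<subseteq> e1 ` topspace (F y)"
            using openin_subset[OF V(1)] topT[of y] img[of y] by simp
          ultimately show False using V(2) by blast
        qed
      qed
      moreover have "{y' \<in> ?C. (y, y') \<in> B} \<in> \<F> ?C \<longleftrightarrow> meager_in (T ?C) R"
        by (auto simp: \<F>_def R_def)
      ultimately show ?thesis using Rpre by simp
    qed
    have "{y \<in> topspace Y. {y' \<in> E `` {y}. (y, y') \<in> B} \<in> \<F> (E `` {y})}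
        = {y \<in> topspace Y. meager_in (F y) {h \<in> S \<inter> topspace H. e0 h = y}}"
      using key by auto
    also have "\<dots> \<in> sets (borel_measure_of Y)"
      unfolding F_def
      by (rule borel_fibrewise_meager[OF sc o0 _ S openin_topspace]) (use cmF in \<open>simp add: F_def\<close>)
    finally show ?thesis .
  qed
  show ?thesis unfolding idealistic_def
    by (intro conjI PY eqv exI[of _ \<F>] exI[of _ "\<lambda>y. y"])
      (use sf bor self in auto)
qed

section \<open>Spaces of maps into a metric space\<close>

lemma compactin_finite_subcover:
  assumes "compactin X K" "\<And>x. x \<in> K \<Longrightarrow> openin X (V x)" "\<And>x. x \<in> K \<Longrightarrow> x \<in> V x"
  obtains F where "finite F" "F \<subseteq> K" "K \<subseteq> (\<Union>x\<in>F. V x)"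
proof -
  have "\<exists>\<F>. finite \<F> \<and> \<F> \<subseteq> V ` K \<and> K \<subseteq> \<Union>\<F>"
    using assms by (intro compactinD) auto
  then obtain \<F> where "finite \<F>" "\<F> \<subseteq> V ` K" "K \<subseteq> \<Union>\<F>" by blast
  moreover obtain F where "F \<subseteq> K" "finite F" "\<F> = V ` F"
    using finite_subset_image[OF \<open>finite \<F>\<close> \<open>\<F> \<subseteq> V ` K\<close>] by blast
  ultimately show thesis using that by blast
qed

lemma second_countable_prod_topology:
  assumes "second_countable X" "second_countable Y"
  shows "second_countable (prod_topology X Y)"
proof -
  obtain \<B> where \<B>: "countable \<B>" "\<And>V. V \<in> \<B> \<Longrightarrow> openin X V"
      "\<And>U x. openin X U \<Longrightarrow> x \<in> U \<Longrightarrow> \<exists>V\<in>\<B>. x \<in> V \<and> V \<subseteq> U"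
    using assms(1) unfolding second_countable_def by metis
  obtain \<C> where \<C>: "countable \<C>" "\<And>V. V \<in> \<C> \<Longrightarrow> openin Y V"
      "\<And>U x. openin Y U \<Longrightarrow> x \<in> U \<Longrightarrow> \<exists>V\<in>\<C>. x \<in> V \<and> V \<subseteq> U"
    using assms(2) unfolding second_countable_def by metis
  show ?thesis unfolding second_countable_def
  proof (intro exI[of _ "(\<lambda>(B, C). B \<times> C) ` (\<B> \<times> \<C>)"] conjI ballI allI impI)
    show "countable ((\<lambda>(B, C). B \<times> C) ` (\<B> \<times> \<C>))" using \<B>(1) \<C>(1) by simp
  next
    fix V assume "V \<in> (\<lambda>(B, C). B \<times> C) ` (\<B> \<times> \<C>)"
    then show "openin (prod_topology X Y) V" using \<B>(2) \<C>(2) by (auto simp: openin_prod_Times_iff)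
  next
    fix U z assume "openin (prod_topology X Y) U \<and> z \<in> U"
    then obtain R S where RS: "openin X R" "openin Y S" "fst z \<in> R" "snd z \<in> S" "R \<times> S \<subseteq> U"
      unfolding openin_prod_topology_alt by (metis prod.collapse)
    obtain B where "B \<in> \<B>" "fst z \<in> B" "B \<subseteq> R" using \<B>(3)[OF RS(1,3)] by blast
    moreover obtain C where "C \<in> \<C>" "snd z \<in> C" "C \<subseteq> S" using \<C>(3)[OF RS(2,4)] by blast
    ultimately show "\<exists>V\<in>(\<lambda>(B, C). B \<times> C) ` (\<B> \<times> \<C>). z \<in> V \<and> V \<subseteq> U"
      by (intro bexI[of _ "B \<times> C"]) (use RS(5) in \<open>auto simp: mem_Times_iff\<close>)
  qed
qed

lemma second_countable_euclidean: "second_countable (euclidean :: 'a::second_countable_topology topology)"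
proof -
  obtain B :: "'a set set" where B: "countable B" "\<And>C. C \<in> B \<Longrightarrow> open C" "\<And>S. open S \<Longrightarrow> \<exists>U. U \<subseteq> B \<and> S = \<Union>U"
    using univ_second_countable by blast
  show ?thesis unfolding second_countable_def
  proof (intro exI[of _ B] conjI ballI allI impI B(1))
    show "openin euclidean C" if "C \<in> B" for C using B(2)[OF that] by simp
    fix U x assume U: "openin euclidean U \<and> x \<in> (U :: 'a set)"
    then obtain W where "W \<subseteq> B" "U = \<Union>W" using B(3)[of U] by auto
    then show "\<exists>V\<in>B. x \<in> V \<and> V \<subseteq> U" using U by blast
  qed
qed

lemma (in Metric_space) second_countable_mtopology:
  assumes "separable_space mtopology"
  shows "second_countable mtopology"
proof -
  obtain Q where Q: "countable Q" "Q \<subseteq> M" "mtopology closure_of Q = M"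
    using assms unfolding separable_space_def by auto
  show ?thesis unfolding second_countable_def
  proof (intro exI[of _ "(\<lambda>(q, n). mball q (inverse (real (Suc n)))) ` (Q \<times> UNIV)"] conjI ballI allI impI)
    show "countable ((\<lambda>(q, n). mball q (inverse (real (Suc n)))) ` (Q \<times> UNIV))" using Q(1) by simp
  next
    fix V assume "V \<in> (\<lambda>(q, n). mball q (inverse (real (Suc n)))) ` (Q \<times> UNIV)"
    then show "openin mtopology V" by auto
  next
    fix U x assume "openin mtopology U \<and> x \<in> U"
    then obtain r where r: "x \<in> M" "r > 0" "mball x r \<subseteq> U" unfolding openin_mtopology by blast
    obtain n where n: "inverse (real (Suc n)) < r / 2" using r(2) reals_Archimedean[of "r/2"] by auto
    have "x \<in> mtopology closure_of Q" using Q r by simp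
    then obtain q where q: "q \<in> Q" "q \<in> mball x (inverse (real (Suc n)))"
      unfolding metric_closure_of by (smt (verit) mem_Collect_eq inverse_positive_iff_positive of_nat_0_less_iff zero_less_Suc)
    have "mball q (inverse (real (Suc n))) \<subseteq> mball x r"
    proof
      fix z assume z: "z \<in> mball q (inverse (real (Suc n)))"
      then have "d x z \<le> d x q + d q z" using q by (intro triangle) auto
      then show "z \<in> mball x r" using z q n by auto
    qed
    then show "\<exists>V\<in>(\<lambda>(q, n). mball q (inverse (real (Suc n)))) ` (Q \<times> UNIV). x \<in> V \<and> V \<subseteq> U"
      using q r(3) by (intro bexI[of _ "mball q (inverse (real (Suc n)))"]) (auto simp: commute)
  qed
qed

lemma Polish_space_imp_second_countable:
  assumes "Polish_space X"
  shows "second_countable X"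
proof -
  obtain M d where "Metric_space M d" "X = Metric_space.mtopology M d"
    using assms unfolding Polish_space_def completely_metrizable_space_def by blast
  then show ?thesis
    using Metric_space.second_countable_mtopology assms unfolding Polish_space_def by blast
qed

text \<open>Not only every point but every compact set is caught by a single \<open>C n\<close>.
  Thus countably many compact sets determine the compact-open topology, which is what makes it
  metrizable.\<close>

lemma compact_exhaustion:
  assumes "second_countable X" "locally_compact_space X" "Hausdorff_space X"
  obtains C :: "nat \<Rightarrow> 'a set" where "\<And>n. compactin X (C n)" "\<And>m n. m \<le> n \<Longrightarrow> C m \<subseteq> C n"
    "\<And>K. compactin X K \<Longrightarrow> \<exists>n. K \<subseteq> C n"
proof -
  obtain \<B> where \<B>: "countable \<B>" "\<And>V. V \<in> \<B> \<Longrightarrow> openin X V"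
      "\<And>U x. openin X U \<Longrightarrow> x \<in> U \<Longrightarrow> \<exists>V\<in>\<B>. x \<in> V \<and> V \<subseteq> U"
    using assms(1) unfolding second_countable_def by metis
  \<comment> \<open>The empty set is added so that \<open>from_nat_into\<close> always has a
    nonempty set to enumerate.\<close>
  define \<K> where "\<K> = insert {} {B \<in> \<B>. compactin X (X closure_of B)}"
  have \<K>: "countable \<K>" "\<K> \<noteq> {}" using \<B>(1) by (auto simp: \<K>_def)
  have cK: "compactin X (X closure_of B)" if "B \<in> \<K>" for B using that by (auto simp: \<K>_def)
  define C where "C n = (\<Union>i\<le>n. X closure_of (from_nat_into \<K> i))" for n
  show ?thesis
  proof
    show "compactin X (C n)" for n
      unfolding C_def using cK from_nat_into[OF \<K>(2)] by (intro compactin_Union) auto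
    show "m \<le> n \<Longrightarrow> C m \<subseteq> C n" for m n unfolding C_def by force
  next
    fix K assume K: "compactin X K"
    have "\<exists>B\<in>\<K>. x \<in> B" if "x \<in> K" for x
    proof -
      have "x \<in> topspace X" using K that compactin_subset_topspace by blast
      then obtain U where U: "openin X U" "compactin X (X closure_of U)" "x \<in> U"
        using assms locally_compact_space_compact_closure_of by blast
      then obtain B where B: "B \<in> \<B>" "x \<in> B" "B \<subseteq> U" using \<B>(3) by blast
      then have "compactin X (X closure_of B)"
        using U(2) closed_compactin closedin_closure_of closure_of_mono by metis
      then show ?thesis using B by (auto simp: \<K>_def)
    qed
    then have "K \<subseteq> \<Union>\<K>" by blast
    moreover have "\<forall>B\<in>\<K>. openin X B" using \<B>(2) by (auto simp: \<K>_def)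
    ultimately obtain \<F> where \<F>: "finite \<F>" "\<F> \<subseteq> \<K>" "K \<subseteq> \<Union>\<F>"
      using K unfolding compactin_def by meson
    define n where "n = Max (insert 0 (to_nat_on \<K> ` \<F>))"
    have "B \<subseteq> C n" if "B \<in> \<F>" for B
    proof -
      have "B \<in> \<K>" using that \<F> by blast
      then have "from_nat_into \<K> (to_nat_on \<K> B) = B" using \<K>(1) by simp
      moreover have "to_nat_on \<K> B \<le> n" unfolding n_def using \<F>(1) that by simp
      ultimately have "X closure_of B \<subseteq> C n" unfolding C_def by (auto intro!: bexI[of _ "to_nat_on \<K> B"])
      moreover have "B \<subseteq> X closure_of B"
        using \<B>(2) \<open>B \<in> \<K>\<close> by (auto simp: \<K>_def intro!: closure_of_subset dest: openin_subset)
      ultimately show ?thesis by blast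
    qed
    then show "\<exists>n. K \<subseteq> C n" using \<F>(3) by blast
  qed
qed

section \<open>The compact-open topology for a metric target\<close>

context Metric_space
begin

lemma continuous_map_d:
  assumes "continuous_map X mtopology f" "continuous_map X mtopology g"
  shows "continuous_map X euclideanreal (\<lambda>x. d (f x) (g x))"
proof -
  have "mtopology_of (metric (M, d)) = mtopology"
    by (simp add: mtopology_of_def mspace_metric mdist_metric)
  then show ?thesis
    using continuous_map_mdist[of X "metric (M, d)" f g] assms by (simp add: mdist_metric)
qed

lemma pair_maps_in_M: "f \<in> pair_maps X A mtopology p \<Longrightarrow> x \<in> topspace X \<Longrightarrow> f x \<in> M"
  by (auto simp: pair_maps_def continuous_map_def)

definition compact_nbhd :: "'b topology \<Rightarrow> 'b set \<Rightarrow> 'a \<Rightarrow> ('b \<Rightarrow> 'a) \<Rightarrow> 'b set \<Rightarrow> real \<Rightarrow> ('b \<Rightarrow> 'a) set" where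
  "compact_nbhd X A p f C \<epsilon> = {g \<in> pair_maps X A mtopology p. \<forall>x\<in>C. d (f x) (g x) < \<epsilon>}"

lemma compact_nbhd_mono: "C \<subseteq> C' \<Longrightarrow> \<epsilon>' \<le> \<epsilon> \<Longrightarrow> compact_nbhd X A p f C' \<epsilon>' \<subseteq> compact_nbhd X A p f C \<epsilon>"
  by (force simp: compact_nbhd_def)

lemma compact_subset_open_ball:
  assumes "compactin mtopology K" "openin mtopology U" "K \<subseteq> U"
  shows "\<exists>\<epsilon>>0. \<forall>x\<in>K. mball x \<epsilon> \<subseteq> U"
proof -
  have KM: "K \<subseteq> M" using assms(1) compactin_subset_topspace by fastforce
  have "\<forall>x\<in>K. \<exists>r>0. mball x r \<subseteq> U" using assms unfolding openin_mtopology by blast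
  from bchoice[OF this] obtain r where r: "\<And>x. x \<in> K \<Longrightarrow> r x > 0 \<and> mball x (r x) \<subseteq> U" by blast
  obtain F where F: "finite F" "F \<subseteq> K" "K \<subseteq> (\<Union>x\<in>F. mball x (r x / 2))"
    by (rule compactin_finite_subcover[OF assms(1), of "\<lambda>x. mball x (r x / 2)"]) (use r KM in auto)
  define \<epsilon> where "\<epsilon> = Min (insert 1 ((\<lambda>x. r x / 2) ` F))"
  have pos: "\<epsilon> > 0" unfolding \<epsilon>_def using F r by (subst Min_gr_iff) auto
  have "mball x \<epsilon> \<subseteq> U" if x: "x \<in> K" for x
  proof -
    obtain z where z: "z \<in> F" "x \<in> mball z (r z / 2)" using F(3) x by blast
    have le: "\<epsilon> \<le> r z / 2" unfolding \<epsilon>_def using F(1) z(1) by (intro Min_le) auto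
    have "mball x \<epsilon> \<subseteq> mball z (r z)"
    proof
      fix w assume w: "w \<in> mball x \<epsilon>"
      then have "d z w \<le> d z x + d x w" using z by (intro triangle) auto
      then show "w \<in> mball z (r z)" using w z(2) le by auto
    qed
    then show ?thesis using r z(1) F(2) by blast
  qed
  with pos show ?thesis by blast
qed

text \<open>A metric on the target turns the subbasic conditions into uniform closeness on compact
  sets. Later arguments about map spaces mostly use this form, as it allows estimates by the
  triangle inequality.\<close>

lemma openin_map_space_iff:
  "openin (map_space X A mtopology p) W \<longleftrightarrow> W \<subseteq> pair_maps X A mtopology p \<and>
     (\<forall>f\<in>W. \<exists>C \<epsilon>. compactin X C \<and> \<epsilon> > 0 \<and> compact_nbhd X A p f C \<epsilon> \<subseteq> W)"
proof
  assume o: "openin (map_space X A mtopology p) W"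
  define \<S> where "\<S> = {{f \<in> extensional (topspace X). continuous_map X mtopology f \<and> f ` C \<subseteq> U} | C U.
                        compactin X C \<and> openin mtopology U}"
  obtain W' where W': "generate_topology_on \<S> W'" "W = W' \<inter> pair_maps X A mtopology p"
    using o unfolding map_space_def openin_subtopology compact_open_topology_def
      openin_topology_generated_by_iff \<S>_def by blast
  have gen: "\<exists>C \<epsilon>. compactin X C \<and> \<epsilon> > 0 \<and> compact_nbhd X A p f C \<epsilon> \<subseteq> W'"
    if "f \<in> W'" "f \<in> pair_maps X A mtopology p" for f
    using W'(1) that
  proof (induction arbitrary: f)
    case Empty
    then show ?case by simp
  next
    case (Int a b)
    have fab: "f \<in> a" "f \<in> b" using Int.prems(1) by auto
    obtain C \<epsilon> where 1: "compactin X C" "\<epsilon> > 0" "compact_nbhd X A p f C \<epsilon> \<subseteq> a"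
      using Int.IH(1)[OF fab(1) Int.prems(2)] by blast
    obtain C' \<epsilon>' where 2: "compactin X C'" "\<epsilon>' > 0" "compact_nbhd X A p f C' \<epsilon>' \<subseteq> b"
      using Int.IH(2)[OF fab(2) Int.prems(2)] by blast
    have "compact_nbhd X A p f (C \<union> C') (min \<epsilon> \<epsilon>') \<subseteq> a \<inter> b"
      using 1(3) 2(3) compact_nbhd_mono[of C "C \<union> C'" "min \<epsilon> \<epsilon>'" \<epsilon> X A p f]
        compact_nbhd_mono[of C' "C \<union> C'" "min \<epsilon> \<epsilon>'" \<epsilon>' X A p f] by auto
    then show ?case using 1 2 by (intro exI[of _ "C \<union> C'"] exI[of _ "min \<epsilon> \<epsilon>'"]) (auto simp: compactin_Un)
  next
    case (UN K)
    then obtain k where "k \<in> K" "f \<in> k" by blast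
    from UN.IH[OF this(1) this(2) UN.prems(2)] \<open>k \<in> K\<close> show ?case by blast
  next
    case (Basis s)
    then obtain C U where s: "s = {f \<in> extensional (topspace X). continuous_map X mtopology f \<and> f ` C \<subseteq> U}"
      "compactin X C" "openin mtopology U" unfolding \<S>_def by blast
    have "compactin mtopology (f ` C)" using s(1,2) Basis.prems(1) by (auto intro: image_compactin)
    then obtain \<epsilon> where e: "\<epsilon> > 0" "\<forall>x\<in>f ` C. mball x \<epsilon> \<subseteq> U"
      using compact_subset_open_ball[OF _ s(3)] s(1) Basis.prems(1) by blast
    have "compact_nbhd X A p f C \<epsilon> \<subseteq> s"
    proof
      fix g assume g: "g \<in> compact_nbhd X A p f C \<epsilon>"
      have "g x \<in> U" if "x \<in> C" for x
      proof -
        have "x \<in> topspace X" using s(2) that compactin_subset_topspace by blast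
        then have "g x \<in> mball (f x) \<epsilon>"
          using g that Basis.prems(2) by (auto simp: compact_nbhd_def pair_maps_in_M)
        then show ?thesis using e(2) that by blast
      qed
      then show "g \<in> s" using g unfolding s(1) by (auto simp: compact_nbhd_def pair_maps_def)
    qed
    then show ?case using s(2) e(1) by blast
  qed
  have "\<exists>C \<epsilon>. compactin X C \<and> \<epsilon> > 0 \<and> compact_nbhd X A p f C \<epsilon> \<subseteq> W" if "f \<in> W" for f
  proof -
    have f: "f \<in> W'" "f \<in> pair_maps X A mtopology p" using that W'(2) by auto
    obtain C \<epsilon> where C: "compactin X C" "\<epsilon> > 0" "compact_nbhd X A p f C \<epsilon> \<subseteq> W'"
      using gen[OF f] by (elim exE conjE)
    have "compact_nbhd X A p f C \<epsilon> \<subseteq> pair_maps X A mtopology p" by (auto simp: compact_nbhd_def)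
    with C W'(2) have "compact_nbhd X A p f C \<epsilon> \<subseteq> W" by blast
    with C show ?thesis by (intro exI conjI)
  qed
  then show "W \<subseteq> pair_maps X A mtopology p \<and>
     (\<forall>f\<in>W. \<exists>C \<epsilon>. compactin X C \<and> \<epsilon> > 0 \<and> compact_nbhd X A p f C \<epsilon> \<subseteq> W)"
    using W'(2) by blast
next
  assume R: "W \<subseteq> pair_maps X A mtopology p \<and>
     (\<forall>f\<in>W. \<exists>C \<epsilon>. compactin X C \<and> \<epsilon> > 0 \<and> compact_nbhd X A p f C \<epsilon> \<subseteq> W)"
  show "openin (map_space X A mtopology p) W"
  proof (subst openin_subopen, intro ballI)
    fix f assume f: "f \<in> W"
    obtain C \<epsilon> where C: "compactin X C" "\<epsilon> > 0" "compact_nbhd X A p f C \<epsilon> \<subseteq> W"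
      using bspec[OF conjunct2[OF R] f] by (elim exE conjE)
    have fp: "f \<in> pair_maps X A mtopology p" using f conjunct1[OF R] by blast
    then have cf: "continuous_map X mtopology f" by (simp add: pair_maps_def)
    have CX: "C \<subseteq> topspace X" using C(1) compactin_subset_topspace by blast
    \<comment> \<open>The closed ball makes \<open>K x\<close> compact, and the open sets
      \<open>V x\<close> yield a finite cover of \<open>C\<close>. As \<open>\<epsilon>/3\<close> is
      less than \<open>\<epsilon>/2\<close>, the map \<open>f\<close> itself satisfies the subbasic
      condition on \<open>K x\<close> below; as \<open>\<epsilon>/3 + \<epsilon>/2\<close> is less
      than \<open>\<epsilon>\<close>, every map that satisfies these conditions is close enough to
      \<open>f\<close>.\<close>
    define K where "K x = C \<inter> {z \<in> topspace X. f z \<in> mcball (f x) (\<epsilon>/3)}" for x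
    define V where "V x = {z \<in> topspace X. f z \<in> mball (f x) (\<epsilon>/3)}" for x
    have cK: "compactin X (K x)" for x
      unfolding K_def by (intro compact_Int_closedin C(1) closedin_continuous_map_preimage[OF cf]) simp
    have oV: "openin X (V x)" for x
      unfolding V_def by (intro openin_continuous_map_preimage[OF cf]) simp
    have Vx: "x \<in> V x" if "x \<in> C" for x
      using that CX C(2) pair_maps_in_M[OF fp] by (auto simp: V_def)
    obtain F where F: "finite F" "F \<subseteq> C" "C \<subseteq> (\<Union>x\<in>F. V x)"
      by (rule compactin_finite_subcover[OF C(1) oV Vx])
    define S where "S x = {g \<in> extensional (topspace X). continuous_map X mtopology g \<and> g ` K x \<subseteq> mball (f x) (\<epsilon>/2)}" for x
    have oS: "openin (map_space X A mtopology p) (S x \<inter> pair_maps X A mtopology p)" for x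
    proof -
      have "openin (compact_open_topology X mtopology) (S x)"
        unfolding compact_open_topology_def openin_topology_generated_by_iff S_def
        by (rule generate_topology_on.Basis) (use cK in blast)
      then show ?thesis unfolding map_space_def openin_subtopology by blast
    qed
    define T where "T = pair_maps X A mtopology p \<inter> \<Inter>((\<lambda>x. S x \<inter> pair_maps X A mtopology p) ` F)"
    have oT: "openin (map_space X A mtopology p) T"
    proof (cases "F = {}")
      case True
      then show ?thesis unfolding T_def using openin_topspace[of "map_space X A mtopology p"]
        by (simp add: topspace_map_space)
    next
      case False
      then have "openin (map_space X A mtopology p) (\<Inter>((\<lambda>x. S x \<inter> pair_maps X A mtopology p) ` F))"
        using F(1) oS by (intro openin_Inter) auto
      then show ?thesis unfolding T_def
        using openin_topspace[of "map_space X A mtopology p"] by (simp add: topspace_map_space openin_Int)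
    qed
    have fT: "f \<in> T"
    proof -
      have "f z \<in> mball (f x) (\<epsilon>/2)" if "z \<in> K x" "x \<in> F" for x z
        using that C(2) unfolding K_def by auto
      then have "f \<in> S x" if "x \<in> F" for x using that fp by (auto simp: S_def pair_maps_def)
      then show ?thesis using fp by (auto simp: T_def)
    qed
    have "T \<subseteq> compact_nbhd X A p f C \<epsilon>"
    proof
      fix g assume g: "g \<in> T"
      have gp: "g \<in> pair_maps X A mtopology p" using g by (simp add: T_def)
      have "d (f z) (g z) < \<epsilon>" if z: "z \<in> C" for z
      proof -
        obtain x where x: "x \<in> F" "z \<in> V x" using F(3) z by blast
        then have "z \<in> K x" using z mball_subset_mcball unfolding V_def K_def by blast
        moreover have "g \<in> S x" using g x(1) unfolding T_def by blast
        ultimately have gz: "g z \<in> mball (f x) (\<epsilon>/2)" unfolding S_def by blast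
        have fz: "f z \<in> mball (f x) (\<epsilon>/3)" using x(2) by (simp add: V_def)
        have "d (f z) (g z) \<le> d (f z) (f x) + d (f x) (g z)" using gz fz by (intro triangle) auto
        then show ?thesis using gz fz C(2) by (auto simp: commute)
      qed
      then show "g \<in> compact_nbhd X A p f C \<epsilon>" using gp by (simp add: compact_nbhd_def)
    qed
    then show "\<exists>T. openin (map_space X A mtopology p) T \<and> f \<in> T \<and> T \<subseteq> W" using oT fT C(3) by blast
  qed
qed

lemma openin_compact_nbhd:
  assumes "compactin X C" "f \<in> pair_maps X A mtopology p"
  shows "openin (map_space X A mtopology p) (compact_nbhd X A p f C \<epsilon>)"
  unfolding openin_map_space_iff
proof (intro conjI ballI)
  show "compact_nbhd X A p f C \<epsilon> \<subseteq> pair_maps X A mtopology p" by (auto simp: compact_nbhd_def)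
  fix g assume g: "g \<in> compact_nbhd X A p f C \<epsilon>"
  then have gp: "g \<in> pair_maps X A mtopology p" by (simp add: compact_nbhd_def)
  have CX: "C \<subseteq> topspace X" using assms(1) compactin_subset_topspace by blast
  have "continuous_map X euclideanreal (\<lambda>x. d (f x) (g x))"
    using gp assms(2) by (intro continuous_map_d) (auto simp: pair_maps_def)
  then have "compact ((\<lambda>x. d (f x) (g x)) ` C)"
    using image_compactin[OF assms(1)] by fastforce
  \<comment> \<open>On the compact set \<open>C\<close> the distance attains a maximum
    \<open>m\<close> below \<open>\<epsilon>\<close>, so \<open>\<epsilon> - m\<close> is left to
    spare. For empty \<open>C\<close> any number below \<open>\<epsilon>\<close> serves.\<close>
  then obtain m where m: "m < \<epsilon>" "\<forall>x\<in>C. d (f x) (g x) \<le> m"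
  proof (cases "C = {}")
    case True
    then show ?thesis using that[of "\<epsilon> - 1"] by simp
  next
    case False
    then obtain x where "x \<in> C" "\<forall>y\<in>C. d (f y) (g y) \<le> d (f x) (g x)"
      using compact_attains_sup[OF \<open>compact ((\<lambda>x. d (f x) (g x)) ` C)\<close>] by blast
    then show ?thesis using that[of "d (f x) (g x)"] g by (auto simp: compact_nbhd_def)
  qed
  have "compact_nbhd X A p g C (\<epsilon> - m) \<subseteq> compact_nbhd X A p f C \<epsilon>"
  proof
    fix k assume k: "k \<in> compact_nbhd X A p g C (\<epsilon> - m)"
    then have kp: "k \<in> pair_maps X A mtopology p" by (simp add: compact_nbhd_def)
    have "d (f x) (k x) < \<epsilon>" if x: "x \<in> C" for x
    proof -
      have "x \<in> topspace X" using x CX by blast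
      then have "d (f x) (k x) \<le> d (f x) (g x) + d (g x) (k x)"
        using kp gp assms(2) by (intro triangle pair_maps_in_M)
      moreover have "d (g x) (k x) < \<epsilon> - m" using k x by (simp add: compact_nbhd_def)
      ultimately show ?thesis using m(2) x by fastforce
    qed
    then show "k \<in> compact_nbhd X A p f C \<epsilon>" using kp by (simp add: compact_nbhd_def)
  qed
  then show "\<exists>C' \<epsilon>'. compactin X C' \<and> 0 < \<epsilon>' \<and> compact_nbhd X A p g C' \<epsilon>' \<subseteq> compact_nbhd X A p f C \<epsilon>"
    using assms(1) m(1) by (intro exI[of _ C] exI[of _ "\<epsilon> - m"]) auto
qed

lemma self_in_compact_nbhd:
  assumes "f \<in> pair_maps X A mtopology p" "compactin X C" "\<epsilon> > 0"
  shows "f \<in> compact_nbhd X A p f C \<epsilon>"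
proof -
  have "f x \<in> M" if "x \<in> C" for x
    using that compactin_subset_topspace[OF assms(2)] pair_maps_in_M[OF assms(1)] by blast
  then show ?thesis using assms by (auto simp: compact_nbhd_def)
qed

text \<open>Countably many subbasic conditions suffice, namely that the compact closure of a basic
  set goes into a basic set of the target. Local compactness provides, around each point of
  \<open>C\<close>, a basic set whose closure is compact and lies in a prescribed preimage.\<close>

lemma second_countable_map_space:
  assumes "second_countable X" "locally_compact_space X" "Hausdorff_space X" "second_countable mtopology"
  shows "second_countable (map_space X A mtopology p)"
proof -
  obtain \<B> where \<B>: "countable \<B>" "\<And>V. V \<in> \<B> \<Longrightarrow> openin X V"
      "\<And>U x. openin X U \<Longrightarrow> x \<in> U \<Longrightarrow> \<exists>V\<in>\<B>. x \<in> V \<and> V \<subseteq> U"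
    using assms(1) unfolding second_countable_def by metis
  obtain \<V> where \<V>: "countable \<V>" "\<And>V. V \<in> \<V> \<Longrightarrow> openin mtopology V"
      "\<And>U x. openin mtopology U \<Longrightarrow> x \<in> U \<Longrightarrow> \<exists>V\<in>\<V>. x \<in> V \<and> V \<subseteq> U"
    using assms(4) unfolding second_countable_def by metis
  define \<K> where "\<K> = {B \<in> \<B>. compactin X (X closure_of B)} \<times> \<V>"
  let ?Y = "map_space X A mtopology p"
  define S where "S BV = {g \<in> pair_maps X A mtopology p. g ` (X closure_of (fst BV)) \<subseteq> snd BV}" for BV
  have oS: "openin ?Y (S BV)" if "BV \<in> \<K>" for BV
  proof -
    have "openin (compact_open_topology X mtopology)
       {f \<in> extensional (topspace X). continuous_map X mtopology f \<and> f ` (X closure_of (fst BV)) \<subseteq> snd BV}"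
      unfolding compact_open_topology_def openin_topology_generated_by_iff
    proof (rule generate_topology_on.Basis)
      have "compactin X (X closure_of (fst BV))" "openin mtopology (snd BV)"
        using that \<V>(2) by (auto simp: \<K>_def)
      then show "{f \<in> extensional (topspace X). continuous_map X mtopology f \<and> f ` (X closure_of (fst BV)) \<subseteq> snd BV}
         \<in> {{f \<in> extensional (topspace X). continuous_map X mtopology f \<and> f ` C \<subseteq> U} |C U.
             compactin X C \<and> openin mtopology U}" by blast
    qed
    moreover have "S BV = {f \<in> extensional (topspace X). continuous_map X mtopology f \<and> f ` (X closure_of (fst BV)) \<subseteq> snd BV}
        \<inter> pair_maps X A mtopology p"
      by (auto simp: S_def pair_maps_def)
    ultimately show ?thesis unfolding map_space_def openin_subtopology by blast
  qed
  define T where "T F = pair_maps X A mtopology p \<inter> \<Inter>(S ` F)" for F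
  have oT: "openin ?Y (T F)" if "finite F" "F \<subseteq> \<K>" for F
  proof (cases "F = {}")
    case True
    then show ?thesis unfolding T_def using openin_topspace[of ?Y] by (simp add: topspace_map_space)
  next
    case False
    then have "openin ?Y (\<Inter>(S ` F))" using that oS by (intro openin_Inter) auto
    then show ?thesis unfolding T_def
      using openin_topspace[of ?Y] by (simp add: topspace_map_space openin_Int)
  qed
  show ?thesis unfolding second_countable_def
  proof (intro exI[of _ "T ` {F. finite F \<and> F \<subseteq> \<K>}"] conjI ballI allI impI)
    have "countable \<K>" using \<B>(1) \<V>(1) by (simp add: \<K>_def)
    then have "countable {F. finite F \<and> F \<subseteq> \<K>}" by (rule countable_Collect_finite_subset)
    then show "countable (T ` {F. finite F \<and> F \<subseteq> \<K>})" by simp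
  next
    fix V assume "V \<in> T ` {F. finite F \<and> F \<subseteq> \<K>}"
    then show "openin ?Y V" using oT by auto
  next
    fix W f assume "openin ?Y W \<and> f \<in> W"
    then obtain C \<epsilon> where C: "compactin X C" "\<epsilon> > 0" "compact_nbhd X A p f C \<epsilon> \<subseteq> W"
      and fp: "f \<in> pair_maps X A mtopology p" unfolding openin_map_space_iff by blast
    have cf: "continuous_map X mtopology f" using fp by (simp add: pair_maps_def)
    have CX: "C \<subseteq> topspace X" using C(1) compactin_subset_topspace by blast
    have "\<exists>BV. BV \<in> \<K> \<and> x \<in> fst BV \<and> f ` (X closure_of (fst BV)) \<subseteq> snd BV \<and> snd BV \<subseteq> mball (f x) (\<epsilon>/2)"
      if x: "x \<in> C" for x
    proof -
      have "x \<in> topspace X" using x CX by blast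
      with pair_maps_in_M[OF fp] have fx: "f x \<in> M" "x \<in> topspace X" by blast+
      then obtain V where V: "V \<in> \<V>" "f x \<in> V" "V \<subseteq> mball (f x) (\<epsilon>/2)"
        using \<V>(3)[of "mball (f x) (\<epsilon>/2)" "f x"] C(2) by auto
      have o: "openin X {z \<in> topspace X. f z \<in> V} \<and> x \<in> {z \<in> topspace X. f z \<in> V}"
        using cf \<V>(2)[OF V(1)] V(2) fx by (auto intro: openin_continuous_map_preimage)
      have nb: "neighbourhood_base_of (\<lambda>C. compactin X C \<and> closedin X C) X"
        using assms(2,3) locally_compact_space_neighbourhood_base_closedin by blast
      obtain O' K where K: "openin X O'" "compactin X K" "closedin X K" "x \<in> O'" "O' \<subseteq> K"
          "K \<subseteq> {z \<in> topspace X. f z \<in> V}"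
        using nb[unfolded neighbourhood_base_of, rule_format, OF o] by (elim exE conjE)
      obtain B where B: "B \<in> \<B>" "x \<in> B" "B \<subseteq> O'" using \<B>(3) K by blast
      have sub: "X closure_of B \<subseteq> K" using B(3) K(3,5) by (meson closure_of_minimal subset_trans)
      then have "compactin X (X closure_of B)" using K(2) by (metis closed_compactin closedin_closure_of)
      then show ?thesis using B V K(6) sub by (intro exI[of _ "(B, V)"]) (auto simp: \<K>_def)
    qed
    then have "\<forall>x\<in>C. \<exists>BV. BV \<in> \<K> \<and> x \<in> fst BV \<and> f ` (X closure_of (fst BV)) \<subseteq> snd BV \<and> snd BV \<subseteq> mball (f x) (\<epsilon>/2)"
      by blast
    from bchoice[OF this] obtain BV where BV: "\<And>x. x \<in> C \<Longrightarrow> BV x \<in> \<K> \<and> x \<in> fst (BV x) \<and>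
        f ` (X closure_of (fst (BV x))) \<subseteq> snd (BV x) \<and> snd (BV x) \<subseteq> mball (f x) (\<epsilon>/2)" by blast
    have oB: "openin X (fst (BV x))" if "x \<in> C" for x using BV[OF that] \<B>(2) by (auto simp: \<K>_def)
    obtain F where F: "finite F" "F \<subseteq> C" "C \<subseteq> (\<Union>x\<in>F. fst (BV x))"
      by (rule compactin_finite_subcover[OF C(1) oB]) (use BV in auto)
    have "T (BV ` F) \<in> T ` {F. finite F \<and> F \<subseteq> \<K>}" using F BV by (intro imageI) auto
    moreover have "f \<in> T (BV ` F)" using F(2) BV fp unfolding T_def S_def by blast
    moreover have "T (BV ` F) \<subseteq> compact_nbhd X A p f C \<epsilon>"
    proof
      fix g assume g: "g \<in> T (BV ` F)"
      then have gp: "g \<in> pair_maps X A mtopology p" by (simp add: T_def)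
      have "d (f z) (g z) < \<epsilon>" if z: "z \<in> C" for z
      proof -
        obtain x where x: "x \<in> F" "z \<in> fst (BV x)" using F(3) z by blast
        have xC: "x \<in> C" using x(1) F(2) by blast
        have "fst (BV x) \<subseteq> topspace X" using oB[OF xC] by (rule openin_subset)
        then have zc: "z \<in> X closure_of (fst (BV x))" using x(2) closure_of_subset by blast
        have "g \<in> S (BV x)" using g x(1) unfolding T_def by blast
        then have "g z \<in> snd (BV x)" using zc by (auto simp: S_def)
        moreover have "f z \<in> snd (BV x)" using BV[OF xC] zc by blast
        ultimately have gz: "g z \<in> mball (f x) (\<epsilon>/2)" and fz: "f z \<in> mball (f x) (\<epsilon>/2)"
          using BV[OF xC] by blast+
        have "d (f z) (g z) \<le> d (f z) (f x) + d (f x) (g z)" using gz fz by (intro triangle) auto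
        then show ?thesis using gz fz by (auto simp: commute)
      qed
      then show "g \<in> compact_nbhd X A p f C \<epsilon>" using gp by (simp add: compact_nbhd_def)
    qed
    ultimately show "\<exists>V\<in>T ` {F. finite F \<and> F \<subseteq> \<K>}. f \<in> V \<and> V \<subseteq> W" using C(3) by blast
  qed
qed

end

lemma (in Metric_space) completely_metrizable_map_space:
  assumes "second_countable X" "locally_compact_space X" "Hausdorff_space X" "mcomplete" "A \<subseteq> topspace X"
  shows "completely_metrizable_space (map_space X A mtopology p)"
proof -
  obtain C :: "nat \<Rightarrow> 'b set" where C: "\<And>n. compactin X (C n)" "\<And>m n. m \<le> n \<Longrightarrow> C m \<subseteq> C n"
    "\<And>K. compactin X K \<Longrightarrow> \<exists>n. K \<subseteq> C n"
    using compact_exhaustion[OF assms(1-3)] by blast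
  let ?Y = "pair_maps X A mtopology p"
  \<comment> \<open>At a point that first appears in \<open>C n\<close>, the distance is truncated
    at \<open>1/(n+1)\<close>. So points outside a large \<open>C n\<close> contribute little to the
    supremum \<open>D\<close>, while on \<open>C n\<close> a small value of \<open>D\<close> bounds
    \<open>d\<close> itself; hence \<open>D\<close> describes uniform closeness on compact sets. The
    inserted 0 takes care of empty \<open>X\<close>.\<close>
  define w where "w x = inverse (real (Suc (LEAST n. x \<in> C n)))" for x
  define D where "D f g = Sup (insert 0 ((\<lambda>x. min (w x) (d (f x) (g x))) ` topspace X))" for f g
  have wpos: "w x > 0" and w1: "w x \<le> 1" for x by (auto simp: w_def field_simps)
  have wge: "inverse (real (Suc n)) \<le> w x" if "x \<in> C n" for x n
    unfolding w_def using that by (simp add: Least_le field_simps)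
  have wle: "w x \<le> inverse (real (Suc n))" if "x \<in> topspace X" "x \<notin> C n" for x n
  proof -
    have "compactin X {x}" using that by simp
    then obtain k where k: "x \<in> C k" using C(3) by blast
    have "x \<in> C (LEAST n. x \<in> C n)" using k by (rule LeastI)
    then have "n \<le> (LEAST n. x \<in> C n)" using C(2) that(2) by (meson nat_le_linear subsetD)
    then show ?thesis unfolding w_def by (simp add: field_simps)
  qed
  have bdd: "bdd_above (insert 0 ((\<lambda>x. min (w x) (d (f x) (g x))) ` topspace X))" for f g
    by (rule bdd_aboveI[of _ 1]) (use w1 in \<open>auto simp: min_le_iff_disj\<close>)
  have D_ge: "min (w x) (d (f x) (g x)) \<le> D f g" if "x \<in> topspace X" for x f g
    unfolding D_def by (rule cSup_upper[OF _ bdd]) (use that in auto)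
  have D_le: "D f g \<le> e" if "0 \<le> e" "\<And>x. x \<in> topspace X \<Longrightarrow> min (w x) (d (f x) (g x)) \<le> e" for f g e
    unfolding D_def by (rule cSup_least) (use that in auto)
  have D_nonneg: "0 \<le> D f g" for f g
    unfolding D_def by (rule cSup_upper[OF _ bdd]) simp
  have inM: "f x \<in> M" if "f \<in> ?Y" "x \<in> topspace X" for f x using that by (rule pair_maps_in_M)
  have small: "d (f x) (g x) < e" if "x \<in> C n" "D f g < min (inverse (real (Suc n))) e" for f g x n e
  proof -
    have "x \<in> topspace X" using that(1) compactin_subset_topspace[OF C(1)] by blast
    then have "min (w x) (d (f x) (g x)) < min (inverse (real (Suc n))) e"
      using D_ge[of x f g] that(2) by linarith
    then show ?thesis using wge[OF that(1)] by linarith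
  qed
  interpret D: Metric_space ?Y D
  proof
    show "0 \<le> D f g" for f g by (rule D_nonneg)
    show "D f g = D g f" for f g by (simp add: D_def commute)
    show "(D f g = 0) = (f = g)" if "f \<in> ?Y" "g \<in> ?Y" for f g
    proof
      assume z: "D f g = 0"
      show "f = g"
      proof (rule extensionalityI)
        show "f \<in> extensional (topspace X)" "g \<in> extensional (topspace X)"
          using that by (auto simp: pair_maps_def)
        fix x assume x: "x \<in> topspace X"
        then have "d (f x) (g x) \<le> 0" using D_ge[OF x, of f g] z wpos[of x] by linarith
        then show "f x = g x" using inM[OF that(1) x] inM[OF that(2) x] zero[of "f x" "g x"] nonneg[of "f x" "g x"] by simp
      qed
    next
      assume "f = g"
      then have "D f g \<le> 0" using inM[OF that(1)] wpos by (intro D_le) (auto simp: min_le_iff_disj)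
      then show "D f g = 0" using D_nonneg[of f g] by linarith
    qed
    show "D f h \<le> D f g + D g h" if "f \<in> ?Y" "g \<in> ?Y" "h \<in> ?Y" for f g h
    proof (rule D_le)
      show "0 \<le> D f g + D g h" using D_nonneg by simp
      fix x assume x: "x \<in> topspace X"
      have "d (f x) (h x) \<le> d (f x) (g x) + d (g x) (h x)" using that x by (intro triangle inM)
      then show "min (w x) (d (f x) (h x)) \<le> D f g + D g h"
        using D_ge[OF x, of f g] D_ge[OF x, of g h] D_nonneg[of f g] D_nonneg[of g h] by linarith
    qed
  qed
  have "D.mtopology = map_space X A mtopology p"
    unfolding topology_eq
  proof (intro allI iffI)
    fix W assume W: "openin D.mtopology W"
    show "openin (map_space X A mtopology p) W" unfolding openin_map_space_iff
    proof (intro conjI ballI)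
      show "W \<subseteq> ?Y" using W by (simp add: D.openin_mtopology)
      fix f assume f: "f \<in> W"
      obtain r where r: "r > 0" "D.mball f r \<subseteq> W"
        using conjunct2[OF W[unfolded D.openin_mtopology], rule_format, OF f] by (elim exE conjE)
      obtain n where n: "inverse (real (Suc n)) < r / 2" using r(1) reals_Archimedean[of "r/2"] by auto
      have "compact_nbhd X A p f (C n) (r/2) \<subseteq> D.mball f r"
      proof
        fix g assume g: "g \<in> compact_nbhd X A p f (C n) (r/2)"
        have "D f g \<le> r/2"
        proof (rule D_le)
          show "0 \<le> r/2" using r(1) by simp
          fix x assume x: "x \<in> topspace X"
          show "min (w x) (d (f x) (g x)) \<le> r/2"
          proof (cases "x \<in> C n")
            case True
            then have "d (f x) (g x) < r/2" using g by (simp add: compact_nbhd_def)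
            then show ?thesis by linarith
          next
            case False
            then show ?thesis using wle[OF x False] n by linarith
          qed
        qed
        moreover have "g \<in> ?Y" "f \<in> ?Y" using g f \<open>W \<subseteq> ?Y\<close> by (auto simp: compact_nbhd_def)
        ultimately show "g \<in> D.mball f r" using r(1) by simp
      qed
      then show "\<exists>K e. compactin X K \<and> 0 < e \<and> compact_nbhd X A p f K e \<subseteq> W"
        using C(1) r by (intro exI[of _ "C n"] exI[of _ "r/2"]) auto
    qed
  next
    fix W assume W: "openin (map_space X A mtopology p) W"
    then have WY: "W \<subseteq> ?Y" unfolding openin_map_space_iff by (rule conjunct1)
    have "\<exists>r>0. D.mball f r \<subseteq> W" if f: "f \<in> W" for f
    proof -
      obtain K e where K: "compactin X K" "0 < e" "compact_nbhd X A p f K e \<subseteq> W"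
        using bspec[OF conjunct2[OF W[unfolded openin_map_space_iff]] f] by (elim exE conjE)
      obtain n where n: "K \<subseteq> C n" using C(3)[OF K(1)] by blast
      have "D.mball f (min (inverse (real (Suc n))) e) \<subseteq> compact_nbhd X A p f K e"
      proof
        fix g assume g: "g \<in> D.mball f (min (inverse (real (Suc n))) e)"
        then have "D f g < min (inverse (real (Suc n))) e" "g \<in> ?Y" by auto
        then show "g \<in> compact_nbhd X A p f K e"
          unfolding compact_nbhd_def using small n by blast
      qed
      moreover have "min (inverse (real (Suc n))) e > 0" using K(2) by simp
      ultimately show ?thesis using K(3) by (meson subset_trans)
    qed
    then show "openin D.mtopology W" using WY by (simp add: D.openin_mtopology)
  qed
  moreover have "D.mcomplete"
    unfolding D.mcomplete_def
  proof (intro allI impI)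
    fix \<sigma> assume cau: "D.MCauchy \<sigma>"
    have \<sigma>Y: "\<sigma> n \<in> ?Y" for n using cau by (auto simp: D.MCauchy_def)
    have "\<exists>l. limitin mtopology (\<lambda>n. \<sigma> n x) l sequentially" if x: "x \<in> topspace X" for x
    proof -
      have "compactin X {x}" using x by simp
      then obtain k where k: "x \<in> C k" using C(3) by blast
      have "MCauchy (\<lambda>n. \<sigma> n x)" unfolding MCauchy_def
      proof (intro conjI allI impI)
        show "range (\<lambda>n. \<sigma> n x) \<subseteq> M" using inM[OF \<sigma>Y x] by blast
        fix e :: real assume "e > 0"
        then have "min (inverse (real (Suc k))) e > 0" by simp
        then obtain N where N: "\<And>n n'. N \<le> n \<Longrightarrow> N \<le> n' \<Longrightarrow> D (\<sigma> n) (\<sigma> n') < min (inverse (real (Suc k))) e"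
          using cau unfolding D.MCauchy_def by meson
        then show "\<exists>N. \<forall>n n'. N \<le> n \<longrightarrow> N \<le> n' \<longrightarrow> d (\<sigma> n x) (\<sigma> n' x) < e"
          using small[OF k] by blast
      qed
      then show ?thesis using assms(4) unfolding mcomplete_def by blast
    qed
    then have "\<forall>x\<in>topspace X. \<exists>l. limitin mtopology (\<lambda>n. \<sigma> n x) l sequentially" by blast
    from bchoice[OF this] obtain l where l: "\<And>x. x \<in> topspace X \<Longrightarrow> limitin mtopology (\<lambda>n. \<sigma> n x) (l x) sequentially"
      by blast
    define f where "f = restrict l (topspace X)"
    have lim: "limitin mtopology (\<lambda>n. \<sigma> n x) (f x) sequentially" if "x \<in> topspace X" for x
      using l that by (simp add: f_def)
    have fM: "f x \<in> M" if "x \<in> topspace X" for x using lim[OF that] by (rule limitin_mspace)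
    have conv: "\<exists>N. \<forall>n\<ge>N. D (\<sigma> n) f \<le> e" if e: "e > 0" for e
    proof -
      obtain N where N: "\<And>n n'. N \<le> n \<Longrightarrow> N \<le> n' \<Longrightarrow> D (\<sigma> n) (\<sigma> n') < e"
        using cau e unfolding D.MCauchy_def by meson
      have "D (\<sigma> n) f \<le> e" if n: "N \<le> n" for n
      proof (rule D_le)
        show "0 \<le> e" using e by simp
        fix x assume x: "x \<in> topspace X"
        \<comment> \<open>Where \<open>w x \<le> e\<close> there is nothing to show. Elsewhere the
          truncation is harmless, and \<open>m\<close> is taken so late that
          \<open>\<sigma> m x\<close> is nearer to the limit than the supposed excess over
          \<open>e\<close>.\<close>
        show "min (w x) (d (\<sigma> n x) (f x)) \<le> e"
        proof (rule ccontr)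
          assume "\<not> ?thesis"
          then have a: "w x > e" "d (\<sigma> n x) (f x) > e" by auto
          have ev1: "\<forall>\<^sub>F m in sequentially. \<sigma> m x \<in> M \<and> d (\<sigma> m x) (f x) < d (\<sigma> n x) (f x) - e"
            using lim[OF x] a(2) unfolding limitin_metric by simp
          have ev2: "\<forall>\<^sub>F m in sequentially. N \<le> m" by (rule eventually_ge_at_top)
          obtain m where m: "N \<le> m" "d (\<sigma> m x) (f x) < d (\<sigma> n x) (f x) - e"
            using eventually_happens'[OF sequentially_bot eventually_conj[OF ev1 ev2]] by blast
          have "d (\<sigma> n x) (f x) \<le> d (\<sigma> n x) (\<sigma> m x) + d (\<sigma> m x) (f x)"
            using inM[OF \<sigma>Y x] fM[OF x] by (intro triangle)
          moreover have "d (\<sigma> n x) (\<sigma> m x) < e"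
            using D_ge[OF x, of "\<sigma> n" "\<sigma> m"] N[OF n m(1)] a(1) by linarith
          ultimately show False using m(2) by linarith
        qed
      qed
      then show ?thesis by blast
    qed
    have "continuous_map X mtopology f" unfolding continuous_map_to_metric
    proof (intro ballI allI impI)
      fix x and e :: real assume x: "x \<in> topspace X" and e: "e > 0"
      obtain U K where U: "openin X U" "compactin X K" "x \<in> U" "U \<subseteq> K"
        using assms(2)[unfolded locally_compact_space_def, rule_format, OF x] by (elim exE conjE)
      obtain k where k: "K \<subseteq> C k" using C(3)[OF U(2)] by blast
      define r where "r = min (inverse (real (Suc k))) (e/3)"
      have "r > 0" using e by (simp add: r_def)
      then obtain N where N: "\<And>n. n \<ge> N \<Longrightarrow> D (\<sigma> n) f \<le> r / 2" using conv[of "r/2"] by auto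
      have DN: "D (\<sigma> N) f < min (inverse (real (Suc k))) (e/3)"
        using N[of N] \<open>r > 0\<close> unfolding r_def[symmetric] by linarith
      have cN: "continuous_map X mtopology (\<sigma> N)" using \<sigma>Y[of N] by (simp add: pair_maps_def)
      have "e/3 > 0" using e by simp
      obtain V where V: "openin X V" "x \<in> V" "\<And>y. y \<in> V \<Longrightarrow> \<sigma> N y \<in> mball (\<sigma> N x) (e/3)"
        using cN[unfolded continuous_map_to_metric, rule_format, OF x \<open>e/3 > 0\<close>] by blast
      have "f y \<in> mball (f x) e" if y: "y \<in> U \<inter> V" for y
      proof -
        have yX: "y \<in> topspace X" using y openin_subset[OF U(1)] by blast
        have "d (\<sigma> N y) (f y) < e/3" "d (\<sigma> N x) (f x) < e/3"
          using y U k by (intro small[OF _ DN]; blast)+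
        moreover have "d (\<sigma> N x) (\<sigma> N y) < e/3" using V(3) y by auto
        moreover have "d (f x) (f y) \<le> d (f x) (\<sigma> N x) + d (\<sigma> N x) (f y)"
          using fM x yX inM[OF \<sigma>Y] by (intro triangle) auto
        moreover have "d (\<sigma> N x) (f y) \<le> d (\<sigma> N x) (\<sigma> N y) + d (\<sigma> N y) (f y)"
          using fM x yX inM[OF \<sigma>Y] by (intro triangle) auto
        ultimately show ?thesis using fM x yX by (simp add: commute)
      qed
      then show "\<exists>U. openin X U \<and> x \<in> U \<and> (\<forall>y\<in>U. f y \<in> mball (f x) e)"
        using U(1,3) V(1,2) by (intro exI[of _ "U \<inter> V"]) auto
    qed
    moreover have "f x = p" if x: "x \<in> A" for x
    proof -
      have xX: "x \<in> topspace X" using x assms(5) by blast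
      have "\<sigma> n x = p" for n using \<sigma>Y[of n] x by (auto simp: pair_maps_def)
      then have "p \<in> M" "limitin mtopology (\<lambda>n::nat. p) (f x) sequentially"
        using lim[OF xX] inM[OF \<sigma>Y xX] by auto
      then show ?thesis
        using Hausdorff_space_mtopology limitin_Hausdorff_unique[of mtopology "\<lambda>n::nat. p" "f x" sequentially p] by simp
    qed
    ultimately have fY: "f \<in> ?Y" by (auto simp: pair_maps_def f_def)
    have "limitin D.mtopology \<sigma> f sequentially" unfolding D.limitin_metric
    proof (intro conjI allI impI fY)
      fix e :: real assume "e > 0"
      then obtain N where "\<forall>n\<ge>N. D (\<sigma> n) f \<le> e/2" using conv[of "e/2"] by auto
      then have "\<forall>n\<ge>N. \<sigma> n \<in> ?Y \<and> D (\<sigma> n) f < e" using \<sigma>Y \<open>e > 0\<close> by fastforce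
      then show "\<forall>\<^sub>F n in sequentially. \<sigma> n \<in> ?Y \<and> D (\<sigma> n) f < e"
        unfolding eventually_sequentially by blast
    qed
    then show "\<exists>f. limitin D.mtopology \<sigma> f sequentially" by blast
  qed
  ultimately show ?thesis
    unfolding completely_metrizable_space_def using D.Metric_space_axioms by metis
qed

section \<open>Spaces of homotopies\<close>

abbreviation unit_interval_top :: "real topology" ("\<I>") where
  "\<I> \<equiv> top_of_set {0..1}"

text \<open>Urysohn's lemma, applied to \<open>C\<close> and the complement of an open neighbourhood
  of \<open>C\<close> that lies in a compact set. The cutoff will serve as a clock: full speed on
  \<open>C\<close>, standstill outside \<open>K\<close>, so that estimates on \<open>K\<close> are
  enough.\<close>

lemma compact_cutoff:
  assumes "metrizable_space X" "locally_compact_space X" "compactin X C"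
  obtains u :: "'a \<Rightarrow> real" and K where "continuous_map X euclideanreal u" "\<And>x. x \<in> topspace X \<Longrightarrow> u x \<in> {0..1}"
    "compactin X K" "\<And>x. x \<in> C \<Longrightarrow> u x = 1" "\<And>x. x \<in> topspace X \<Longrightarrow> x \<notin> K \<Longrightarrow> u x = 0"
proof -
  have H: "Hausdorff_space X" and n: "normal_space X"
    using assms(1) by (simp_all add: metrizable_imp_Hausdorff_space metrizable_imp_normal_space)
  obtain U K where K: "openin X U" "compactin X K" "C \<subseteq> U" "U \<subseteq> K"
    using locally_compact_space_compact_closed_compact[of X] H assms(2,3) by blast
  have "closedin X (topspace X - U)" "closedin X C" "disjnt (topspace X - U) C"
    using K assms(3) H by (auto simp: disjnt_def compactin_imp_closedin closedin_diff)
  then obtain u :: "'a \<Rightarrow> real" where u: "continuous_map X (top_of_set {0..1}) u"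
      "u ` (topspace X - U) \<subseteq> {0}" "u ` C \<subseteq> {1}"
    using Urysohn_lemma[OF n, of "topspace X - U" C 0 1] by auto
  show thesis
  proof (rule that[of u K])
    show "continuous_map X euclideanreal u" "\<And>x. x \<in> topspace X \<Longrightarrow> u x \<in> {0..1}"
      using u(1) unfolding continuous_map_in_subtopology by auto
    show "compactin X K" by (rule K(2))
    show "\<And>x. x \<in> C \<Longrightarrow> u x = 1" using u(3) by auto
    show "\<And>x. x \<in> topspace X \<Longrightarrow> x \<notin> K \<Longrightarrow> u x = 0" using u(2) K(4) by auto
  qed
qed

lemma continuous_map_cylinder:
  assumes "continuous_map (prod_topology \<I> X) Y h" "continuous_map Z euclideanreal s"
    "\<And>z. z \<in> topspace Z \<Longrightarrow> s z \<in> {0..1}" "continuous_map Z X \<phi>"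
  shows "continuous_map Z Y (\<lambda>z. h (s z, \<phi> z))"
proof -
  have "continuous_map Z \<I> s"
    using assms(2,3) by (auto simp: continuous_map_in_subtopology)
  then have "continuous_map Z (prod_topology \<I> X) (\<lambda>z. (s z, \<phi> z))"
    using assms(4) by (rule continuous_map_pairedI)
  from continuous_map_compose[OF this assms(1)] show ?thesis by (simp add: o_def)
qed

lemma continuous_map_time: "continuous_map (prod_topology \<I> X) euclideanreal fst"
  using continuous_map_fst[of \<I> X] by (auto simp: continuous_map_in_subtopology)

lemma continuous_map_space:
  "continuous_map X Y f \<Longrightarrow> continuous_map (prod_topology \<I> X) Y (\<lambda>z. f (snd z))"
  using continuous_map_compose[OF continuous_map_snd] by (fastforce simp: o_def)

section \<open>The space of homotopies and its time slices\<close>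

context Metric_space
begin

text \<open>The tube lemma gives an estimate near each time that is uniform over the compact set
  \<open>C\<close>; a Lebesgue number of the resulting cover of the interval makes it uniform in
  time.\<close>

lemma homotopy_uniformly_continuous:
  assumes h: "continuous_map (prod_topology \<I> X) mtopology h" and C: "compactin X C" and e: "\<epsilon> > 0"
  obtains \<delta> where "\<delta> > 0" "\<And>s t x. s \<in> {0..1} \<Longrightarrow> t \<in> {0..1} \<Longrightarrow> \<bar>s - t\<bar> < \<delta> \<Longrightarrow> x \<in> C \<Longrightarrow> d (h (s, x)) (h (t, x)) < \<epsilon>"
proof -
  have CX: "C \<subseteq> topspace X" using C by (rule compactin_subset_topspace)
  have hM: "h (t, x) \<in> M" if "t \<in> {0..1}" "x \<in> topspace X" for t x
    using h that by (auto simp: continuous_map_def)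
  have "\<exists>r>0. \<forall>t\<in>{0..1} \<inter> ball t0 r. \<forall>x\<in>C. d (h (t, x)) (h (t0, x)) < \<epsilon>/2" if t0: "t0 \<in> {0..1}" for t0
  proof -
    define W where "W = {z \<in> topspace (prod_topology \<I> X). d (h z) (h (t0, snd z)) \<in> {..<\<epsilon>/2}}"
    have "continuous_map (prod_topology \<I> X) mtopology (\<lambda>z. h (t0, snd z))"
      by (rule continuous_map_cylinder[OF h]) (use t0 continuous_map_snd[of \<I> X] in auto)
    then have "continuous_map (prod_topology \<I> X) euclideanreal (\<lambda>z. d (h z) (h (t0, snd z)))"
      using h by (intro continuous_map_d)
    then have "openin (prod_topology \<I> X) W"
      unfolding W_def by (rule openin_continuous_map_preimage) auto
    moreover have "{t0} \<times> C \<subseteq> W" using t0 CX e hM by (auto simp: W_def)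
    moreover have "compactin \<I> {t0}" using t0 by simp
    ultimately obtain U V where UV: "openin \<I> U" "{t0} \<subseteq> U" "C \<subseteq> V" "U \<times> V \<subseteq> W"
      using Wallace_theorem_prod_topology[of \<I> "{t0}" X C W] C by metis
    obtain O' where O': "open O'" "U = O' \<inter> {0..1}" using UV(1) by (auto simp: openin_open)
    have "t0 \<in> O'" using UV(2) O'(2) by blast
    then obtain r where r: "r > 0" "ball t0 r \<subseteq> O'" using openE[OF O'(1)] by blast
    have "d (h (t, x)) (h (t0, x)) < \<epsilon>/2" if "t \<in> {0..1} \<inter> ball t0 r" "x \<in> C" for t x
    proof -
      have "t \<in> U" "x \<in> V" using that r O'(2) UV(3) by blast+
      then have "(t, x) \<in> W" using UV(4) by blast
      then show ?thesis by (simp add: W_def)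
    qed
    with r(1) show ?thesis by blast
  qed
  then have "\<forall>t0\<in>{0..1}. \<exists>r>0. \<forall>t\<in>{0..1} \<inter> ball t0 r. \<forall>x\<in>C. d (h (t, x)) (h (t0, x)) < \<epsilon>/2" by blast
  from bchoice[OF this] obtain r where r: "\<And>t0. t0 \<in> {0..1} \<Longrightarrow> r t0 > 0"
    "\<And>t0 t x. t0 \<in> {0..1} \<Longrightarrow> t \<in> {0..1} \<Longrightarrow> t \<in> ball t0 (r t0) \<Longrightarrow> x \<in> C \<Longrightarrow> d (h (t, x)) (h (t0, x)) < \<epsilon>/2" by blast
  obtain \<delta> where \<delta>: "\<delta> > 0" "\<And>s. s \<in> {0..1} \<Longrightarrow> \<exists>T\<in>(\<lambda>t. ball t (r t)) ` {0..1}. ball s \<delta> \<subseteq> T"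
  proof (rule Heine_Borel_lemma[of "{0..1::real}" "(\<lambda>t. ball t (r t)) ` {0..1}"])
    show "{0..1} \<subseteq> \<Union>((\<lambda>t. ball t (r t)) ` {0..1})" using r(1) by fastforce
  qed (use that in auto)
  show thesis
  proof (rule that[OF \<delta>(1)])
    fix s t x assume st: "s \<in> {0..1}" "t \<in> {0..1}" "\<bar>s - t\<bar> < \<delta>" "x \<in> C"
    obtain t0 where t0: "t0 \<in> {0..1}" "ball s \<delta> \<subseteq> ball t0 (r t0)" using \<delta>(2)[OF st(1)] by auto
    have "s \<in> ball t0 (r t0)" "t \<in> ball t0 (r t0)"
      using t0(2) st(3) \<delta>(1) by (auto simp: dist_real_def subset_iff)
    then have "d (h (s, x)) (h (t0, x)) < \<epsilon>/2" "d (h (t, x)) (h (t0, x)) < \<epsilon>/2"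
      using r(2)[OF t0(1)] st by auto
    moreover have "d (h (s, x)) (h (t, x)) \<le> d (h (s, x)) (h (t0, x)) + d (h (t0, x)) (h (t, x))"
      using st t0 CX by (intro triangle hM) auto
    ultimately show "d (h (s, x)) (h (t, x)) < \<epsilon>" by (simp add: commute)
  qed
qed

text \<open>Homotopies that respect the base point are themselves maps of a pair, on the cylinder
  over \<open>X\<close>. The cylinder is again locally compact, Hausdorff and second countable when
  \<open>X\<close> is, so that the results on map spaces apply to them.\<close>

definition homotopies :: "'b topology \<Rightarrow> 'b set \<Rightarrow> 'a \<Rightarrow> (real \<times> 'b \<Rightarrow> 'a) set" where
  "homotopies X A p = pair_maps (prod_topology \<I> X) ({0..1} \<times> A) mtopology p"

definition homotopy_space :: "'b topology \<Rightarrow> 'b set \<Rightarrow> 'a \<Rightarrow> (real \<times> 'b \<Rightarrow> 'a) topology" where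
  "homotopy_space X A p = map_space (prod_topology \<I> X) ({0..1} \<times> A) mtopology p"

definition slice :: "'b topology \<Rightarrow> real \<Rightarrow> (real \<times> 'b \<Rightarrow> 'a) \<Rightarrow> 'b \<Rightarrow> 'a" where
  "slice X t h = restrict (\<lambda>x. h (t, x)) (topspace X)"

lemma topspace_homotopy_space: "topspace (homotopy_space X A p) = homotopies X A p"
  by (simp add: homotopy_space_def homotopies_def topspace_map_space)

lemma homotopies_continuous: "h \<in> homotopies X A p \<Longrightarrow> continuous_map (prod_topology \<I> X) mtopology h"
  by (simp add: homotopies_def pair_maps_def)

lemma homotopies_base: "h \<in> homotopies X A p \<Longrightarrow> t \<in> {0..1} \<Longrightarrow> x \<in> A \<Longrightarrow> h (t, x) = p"
  unfolding homotopies_def pair_maps_def by blast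

lemma homotopies_in_M: "h \<in> homotopies X A p \<Longrightarrow> t \<in> {0..1} \<Longrightarrow> x \<in> topspace X \<Longrightarrow> h (t, x) \<in> M"
  unfolding homotopies_def by (rule pair_maps_in_M) auto

lemma slice_in_pair_maps:
  assumes "h \<in> homotopies X A p" "t \<in> {0..1}" "A \<subseteq> topspace X"
  shows "slice X t h \<in> pair_maps X A mtopology p"
proof -
  have "continuous_map X mtopology (\<lambda>x. h (t, x))"
    by (rule continuous_map_cylinder[OF homotopies_continuous[OF assms(1)]]) (use assms in auto)
  then have "continuous_map X mtopology (slice X t h)"
    by (rule continuous_map_eq) (simp add: slice_def)
  moreover have "slice X t h x = p" if "x \<in> A" for x
    using homotopies_base[OF assms(1,2) that] that assms(3) by (auto simp: slice_def)
  ultimately show ?thesis by (auto simp: pair_maps_def slice_def)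
qed

lemma restrict_in_homotopies:
  assumes "continuous_map (prod_topology \<I> X) mtopology k"
    "\<And>t x. t \<in> {0..1} \<Longrightarrow> x \<in> A \<Longrightarrow> k (t, x) = p" "A \<subseteq> topspace X"
  shows "restrict k ({0..1} \<times> topspace X) \<in> homotopies X A p"
proof -
  have "continuous_map (prod_topology \<I> X) mtopology (restrict k ({0..1} \<times> topspace X))"
    using assms(1) by (rule continuous_map_eq) auto
  then show ?thesis using assms(2,3) by (auto simp: homotopies_def pair_maps_def)
qed

lemma slice_restrict: "t \<in> {0..1} \<Longrightarrow> slice X t (restrict k ({0..1} \<times> topspace X)) = slice X t k"
  by (auto simp: slice_def)

lemma slice_eqI: "f \<in> pair_maps X A mtopology p \<Longrightarrow> (\<And>x. x \<in> topspace X \<Longrightarrow> k (t, x) = f x) \<Longrightarrow> slice X t k = f"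
  by (auto simp: slice_def pair_maps_def extensional_def)

lemma continuous_map_slice:
  assumes t: "t \<in> {0..1}" and A: "A \<subseteq> topspace X"
  shows "continuous_map (homotopy_space X A p) (map_space X A mtopology p) (slice X t)"
  unfolding continuous_map topspace_homotopy_space topspace_map_space
proof (intro conjI allI impI)
  show "slice X t ` homotopies X A p \<subseteq> pair_maps X A mtopology p"
    using slice_in_pair_maps[OF _ t A] by blast
  fix U assume U: "openin (map_space X A mtopology p) U"
  show "openin (homotopy_space X A p) {h \<in> homotopies X A p. slice X t h \<in> U}"
    unfolding homotopy_space_def openin_map_space_iff
  proof (intro conjI ballI)
    show "{h \<in> homotopies X A p. slice X t h \<in> U} \<subseteq> pair_maps (prod_topology \<I> X) ({0..1} \<times> A) mtopology p"
      by (auto simp: homotopies_def)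
    fix h assume "h \<in> {h \<in> homotopies X A p. slice X t h \<in> U}"
    then have h: "h \<in> homotopies X A p" "slice X t h \<in> U" by auto
    obtain C \<epsilon> where C: "compactin X C" "\<epsilon> > 0" "compact_nbhd X A p (slice X t h) C \<epsilon> \<subseteq> U"
      using bspec[OF conjunct2[OF U[unfolded openin_map_space_iff]] h(2)] by (elim exE conjE)
    have CX: "C \<subseteq> topspace X" using C(1) by (rule compactin_subset_topspace)
    have "compactin (prod_topology \<I> X) ({t} \<times> C)" using C(1) t by (simp add: compactin_Times)
    moreover have "slice X t k \<in> U" if k: "k \<in> compact_nbhd (prod_topology \<I> X) ({0..1} \<times> A) p h ({t} \<times> C) \<epsilon>" for k
    proof -
      have kH: "k \<in> homotopies X A p" using k by (simp add: compact_nbhd_def homotopies_def)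
      have "d (slice X t h x) (slice X t k x) < \<epsilon>" if "x \<in> C" for x
        using k that CX by (auto simp: compact_nbhd_def slice_def)
      then have "slice X t k \<in> compact_nbhd X A p (slice X t h) C \<epsilon>"
        using slice_in_pair_maps[OF kH t A] by (simp add: compact_nbhd_def)
      then show ?thesis using C(3) by blast
    qed
    then have "compact_nbhd (prod_topology \<I> X) ({0..1} \<times> A) p h ({t} \<times> C) \<epsilon> \<subseteq> {h \<in> homotopies X A p. slice X t h \<in> U}"
      by (auto simp: compact_nbhd_def homotopies_def)
    ultimately show "\<exists>K e. compactin (prod_topology \<I> X) K \<and> 0 < e \<and>
        compact_nbhd (prod_topology \<I> X) ({0..1} \<times> A) p h K e \<subseteq> {h \<in> homotopies X A p. slice X t h \<in> U}"
      using C(2) by (intro exI conjI)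
  qed
qed

text \<open>A compact subset of the cylinder is contained in the cylinder over its projection to
  \<open>X\<close>; so it is enough to prescribe closeness at all times over a compact subset of
  \<open>X\<close>.\<close>

lemma homotopy_space_nbhd:
  assumes "openin (homotopy_space X A p) N" "h \<in> N"
  obtains C \<epsilon> where "compactin X C" "\<epsilon> > 0"
    "\<forall>k\<in>homotopies X A p. (\<forall>t\<in>{0..1}. \<forall>x\<in>C. d (h (t, x)) (k (t, x)) < \<epsilon>) \<longrightarrow> k \<in> N"
proof -
  obtain K \<epsilon> where K: "compactin (prod_topology \<I> X) K" "\<epsilon> > 0"
      "compact_nbhd (prod_topology \<I> X) ({0..1} \<times> A) p h K \<epsilon> \<subseteq> N"
    using bspec[OF conjunct2[OF assms(1)[unfolded homotopy_space_def openin_map_space_iff]] assms(2)]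
    by (elim exE conjE)
  have sub: "K \<subseteq> {0..1} \<times> topspace X" using compactin_subset_topspace[OF K(1)] by simp
  show thesis
  proof (rule that)
    show "compactin X (snd ` K)" using K(1) continuous_map_snd by (rule image_compactin)
    show "\<epsilon> > 0" by (rule K(2))
    show "\<forall>k\<in>homotopies X A p. (\<forall>t\<in>{0..1}. \<forall>x\<in>snd ` K. d (h (t, x)) (k (t, x)) < \<epsilon>) \<longrightarrow> k \<in> N"
    proof (intro ballI impI)
    fix k assume "k \<in> homotopies X A p" "\<forall>t\<in>{0..1}. \<forall>x\<in>snd ` K. d (h (t, x)) (k (t, x)) < \<epsilon>"
    then have "k \<in> compact_nbhd (prod_topology \<I> X) ({0..1} \<times> A) p h K \<epsilon>"
      using sub by (force simp: compact_nbhd_def homotopies_def)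
    then show "k \<in> N" using K(3) by blast
    qed
  qed
qed

section \<open>The topology of controlled homotopies\<close>

definition based_close :: "'b set \<Rightarrow> 'a \<Rightarrow> ('b \<Rightarrow> 'a) \<Rightarrow> 'b set \<Rightarrow> real \<Rightarrow> ('b \<Rightarrow> 'a) \<Rightarrow> bool" where
  "based_close A p f C \<epsilon> k \<longleftrightarrow> k ` A \<subseteq> {p} \<and> (\<forall>x\<in>C. d (f x) (k x) < \<epsilon>)"

lemma based_close_cong:
  assumes "A \<subseteq> topspace X" "C \<subseteq> topspace X" "\<And>x. x \<in> topspace X \<Longrightarrow> k x = k' x"
  shows "based_close A p f C \<epsilon> k = based_close A p f C \<epsilon> k'"
proof -
  have "k ` A = k' ` A" using assms by (intro image_cong) auto
  moreover have "k x = k' x" if "x \<in> C" for x using assms that by auto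
  ultimately show ?thesis by (simp add: based_close_def)
qed

lemma homotopic_with_based_close:
  assumes "A \<subseteq> topspace X" "C \<subseteq> topspace X"
  shows "homotopic_with (based_close A p f C \<epsilon>) X mtopology g g' \<longleftrightarrow>
    (\<exists>k. continuous_map (prod_topology \<I> X) mtopology k \<and> (\<forall>x\<in>topspace X. k (0, x) = g x) \<and>
      (\<forall>x\<in>topspace X. k (1, x) = g' x) \<and> (\<forall>t\<in>{0..1}. based_close A p f C \<epsilon> (\<lambda>x. k (t, x))))"
  by (rule homotopic_with) (use based_close_cong[OF assms] in blast)

text \<open>The whole homotopy, not only its end \<open>g\<close>, has to stay near \<open>f\<close>
  on \<open>C\<close>. This is what permits appending it to a homotopy that ends in \<open>f\<close>
  without leaving a neighbourhood of the latter.\<close>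

definition homotopy_nbhd :: "'b topology \<Rightarrow> 'b set \<Rightarrow> 'a \<Rightarrow> ('b \<Rightarrow> 'a) \<Rightarrow> 'b set \<Rightarrow> real \<Rightarrow> ('b \<Rightarrow> 'a) set" where
  "homotopy_nbhd X A p f C \<epsilon> =
     {g \<in> pair_maps X A mtopology p. homotopic_with (based_close A p f C \<epsilon>) X mtopology f g}"

lemma homotopy_nbhd_mono:
  assumes "C \<subseteq> C'" "\<epsilon>' \<le> \<epsilon>"
  shows "homotopy_nbhd X A p f C' \<epsilon>' \<subseteq> homotopy_nbhd X A p f C \<epsilon>"
proof
  fix g assume g: "g \<in> homotopy_nbhd X A p f C' \<epsilon>'"
  then have h: "homotopic_with (based_close A p f C' \<epsilon>') X mtopology f g" by (simp add: homotopy_nbhd_def)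
  have "homotopic_with (based_close A p f C \<epsilon>) X mtopology f g"
    by (rule homotopic_with_mono[OF h]) (use assms in \<open>force simp: based_close_def\<close>)
  then show "g \<in> homotopy_nbhd X A p f C \<epsilon>" using g by (simp add: homotopy_nbhd_def)
qed

text \<open>In this topology, being close to \<open>f\<close> means being joined to \<open>f\<close> by a homotopy that moves
  points little on a large compact set. On every homotopy class it is the quotient of the space of
  homotopies starting at any fixed member of the class.\<close>

definition homotopy_topology :: "'b topology \<Rightarrow> 'b set \<Rightarrow> 'a \<Rightarrow> ('b \<Rightarrow> 'a) topology" where
  "homotopy_topology X A p = topology (\<lambda>W. W \<subseteq> pair_maps X A mtopology p \<and>
     (\<forall>f\<in>W. \<exists>C \<epsilon>. compactin X C \<and> \<epsilon> > 0 \<and> homotopy_nbhd X A p f C \<epsilon> \<subseteq> W))"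

lemma openin_homotopy_topology:
  "openin (homotopy_topology X A p) W \<longleftrightarrow> W \<subseteq> pair_maps X A mtopology p \<and>
     (\<forall>f\<in>W. \<exists>C \<epsilon>. compactin X C \<and> \<epsilon> > 0 \<and> homotopy_nbhd X A p f C \<epsilon> \<subseteq> W)"
proof -
  let ?T = "\<lambda>W. W \<subseteq> pair_maps X A mtopology p \<and>
     (\<forall>f\<in>W. \<exists>C \<epsilon>. compactin X C \<and> \<epsilon> > 0 \<and> homotopy_nbhd X A p f C \<epsilon> \<subseteq> W)"
  have "istopology ?T" unfolding istopology_def
  proof (intro conjI allI impI ballI)
    fix S T assume S: "?T S" and T: "?T T"
    show "S \<inter> T \<subseteq> pair_maps X A mtopology p" using S by blast
    fix f assume f: "f \<in> S \<inter> T"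
    obtain C \<epsilon> where 1: "compactin X C" "\<epsilon> > 0" "homotopy_nbhd X A p f C \<epsilon> \<subseteq> S"
      using bspec[OF conjunct2[OF S] IntD1[OF f]] by (elim exE conjE)
    obtain C' \<epsilon>' where 2: "compactin X C'" "\<epsilon>' > 0" "homotopy_nbhd X A p f C' \<epsilon>' \<subseteq> T"
      using bspec[OF conjunct2[OF T] IntD2[OF f]] by (elim exE conjE)
    have "homotopy_nbhd X A p f (C \<union> C') (min \<epsilon> \<epsilon>') \<subseteq> S \<inter> T"
      using 1(3) 2(3) homotopy_nbhd_mono[of C "C \<union> C'" "min \<epsilon> \<epsilon>'" \<epsilon> X A p f]
        homotopy_nbhd_mono[of C' "C \<union> C'" "min \<epsilon> \<epsilon>'" \<epsilon>' X A p f] by auto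
    then show "\<exists>C \<epsilon>. compactin X C \<and> \<epsilon> > 0 \<and> homotopy_nbhd X A p f C \<epsilon> \<subseteq> S \<inter> T"
      using 1 2 by (intro exI[of _ "C \<union> C'"] exI[of _ "min \<epsilon> \<epsilon>'"]) (auto simp: compactin_Un)
  next
    fix \<K> assume K: "\<forall>U\<in>\<K>. ?T U"
    then show "\<Union>\<K> \<subseteq> pair_maps X A mtopology p" by blast
    fix f assume "f \<in> \<Union>\<K>"
    then obtain U where U: "U \<in> \<K>" "f \<in> U" by blast
    obtain C \<epsilon> where "compactin X C" "\<epsilon> > 0" "homotopy_nbhd X A p f C \<epsilon> \<subseteq> U"
      using bspec[OF conjunct2[OF bspec[OF K U(1)]] U(2)] by (elim exE conjE)
    then show "\<exists>C \<epsilon>. compactin X C \<and> \<epsilon> > 0 \<and> homotopy_nbhd X A p f C \<epsilon> \<subseteq> \<Union>\<K>"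
      using U(1) by (intro exI[of _ C] exI[of _ \<epsilon>]) auto
  qed
  then show ?thesis by (simp add: homotopy_topology_def topology_inverse')
qed

lemma topspace_homotopy_topology: "topspace (homotopy_topology X A p) = pair_maps X A mtopology p"
proof
  show "topspace (homotopy_topology X A p) \<subseteq> pair_maps X A mtopology p"
    using openin_topspace[of "homotopy_topology X A p"] unfolding openin_homotopy_topology by (rule conjunct1)
  have "openin (homotopy_topology X A p) (pair_maps X A mtopology p)"
    unfolding openin_homotopy_topology
    by (intro conjI ballI exI[of _ "{}"] exI[of _ 1]) (auto simp: homotopy_nbhd_def)
  then show "pair_maps X A mtopology p \<subseteq> topspace (homotopy_topology X A p)" by (rule openin_subset)
qed

lemma openin_homotopy_topology_finer:
  assumes "openin (map_space X A mtopology p) W"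
  shows "openin (homotopy_topology X A p) W"
  unfolding openin_homotopy_topology
proof (intro conjI ballI)
  show "W \<subseteq> pair_maps X A mtopology p" using assms unfolding openin_map_space_iff by (rule conjunct1)
  fix f assume f: "f \<in> W"
  obtain C \<epsilon> where C: "compactin X C" "\<epsilon> > 0" "compact_nbhd X A p f C \<epsilon> \<subseteq> W"
    using bspec[OF conjunct2[OF assms[unfolded openin_map_space_iff]] f] by (elim exE conjE)
  have "homotopy_nbhd X A p f C \<epsilon> \<subseteq> compact_nbhd X A p f C \<epsilon>"
  proof
    fix g assume g: "g \<in> homotopy_nbhd X A p f C \<epsilon>"
    then have "homotopic_with (based_close A p f C \<epsilon>) X mtopology f g" by (simp add: homotopy_nbhd_def)
    then have "based_close A p f C \<epsilon> g" using homotopic_with_imp_property by blast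
    then show "g \<in> compact_nbhd X A p f C \<epsilon>"
      using g by (simp add: homotopy_nbhd_def compact_nbhd_def based_close_def)
  qed
  then show "\<exists>C \<epsilon>. compactin X C \<and> \<epsilon> > 0 \<and> homotopy_nbhd X A p f C \<epsilon> \<subseteq> W"
    using C by (intro exI[of _ C] exI[of _ \<epsilon>]) auto
qed

text \<open>A controlled homotopy from the end of \<open>h\<close> to \<open>g\<close> is appended
  to \<open>h\<close>: \<open>h\<close> is run through by time \<open>1 - \<delta>\<close>, and the
  new piece is squeezed into the remaining time. The start is unchanged, so the result lies in the
  same fibre and, if \<open>\<delta>\<close> is small, in \<open>N\<close>.\<close>

lemma open_map_end:
  fixes X :: "'b topology"
  assumes A: "A \<subseteq> topspace X"
  shows "open_map (subtopology (homotopy_space X A p) {h \<in> topspace (homotopy_space X A p). slice X 0 h = y})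
           (homotopy_topology X A p) (slice X 1)"
  unfolding open_map_def
proof (intro allI impI)
  fix N assume "openin (subtopology (homotopy_space X A p) {h \<in> topspace (homotopy_space X A p). slice X 0 h = y}) N"
  then obtain N' where N': "openin (homotopy_space X A p) N'" "N = N' \<inter> {h \<in> homotopies X A p. slice X 0 h = y}"
    unfolding openin_subtopology topspace_homotopy_space by blast
  show "openin (homotopy_topology X A p) (slice X 1 ` N)" unfolding openin_homotopy_topology
  proof (intro conjI ballI)
    show "slice X 1 ` N \<subseteq> pair_maps X A mtopology p" using slice_in_pair_maps[OF _ _ A] N'(2) by auto
    fix f assume "f \<in> slice X 1 ` N"
    then obtain h where h: "h \<in> N'" "h \<in> homotopies X A p" "slice X 0 h = y" "f = slice X 1 h"
      using N'(2) by blast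
    obtain C \<epsilon> where C: "compactin X C" "\<epsilon> > 0"
      "\<forall>k\<in>homotopies X A p. (\<forall>t\<in>{0..1}. \<forall>x\<in>C. d (h (t, x)) (k (t, x)) < \<epsilon>) \<longrightarrow> k \<in> N'"
      by (rule homotopy_space_nbhd[OF N'(1) h(1)])
    have CX: "C \<subseteq> topspace X" using C(1) by (rule compactin_subset_topspace)
    have ch: "continuous_map (prod_topology \<I> X) mtopology h" using h(2) by (rule homotopies_continuous)
    have "\<epsilon>/2 > 0" using C(2) by simp
    then obtain \<delta>' where \<delta>': "\<delta>' > 0"
      "\<And>s t x. s \<in> {0..1} \<Longrightarrow> t \<in> {0..1} \<Longrightarrow> \<bar>s - t\<bar> < \<delta>' \<Longrightarrow> x \<in> C \<Longrightarrow> d (h (s, x)) (h (t, x)) < \<epsilon>/2"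
      using homotopy_uniformly_continuous[OF ch C(1)] by metis
    \<comment> \<open>Running \<open>h\<close> faster shifts its time by at most
      \<open>\<delta>\<close>, which costs less than \<open>\<epsilon>/2\<close>. In the last piece
      \<open>h\<close> is within \<open>\<epsilon>/2\<close> of its end, and the appended homotopy
      adds another \<open>\<epsilon>/2\<close>. Halving \<open>\<delta>'\<close> makes the
      inequality strict, and the bound \<open>1/2\<close> keeps \<open>1 - \<delta>\<close>
      positive.\<close>
    define \<delta> where "\<delta> = min (\<delta>'/2) (1/2)"
    have \<delta>: "0 < \<delta>" "\<delta> < 1" "\<delta> < \<delta>'" using \<delta>'(1) by (auto simp: \<delta>_def)
    have "homotopy_nbhd X A p f C (\<epsilon>/2) \<subseteq> slice X 1 ` N"
    proof
      fix g assume "g \<in> homotopy_nbhd X A p f C (\<epsilon>/2)"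
      then have g: "g \<in> pair_maps X A mtopology p" and "homotopic_with (based_close A p f C (\<epsilon>/2)) X mtopology f g"
        by (auto simp: homotopy_nbhd_def)
      then obtain k where k: "continuous_map (prod_topology \<I> X) mtopology k" "\<forall>x\<in>topspace X. k (0, x) = f x"
        "\<forall>x\<in>topspace X. k (1, x) = g x" "\<forall>t\<in>{0..1}. based_close A p f C (\<epsilon>/2) (\<lambda>x. k (t, x))"
        unfolding homotopic_with_based_close[OF A CX] by (elim exE conjE)
      define m where "m z = (if fst z \<le> 1 - \<delta> then h (fst z / (1 - \<delta>), snd z) else k ((fst z - (1 - \<delta>)) / \<delta>, snd z))" for z
      have cm: "continuous_map (prod_topology \<I> X) mtopology m"
        unfolding m_def
      proof (rule continuous_map_cases_le)
        show "continuous_map (prod_topology \<I> X) euclideanreal fst" by (rule continuous_map_time)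
        show "continuous_map (prod_topology \<I> X) euclideanreal (\<lambda>z. 1 - \<delta>)" by simp
        let ?S = "subtopology (prod_topology \<I> X) {x \<in> topspace (prod_topology \<I> X). fst x \<le> 1 - \<delta>}"
        show "continuous_map ?S mtopology (\<lambda>z. h (fst z / (1 - \<delta>), snd z))"
        proof (rule continuous_map_cylinder[OF ch])
          show "continuous_map ?S euclideanreal (\<lambda>z. fst z / (1 - \<delta>))"
            using \<delta> by (intro continuous_map_real_divide continuous_map_from_subtopology continuous_map_time) auto
          show "continuous_map ?S X snd" by (intro continuous_map_from_subtopology continuous_map_snd)
        qed (use \<delta> in \<open>auto simp: field_simps\<close>)
        let ?S = "subtopology (prod_topology \<I> X) {x \<in> topspace (prod_topology \<I> X). 1 - \<delta> \<le> fst x}"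
        show "continuous_map ?S mtopology (\<lambda>z. k ((fst z - (1 - \<delta>)) / \<delta>, snd z))"
        proof (rule continuous_map_cylinder[OF k(1)])
          show "continuous_map ?S euclideanreal (\<lambda>z. (fst z - (1 - \<delta>)) / \<delta>)"
            using \<delta> by (intro continuous_map_real_divide continuous_map_diff continuous_map_from_subtopology continuous_map_time) auto
          show "continuous_map ?S X snd" by (intro continuous_map_from_subtopology continuous_map_snd)
        qed (use \<delta> in \<open>auto simp: field_simps\<close>)
        fix z assume "z \<in> topspace (prod_topology \<I> X)" "fst z = 1 - \<delta>"
        then show "h (fst z / (1 - \<delta>), snd z) = k ((fst z - (1 - \<delta>)) / \<delta>, snd z)"
          using \<delta> k(2) h(4) by (auto simp: slice_def)
      qed
      have kA: "k (t, x) = p" if "t \<in> {0..1}" "x \<in> A" for t x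
        using bspec[OF k(4) that(1)] that(2) unfolding based_close_def by blast
      have mA: "m (t, x) = p" if "t \<in> {0..1}" "x \<in> A" for t x
      proof (cases "t \<le> 1 - \<delta>")
        case True
        then show ?thesis using that \<delta> by (auto simp: m_def field_simps intro!: homotopies_base[OF h(2)])
      next
        case False
        then show ?thesis using that \<delta> by (auto simp: m_def field_simps intro!: kA)
      qed
      define q where "q = restrict m ({0..1} \<times> topspace X)"
      have qH: "q \<in> homotopies X A p" unfolding q_def by (rule restrict_in_homotopies[OF cm mA A])
      have "slice X 0 q = slice X 0 m" unfolding q_def by (rule slice_restrict) simp
      also have "\<dots> = y" using \<delta> h(3) by (auto simp: slice_def m_def)
      finally have q0: "slice X 0 q = y" .
      have "slice X 1 q = slice X 1 m" unfolding q_def by (rule slice_restrict) simp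
      also have "\<dots> = g" by (rule slice_eqI[OF g]) (use \<delta> k(3) in \<open>auto simp: m_def\<close>)
      finally have q1: "slice X 1 q = g" .
      have "q \<in> N'"
      proof (rule C(3)[rule_format, OF qH])
        fix t :: real and x assume t: "t \<in> {0..1}" and x: "x \<in> C"
        then have xX: "x \<in> topspace X" using CX by blast
        have qm: "q (t, x) = m (t, x)" using t xX by (simp add: q_def)
        show "d (h (t, x)) (q (t, x)) < \<epsilon>"
        proof (cases "t \<le> 1 - \<delta>")
          case True
          have s: "t / (1 - \<delta>) \<in> {0..1}" using True t \<delta> by (auto simp: field_simps)
          have "t / (1 - \<delta>) - t = \<delta> * (t / (1 - \<delta>))" using \<delta> by (simp add: field_simps)
          moreover have "0 \<le> \<delta> * (t / (1 - \<delta>))" "\<delta> * (t / (1 - \<delta>)) \<le> \<delta> * 1"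
            using s \<delta> by (auto intro!: mult_left_mono simp del: times_divide_eq_right)
          ultimately have "\<bar>t - t / (1 - \<delta>)\<bar> < \<delta>'" using \<delta> by linarith
          then have "d (h (t, x)) (h (t / (1 - \<delta>), x)) < \<epsilon>/2" using \<delta>'(2)[OF t s] x by blast
          then show ?thesis using True C(2) by (simp add: qm m_def)
        next
          case False
          define s where "s = (t - (1 - \<delta>)) / \<delta>"
          have s: "s \<in> {0..1}" using False t \<delta> by (auto simp: field_simps s_def)
          have "d (h (t, x)) (h (1, x)) < \<epsilon>/2" using \<delta>'(2)[OF t, of 1 x] False t \<delta> x by auto
          moreover have "f x = h (1, x)" using xX h(4) by (simp add: slice_def)
          then have "d (h (1, x)) (k (s, x)) < \<epsilon>/2"
            using bspec[OF conjunct2[OF bspec[OF k(4) s, unfolded based_close_def]] x] by simp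
          moreover have "d (h (t, x)) (k (s, x)) \<le> d (h (t, x)) (h (1, x)) + d (h (1, x)) (k (s, x))"
            using t s xX homotopies_in_M[OF h(2)] k(1) by (intro triangle) (auto simp: continuous_map_def)
          ultimately show ?thesis using False by (simp add: qm m_def s_def)
        qed
      qed
      then have "q \<in> N" using N'(2) qH q0 by blast
      then show "g \<in> slice X 1 ` N" using q1 by blast
    qed
    then show "\<exists>C \<epsilon>. compactin X C \<and> \<epsilon> > 0 \<and> homotopy_nbhd X A p f C \<epsilon> \<subseteq> slice X 1 ` N"
      using C(1) \<open>\<epsilon>/2 > 0\<close> by (intro exI[of _ C] exI[of _ "\<epsilon>/2"]) auto
  qed
qed

end

text \<open>\<open>L\<close> is continuous on all pairs of points, but has to reach its target only
  at distance at most 1. Thus \<open>L\<close> of two maps is continuous on all of \<open>X\<close>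
  even where the maps are far apart, and no neighbourhood of the diagonal has to be carried along.
  \<open>L_d\<close> keeps the path no farther from its start than the target.\<close>

locale path_connecting_metric = Metric_space M d for M :: "'b set" and d +
  fixes L :: "'b \<Rightarrow> 'b \<Rightarrow> real \<Rightarrow> 'b"
  assumes complete: mcomplete and sc: "second_countable mtopology"
    and L_cont: "continuous_map (prod_topology (prod_topology mtopology mtopology) \<I>) mtopology (\<lambda>((x, y), t). L x y t)"
    and L_0: "\<And>x y. x \<in> M \<Longrightarrow> y \<in> M \<Longrightarrow> L x y 0 = x"
    and L_1: "\<And>x y. x \<in> M \<Longrightarrow> y \<in> M \<Longrightarrow> d x y \<le> 1 \<Longrightarrow> L x y 1 = y"
    and L_d: "\<And>x y t. x \<in> M \<Longrightarrow> y \<in> M \<Longrightarrow> t \<in> {0..1} \<Longrightarrow> d x (L x y t) \<le> d x y"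
begin

lemma L_in_M: "x \<in> M \<Longrightarrow> y \<in> M \<Longrightarrow> t \<in> {0..1} \<Longrightarrow> L x y t \<in> M"
  using continuous_map_image_subset_topspace[OF L_cont] by (force simp: image_subset_iff)

text \<open>A consequence of \<open>L_d\<close>: over \<open>A\<close>, where both maps take the
  value \<open>p\<close>, a connecting homotopy built from \<open>L\<close> rests at
  \<open>p\<close>.\<close>

lemma L_self: "x \<in> M \<Longrightarrow> t \<in> {0..1} \<Longrightarrow> L x x t = x"
  using L_d[of x x t] L_in_M[of x x t] nonneg[of x "L x x t"] zero[of x "L x x t"] by simp

lemma continuous_map_L:
  assumes "continuous_map Z mtopology a" "continuous_map Z mtopology b"
    "continuous_map Z euclideanreal s" "\<And>z. z \<in> topspace Z \<Longrightarrow> s z \<in> {0..1}"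
  shows "continuous_map Z mtopology (\<lambda>z. L (a z) (b z) (s z))"
proof -
  have "continuous_map Z \<I> s" using assms(3,4) by (auto simp: continuous_map_in_subtopology)
  then have "continuous_map Z (prod_topology (prod_topology mtopology mtopology) \<I>) (\<lambda>z. ((a z, b z), s z))"
    using assms(1,2) by (intro continuous_map_pairedI)
  from continuous_map_compose[OF this L_cont] show ?thesis by (simp add: o_def)
qed

lemma continuous_map_end:
  fixes X :: "'x topology"
  assumes A: "A \<subseteq> topspace X" and X: "metrizable_space X" "locally_compact_space X"
  shows "continuous_map (subtopology (homotopy_space X A p) {h \<in> topspace (homotopy_space X A p). slice X 0 h = y})
           (homotopy_topology X A p) (slice X 1)"
  unfolding continuous_map topspace_homotopy_topology topspace_subtopology topspace_homotopy_space
proof (intro conjI allI impI)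
  let ?F = "{h \<in> homotopies X A p. slice X 0 h = y}"
  show "slice X 1 ` (homotopies X A p \<inter> ?F) \<subseteq> pair_maps X A mtopology p"
    using slice_in_pair_maps[OF _ _ A] by auto
  fix U assume U: "openin (homotopy_topology X A p) U"
  show "openin (subtopology (homotopy_space X A p) ?F) {h \<in> homotopies X A p \<inter> ?F. slice X 1 h \<in> U}"
  proof (subst openin_subopen, intro ballI)
    fix h assume "h \<in> {h \<in> homotopies X A p \<inter> ?F. slice X 1 h \<in> U}"
    then have h: "h \<in> homotopies X A p" "slice X 0 h = y" "slice X 1 h \<in> U" by auto
    define f where "f = slice X 1 h"
    obtain C \<epsilon> where C: "compactin X C" "\<epsilon> > 0" "homotopy_nbhd X A p f C \<epsilon> \<subseteq> U"
      using bspec[OF conjunct2[OF U[unfolded openin_homotopy_topology]] h(3)] unfolding f_def by (elim exE conjE)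
    have CX: "C \<subseteq> topspace X" using C(1) by (rule compactin_subset_topspace)
    obtain u K where u: "continuous_map X euclideanreal u" "\<And>x. x \<in> topspace X \<Longrightarrow> u x \<in> {0..1}"
      "compactin X K" "\<And>x. x \<in> C \<Longrightarrow> u x = 1" "\<And>x. x \<in> topspace X \<Longrightarrow> x \<notin> K \<Longrightarrow> u x = 0"
      using compact_cutoff[OF X C(1)] by metis
    have uI: "0 \<le> u x" "u x \<le> 1" if "x \<in> topspace X" for x using u(2)[OF that] by auto
    have ch: "continuous_map (prod_topology \<I> X) mtopology h" using h(1) by (rule homotopies_continuous)
    \<comment> \<open>Closeness on \<open>K\<close> is needed at all times, because the crossing
      from \<open>h\<close> to \<open>k\<close> takes place at time \<open>u x\<close>, which can be
      any number in the interval. The bound 1 lets \<open>L\<close> reach its target; the bound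
      \<open>\<epsilon>\<close> controls the crossing on \<open>C\<close>.\<close>
    define N where "N = compact_nbhd (prod_topology \<I> X) ({0..1} \<times> A) p h ({0..1} \<times> K) (min 1 \<epsilon>)"
    have cK: "compactin (prod_topology \<I> X) ({0..1} \<times> K)"
      using u(3) by (simp add: compactin_Times compactin_subtopology)
    have hH: "h \<in> pair_maps (prod_topology \<I> X) ({0..1} \<times> A) mtopology p"
      using h(1) by (simp add: homotopies_def)
    have oN: "openin (homotopy_space X A p) N"
      unfolding N_def homotopy_space_def by (rule openin_compact_nbhd[OF cK hH])
    have hN: "h \<in> N" unfolding N_def using C(2) by (intro self_in_compact_nbhd[OF hH cK]) simp
    have uc: "continuous_map (prod_topology \<I> X) euclideanreal (\<lambda>z. u (snd z))"
      using u(1) by (rule continuous_map_space)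
    have main: "slice X 1 k \<in> U" if kN: "k \<in> N" and k0: "slice X 0 k = y" for k
    proof -
      have k: "k \<in> homotopies X A p" using kN by (simp add: N_def compact_nbhd_def homotopies_def)
      have ck: "continuous_map (prod_topology \<I> X) mtopology k" using k by (rule homotopies_continuous)
      have near: "d (h (t, x)) (k (t, x)) < min 1 \<epsilon>" if "t \<in> {0..1}" "x \<in> K" for t x
        using kN that unfolding N_def compact_nbhd_def by blast
      have same0: "h (0, x) = k (0, x)" if "x \<in> topspace X" for x
      proof -
        have "slice X 0 h x = slice X 0 k x" using h(2) k0 by simp
        then show ?thesis using that by (simp add: slice_def)
      qed
      \<comment> \<open>Outside \<open>K\<close> nothing is known about \<open>k\<close>, but there
        the crossing takes place at time 0, where \<open>h\<close> and \<open>k\<close> agree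
        because they lie in the same fibre.\<close>
      have nearu: "d (h (u x, x)) (k (u x, x)) < min 1 \<epsilon>" if x: "x \<in> topspace X" for x
      proof (cases "x \<in> K")
        case True
        then show ?thesis using near u(2)[OF x] by blast
      next
        case False
        then show ?thesis using u(5)[OF x False] same0[OF x] homotopies_in_M[OF k _ x, of 0] C(2) by simp
      qed
      have fC: "f x = h (1, x)" if "x \<in> topspace X" for x using that by (simp add: f_def slice_def)
      have dfh: "d (f x) (h (1, x)) = 0" if "x \<in> topspace X" for x
        using fC[OF that] homotopies_in_M[OF h(1) _ that, of 1] by simp
      \<comment> \<open>From \<open>f\<close> run back along \<open>h\<close> to time \<open>u\<close>, cross over to \<open>k\<close>, and run forward along \<open>k\<close>. Where
        \<open>h\<close> and \<open>k\<close> are not known to be close, \<open>u\<close> vanishes and the crossing is constant; on \<open>C\<close> only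
        the crossing is left.\<close>
      have s1: "homotopic_with (based_close A p f C \<epsilon>) X mtopology f (\<lambda>x. h (u x, x))"
        unfolding homotopic_with_based_close[OF A CX]
      proof (intro exI[of _ "\<lambda>z. h (1 - fst z * (1 - u (snd z)), snd z)"] conjI ballI)
        show "continuous_map (prod_topology \<I> X) mtopology (\<lambda>z. h (1 - fst z * (1 - u (snd z)), snd z))"
        proof (rule continuous_map_cylinder[OF ch])
          show "continuous_map (prod_topology \<I> X) euclideanreal (\<lambda>z. 1 - fst z * (1 - u (snd z)))"
            by (intro continuous_map_diff continuous_map_real_mult continuous_map_time uc) auto
          fix z assume "z \<in> topspace (prod_topology \<I> X)"
          then have "0 \<le> fst z" "fst z \<le> 1" "0 \<le> 1 - u (snd z)" "1 - u (snd z) \<le> 1" using uI by auto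
          then show "1 - fst z * (1 - u (snd z)) \<in> {0..1}" by (simp add: mult_le_one)
        qed (rule continuous_map_snd)
        fix t :: real assume t: "t \<in> {0..1}"
        show "based_close A p f C \<epsilon> (\<lambda>x. h (1 - fst (t, x) * (1 - u (snd (t, x))), snd (t, x)))"
          unfolding based_close_def
        proof (intro conjI ballI image_subsetI)
          fix x assume x: "x \<in> A"
          then have "0 \<le> 1 - u x" "1 - u x \<le> 1" using uI[of x] A by auto
          then have "1 - t * (1 - u x) \<in> {0..1}" using t by (simp add: mult_le_one)
          then show "h (1 - fst (t, x) * (1 - u (snd (t, x))), snd (t, x)) \<in> {p}"
            using homotopies_base[OF h(1) _ x] by simp
        next
          fix x assume "x \<in> C"
          then show "d (f x) (h (1 - fst (t, x) * (1 - u (snd (t, x))), snd (t, x))) < \<epsilon>"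
            using u(4) dfh CX C(2) by auto
        qed
      qed (use fC in simp_all)
      have s2: "homotopic_with (based_close A p f C \<epsilon>) X mtopology (\<lambda>x. h (u x, x)) (\<lambda>x. k (u x, x))"
        unfolding homotopic_with_based_close[OF A CX]
      proof (intro exI[of _ "\<lambda>z. L (h (u (snd z), snd z)) (k (u (snd z), snd z)) (fst z)"] conjI ballI)
        show "continuous_map (prod_topology \<I> X) mtopology (\<lambda>z. L (h (u (snd z), snd z)) (k (u (snd z), snd z)) (fst z))"
          by (rule continuous_map_L; (rule continuous_map_cylinder[OF ch] continuous_map_cylinder[OF ck])?)
             (use uc u(2) continuous_map_snd[of \<I> X] continuous_map_time[of X] in auto)
        fix x assume x: "x \<in> topspace X"
        have "h (u x, x) \<in> M" "k (u x, x) \<in> M"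
          using homotopies_in_M[OF h(1) u(2)[OF x] x] homotopies_in_M[OF k u(2)[OF x] x] by auto
        then show "L (h (u (snd (0, x)), snd (0, x))) (k (u (snd (0, x)), snd (0, x))) (fst (0, x)) = h (u x, x)"
          "L (h (u (snd (1, x)), snd (1, x))) (k (u (snd (1, x)), snd (1, x))) (fst (1, x)) = k (u x, x)"
          using L_0 L_1 nearu[OF x] by auto
      next
        fix t :: real assume t: "t \<in> {0..1}"
        show "based_close A p f C \<epsilon> (\<lambda>x. L (h (u (snd (t, x)), snd (t, x))) (k (u (snd (t, x)), snd (t, x))) (fst (t, x)))"
          unfolding based_close_def
        proof (intro conjI ballI image_subsetI)
          fix x assume x: "x \<in> A"
          then have xX: "x \<in> topspace X" using A by blast
          have "h (u x, x) = p" "k (u x, x) = p"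
            using homotopies_base[OF h(1) u(2)[OF xX] x] homotopies_base[OF k u(2)[OF xX] x] by auto
          moreover have "p \<in> M" using homotopies_in_M[OF h(1) u(2)[OF xX] xX] calculation by simp
          ultimately show "L (h (u (snd (t, x)), snd (t, x))) (k (u (snd (t, x)), snd (t, x))) (fst (t, x)) \<in> {p}"
            using L_self[OF _ t] by simp
        next
          fix x assume x: "x \<in> C"
          then have xX: "x \<in> topspace X" using CX by blast
          have "h (1, x) \<in> M" "k (1, x) \<in> M"
            using homotopies_in_M[OF h(1) _ xX] homotopies_in_M[OF k _ xX] by auto
          then have "d (h (1, x)) (L (h (1, x)) (k (1, x)) t) \<le> d (h (1, x)) (k (1, x))"
            using L_d t by blast
          moreover have "d (h (1, x)) (k (1, x)) < \<epsilon>" using nearu[OF xX] u(4)[OF x] by simp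
          ultimately show "d (f x) (L (h (u (snd (t, x)), snd (t, x))) (k (u (snd (t, x)), snd (t, x))) (fst (t, x))) < \<epsilon>"
            using u(4)[OF x] fC[OF xX] by simp
        qed
      qed
      have s3: "homotopic_with (based_close A p f C \<epsilon>) X mtopology (\<lambda>x. k (u x, x)) (slice X 1 k)"
        unfolding homotopic_with_based_close[OF A CX]
      proof (intro exI[of _ "\<lambda>z. k (1 - (1 - fst z) * (1 - u (snd z)), snd z)"] conjI ballI)
        show "continuous_map (prod_topology \<I> X) mtopology (\<lambda>z. k (1 - (1 - fst z) * (1 - u (snd z)), snd z))"
        proof (rule continuous_map_cylinder[OF ck])
          show "continuous_map (prod_topology \<I> X) euclideanreal (\<lambda>z. 1 - (1 - fst z) * (1 - u (snd z)))"
            by (intro continuous_map_diff continuous_map_real_mult continuous_map_time uc) auto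
          fix z assume "z \<in> topspace (prod_topology \<I> X)"
          then have "0 \<le> 1 - fst z" "1 - fst z \<le> 1" "0 \<le> 1 - u (snd z)" "1 - u (snd z) \<le> 1" using uI by auto
          then show "1 - (1 - fst z) * (1 - u (snd z)) \<in> {0..1}" by (simp add: mult_le_one)
        qed (rule continuous_map_snd)
        fix t :: real assume t: "t \<in> {0..1}"
        show "based_close A p f C \<epsilon> (\<lambda>x. k (1 - (1 - fst (t, x)) * (1 - u (snd (t, x))), snd (t, x)))"
          unfolding based_close_def
        proof (intro conjI ballI image_subsetI)
          fix x assume x: "x \<in> A"
          then have "0 \<le> 1 - u x" "1 - u x \<le> 1" using uI[of x] A by auto
          then have "1 - (1 - t) * (1 - u x) \<in> {0..1}" using t by (simp add: mult_le_one)
          then show "k (1 - (1 - fst (t, x)) * (1 - u (snd (t, x))), snd (t, x)) \<in> {p}"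
            using homotopies_base[OF k _ x] by simp
        next
          fix x assume x: "x \<in> C"
          then have xX: "x \<in> topspace X" using CX by blast
          have "d (h (1, x)) (k (1, x)) < \<epsilon>" using nearu[OF xX] u(4)[OF x] by simp
          then show "d (f x) (k (1 - (1 - fst (t, x)) * (1 - u (snd (t, x))), snd (t, x))) < \<epsilon>"
            using u(4)[OF x] fC[OF xX] by simp
        qed
      qed (simp_all add: slice_def)
      have "homotopic_with (based_close A p f C \<epsilon>) X mtopology f (slice X 1 k)"
        using homotopic_with_trans[OF homotopic_with_trans[OF s1 s2] s3] .
      then have "slice X 1 k \<in> homotopy_nbhd X A p f C \<epsilon>"
        using slice_in_pair_maps[OF k _ A, of 1] by (simp add: homotopy_nbhd_def)
      then show ?thesis using C(3) by blast
    qed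
    have "openin (subtopology (homotopy_space X A p) ?F) (N \<inter> ?F)"
      using oN unfolding openin_subtopology by blast
    moreover have "h \<in> N \<inter> ?F" using hN h by simp
    moreover have "N \<inter> ?F \<subseteq> {h \<in> homotopies X A p \<inter> ?F. slice X 1 h \<in> U}" using main by blast
    ultimately show "\<exists>T. openin (subtopology (homotopy_space X A p) ?F) T \<and> h \<in> T \<and>
        T \<subseteq> {h \<in> homotopies X A p \<inter> ?F. slice X 1 h \<in> U}" by blast
  qed
qed

text \<open>Given \<open>g\<close> close to the start \<open>f\<close> of \<open>h\<close> on
  \<open>K\<close>, the lift first goes from \<open>g\<close> to \<open>f\<close> along short paths
  and then follows \<open>h\<close>. The paths are known to arrive only over \<open>K\<close>, so
  the clock at \<open>x\<close> is slowed down by the factor \<open>u x\<close>: outside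
  \<open>K\<close> it stands still and the homotopy remains at \<open>g\<close>, while on
  \<open>C\<close> it shows the true time.\<close>

lemma open_map_start:
  fixes X :: "'x topology"
  assumes A: "A \<subseteq> topspace X" and X: "metrizable_space X" "locally_compact_space X"
  shows "open_map (homotopy_space X A p) (map_space X A mtopology p) (slice X 0)"
  unfolding open_map_def
proof (intro allI impI)
  fix N assume N: "openin (homotopy_space X A p) N"
  have NH: "N \<subseteq> homotopies X A p" using openin_subset[OF N] by (simp add: topspace_homotopy_space)
  show "openin (map_space X A mtopology p) (slice X 0 ` N)" unfolding openin_map_space_iff
  proof (intro conjI ballI)
    show "slice X 0 ` N \<subseteq> pair_maps X A mtopology p" using slice_in_pair_maps[OF _ _ A] NH by auto
    fix f assume "f \<in> slice X 0 ` N"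
    then obtain h where hN: "h \<in> N" and f: "f = slice X 0 h" by blast
    have h: "h \<in> homotopies X A p" using hN NH by blast
    have fp: "f \<in> pair_maps X A mtopology p" unfolding f by (rule slice_in_pair_maps[OF h _ A]) simp
    have fh: "f x = h (0, x)" if "x \<in> topspace X" for x using that by (simp add: f slice_def)
    obtain C \<epsilon> where C: "compactin X C" "\<epsilon> > 0"
      "\<forall>k\<in>homotopies X A p. (\<forall>t\<in>{0..1}. \<forall>x\<in>C. d (h (t, x)) (k (t, x)) < \<epsilon>) \<longrightarrow> k \<in> N"
      by (rule homotopy_space_nbhd[OF N hN])
    have CX: "C \<subseteq> topspace X" using C(1) by (rule compactin_subset_topspace)
    obtain u K where u: "continuous_map X euclideanreal u" "\<And>x. x \<in> topspace X \<Longrightarrow> u x \<in> {0..1}"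
      "compactin X K" "\<And>x. x \<in> C \<Longrightarrow> u x = 1" "\<And>x. x \<in> topspace X \<Longrightarrow> x \<notin> K \<Longrightarrow> u x = 0"
      using compact_cutoff[OF X C(1)] by metis
    have uI: "0 \<le> u x" "u x \<le> 1" if "x \<in> topspace X" for x using u(2)[OF that] by auto
    have uc: "continuous_map (prod_topology \<I> X) euclideanreal (\<lambda>z. u (snd z))"
      using u(1) by (rule continuous_map_space)
    have ch: "continuous_map (prod_topology \<I> X) mtopology h" using h by (rule homotopies_continuous)
    \<comment> \<open>In the initial phase three quarters add up: the motion of \<open>h\<close> up
      to time \<open>\<delta>\<close>, the distance from \<open>f\<close> to \<open>g\<close>, and
      the distance from \<open>g\<close> to the point on the short path. Afterwards only the time
      shift of \<open>h\<close> counts.\<close>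
    have "\<epsilon>/4 > 0" using C(2) by simp
    then obtain \<delta>' where \<delta>': "\<delta>' > 0"
      "\<And>s t x. s \<in> {0..1} \<Longrightarrow> t \<in> {0..1} \<Longrightarrow> \<bar>s - t\<bar> < \<delta>' \<Longrightarrow> x \<in> C \<Longrightarrow> d (h (s, x)) (h (t, x)) < \<epsilon>/4"
      using homotopy_uniformly_continuous[OF ch C(1)] by metis
    define \<delta> where "\<delta> = min (\<delta>'/2) (1/2)"
    have \<delta>: "0 < \<delta>" "\<delta> < 1" "\<delta> < \<delta>'" using \<delta>'(1) by (auto simp: \<delta>_def)
    have "compact_nbhd X A p f K (min 1 (\<epsilon>/4)) \<subseteq> slice X 0 ` N"
    proof
      fix g assume "g \<in> compact_nbhd X A p f K (min 1 (\<epsilon>/4))"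
      then have g: "g \<in> pair_maps X A mtopology p" and near: "\<And>x. x \<in> K \<Longrightarrow> d (f x) (g x) < min 1 (\<epsilon>/4)"
        by (auto simp: compact_nbhd_def)
      have gM: "g x \<in> M" and fM: "f x \<in> M" if "x \<in> topspace X" for x
        using pair_maps_in_M[OF g that] pair_maps_in_M[OF fp that] by auto
      have gc: "continuous_map (prod_topology \<I> X) mtopology (\<lambda>z. g (snd z))"
        and fc: "continuous_map (prod_topology \<I> X) mtopology (\<lambda>z. f (snd z))"
        using g fp by (auto simp: pair_maps_def intro!: continuous_map_space)
      define v where "v z = u (snd z) * fst z" for z
      have vc: "continuous_map (prod_topology \<I> X) euclideanreal v"
        unfolding v_def by (intro continuous_map_real_mult uc continuous_map_time)
      have vI: "0 \<le> v z" "v z \<le> 1" if "z \<in> topspace (prod_topology \<I> X)" for z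
        using that uI unfolding v_def by (auto intro!: mult_le_one)
      define m where "m z = (if v z \<le> \<delta> then L (g (snd z)) (f (snd z)) (v z / \<delta>)
          else h ((v z - \<delta>) / (1 - \<delta>), snd z))" for z
      have cm: "continuous_map (prod_topology \<I> X) mtopology m"
        unfolding m_def
      proof (rule continuous_map_cases_le)
        show "continuous_map (prod_topology \<I> X) euclideanreal v" by (rule vc)
        show "continuous_map (prod_topology \<I> X) euclideanreal (\<lambda>z. \<delta>)" by simp
        let ?S = "subtopology (prod_topology \<I> X) {x \<in> topspace (prod_topology \<I> X). v x \<le> \<delta>}"
        show "continuous_map ?S mtopology (\<lambda>z. L (g (snd z)) (f (snd z)) (v z / \<delta>))"
        proof (rule continuous_map_L)
          show "continuous_map ?S euclideanreal (\<lambda>z. v z / \<delta>)"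
            using \<delta> by (intro continuous_map_real_divide continuous_map_from_subtopology vc) auto
          show "continuous_map ?S mtopology (\<lambda>z. g (snd z))" "continuous_map ?S mtopology (\<lambda>z. f (snd z))"
            by (intro continuous_map_from_subtopology gc fc)+
          fix z assume "z \<in> topspace ?S"
          then show "v z / \<delta> \<in> {0..1}" using \<delta> vI(1)[of z] by (auto simp: field_simps)
        qed
        let ?S = "subtopology (prod_topology \<I> X) {x \<in> topspace (prod_topology \<I> X). \<delta> \<le> v x}"
        show "continuous_map ?S mtopology (\<lambda>z. h ((v z - \<delta>) / (1 - \<delta>), snd z))"
        proof (rule continuous_map_cylinder[OF ch])
          show "continuous_map ?S euclideanreal (\<lambda>z. (v z - \<delta>) / (1 - \<delta>))"
            using \<delta> by (intro continuous_map_real_divide continuous_map_diff continuous_map_from_subtopology vc) auto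
          show "continuous_map ?S X snd" by (intro continuous_map_from_subtopology continuous_map_snd)
          fix z assume "z \<in> topspace ?S"
          then show "(v z - \<delta>) / (1 - \<delta>) \<in> {0..1}" using \<delta> vI(2)[of z] by (auto simp: field_simps)
        qed
        \<comment> \<open>Where the two phases meet, the clock is positive, so the point lies in
          \<open>K\<close>. There \<open>f\<close> and \<open>g\<close> are at distance at most 1,
          hence the short path has indeed arrived at \<open>f\<close>.\<close>
        fix z assume z: "z \<in> topspace (prod_topology \<I> X)" "v z = \<delta>"
        then have x: "snd z \<in> topspace X" by auto
        have "u (snd z) \<noteq> 0" using z(2) \<delta>(1) by (auto simp: v_def)
        then have "snd z \<in> K" using u(5)[OF x] by blast
        then have "d (g (snd z)) (f (snd z)) \<le> 1" using near by (simp add: commute less_imp_le)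
        then have "L (g (snd z)) (f (snd z)) 1 = f (snd z)" using gM[OF x] fM[OF x] L_1 by blast
        then show "L (g (snd z)) (f (snd z)) (v z / \<delta>) = h ((v z - \<delta>) / (1 - \<delta>), snd z)"
          using z(2) \<delta> fh[OF x] by simp
      qed
      have mA: "m (t, x) = p" if t: "t \<in> {0..1}" and x: "x \<in> A" for t x
      proof -
        have xX: "x \<in> topspace X" using x A by blast
        have v: "0 \<le> v (t, x)" "v (t, x) \<le> 1" using vI[of "(t, x)"] t xX by auto
        have fg: "f x = p" "g x = p" using fp g x by (auto simp: pair_maps_def)
        show ?thesis
        proof (cases "v (t, x) \<le> \<delta>")
          case True
          have "v (t, x) / \<delta> \<in> {0..1}" using True v \<delta> by (auto simp: field_simps)
          then show ?thesis using True fg fM[OF xX] L_self by (simp add: m_def)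
        next
          case False
          have "(v (t, x) - \<delta>) / (1 - \<delta>) \<in> {0..1}" using False v \<delta> by (auto simp: field_simps)
          then show ?thesis using False homotopies_base[OF h _ x] by (simp add: m_def)
        qed
      qed
      define q where "q = restrict m ({0..1} \<times> topspace X)"
      have qH: "q \<in> homotopies X A p" unfolding q_def by (rule restrict_in_homotopies[OF cm mA A])
      have "slice X 0 q = slice X 0 m" unfolding q_def by (rule slice_restrict) simp
      also have "\<dots> = g"
      proof (rule slice_eqI[OF g])
        fix x assume "x \<in> topspace X"
        then show "m (0, x) = g x" using \<delta> L_0 gM fM by (simp add: m_def v_def)
      qed
      finally have q0: "slice X 0 q = g" .
      have "q \<in> N"
      proof (rule C(3)[rule_format, OF qH])
        fix t :: real and x assume t: "t \<in> {0..1}" and x: "x \<in> C"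
        then have xX: "x \<in> topspace X" using CX by blast
        have xK: "x \<in> K" using u(4)[OF x] u(5)[OF xX] by fastforce
        have vt: "v (t, x) = t" using u(4)[OF x] by (simp add: v_def)
        have qm: "q (t, x) = m (t, x)" using t xX by (simp add: q_def)
        show "d (h (t, x)) (q (t, x)) < \<epsilon>"
        proof (cases "t \<le> \<delta>")
          case True
          define s where "s = t / \<delta>"
          have s: "s \<in> {0..1}" using True t \<delta> by (auto simp: field_simps s_def)
          have "d (h (t, x)) (h (0, x)) < \<epsilon>/4" using \<delta>'(2)[OF t, of 0 x] True t \<delta> x by auto
          then have 1: "d (h (t, x)) (f x) < \<epsilon>/4" using fh[OF xX] by simp
          have 2: "d (f x) (g x) < \<epsilon>/4" using near[OF xK] by simp
          have 3: "d (g x) (L (g x) (f x) s) \<le> d (g x) (f x)" using gM[OF xX] fM[OF xX] s by (rule L_d)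
          have LM: "L (g x) (f x) s \<in> M" using gM[OF xX] fM[OF xX] s by (rule L_in_M)
          have hM: "h (t, x) \<in> M" using homotopies_in_M[OF h t xX] .
          have "d (h (t, x)) (L (g x) (f x) s) \<le> d (h (t, x)) (f x) + d (f x) (L (g x) (f x) s)"
            using hM fM[OF xX] LM by (rule triangle)
          moreover have "d (f x) (L (g x) (f x) s) \<le> d (f x) (g x) + d (g x) (L (g x) (f x) s)"
            using fM[OF xX] gM[OF xX] LM by (rule triangle)
          moreover have "q (t, x) = L (g x) (f x) s" using True by (simp add: qm m_def vt s_def)
          ultimately show ?thesis using 1 2 3 commute[of "g x" "f x"] C(2) by simp
        next
          case False
          define s where "s = (t - \<delta>) / (1 - \<delta>)"
          have s: "s \<in> {0..1}" using False t \<delta> by (auto simp: field_simps s_def)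
          have "t = s * (1 - \<delta>) + \<delta>" using \<delta> by (simp add: s_def)
          then have "t - s = \<delta> * (1 - s)" by (simp add: algebra_simps)
          moreover have "0 \<le> \<delta> * (1 - s)" "\<delta> * (1 - s) \<le> \<delta> * 1"
            using s \<delta> by (auto intro!: mult_left_mono simp del: mult_le_cancel_left)
          ultimately have "\<bar>t - s\<bar> < \<delta>'" using \<delta> by linarith
          then have "d (h (t, x)) (h (s, x)) < \<epsilon>/4" using \<delta>'(2)[OF t s] x by blast
          then show ?thesis using False C(2) by (simp add: qm m_def vt s_def)
        qed
      qed
      then show "g \<in> slice X 0 ` N" using q0 by blast
    qed
    then show "\<exists>C \<epsilon>. compactin X C \<and> \<epsilon> > 0 \<and> compact_nbhd X A p f C \<epsilon> \<subseteq> slice X 0 ` N"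
      using u(3) C(2) by (intro exI[of _ K] exI[of _ "min 1 (\<epsilon>/4)"]) auto
  qed
qed

section \<open>The homotopy relation for targets with short paths\<close>

lemma homotopy_rel_eq_slices:
  fixes X :: "'x topology"
  assumes A: "A \<subseteq> topspace X"
  shows "homotopy_rel X A mtopology p = (\<lambda>h. (slice X 0 h, slice X 1 h)) ` homotopies X A p"
proof -
  have cong: "(k ` A \<subseteq> {p}) = (k' ` A \<subseteq> {p})" if "\<And>x. x \<in> topspace X \<Longrightarrow> k x = k' x" for k k' :: "'x \<Rightarrow> 'b"
  proof -
    have "k ` A = k' ` A" using A that by (intro image_cong) auto
    then show ?thesis by simp
  qed
  have hom: "homotopic_with (\<lambda>k. k ` A \<subseteq> {p}) X mtopology f g \<longleftrightarrow>
    (\<exists>k. continuous_map (prod_topology \<I> X) mtopology k \<and> (\<forall>x\<in>topspace X. k (0, x) = f x) \<and>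
      (\<forall>x\<in>topspace X. k (1, x) = g x) \<and> (\<forall>t\<in>{0..1}. (\<lambda>x. k (t, x)) ` A \<subseteq> {p}))" for f g
    by (rule homotopic_with) (rule cong)
  show ?thesis
  proof (intro set_eqI iffI)
    fix z assume "z \<in> homotopy_rel X A mtopology p"
    then obtain f g where z: "z = (f, g)" and f: "f \<in> pair_maps X A mtopology p" and g: "g \<in> pair_maps X A mtopology p"
      and "homotopic_with (\<lambda>k. k ` A \<subseteq> {p}) X mtopology f g" unfolding homotopy_rel_def by blast
    then obtain k where k: "continuous_map (prod_topology \<I> X) mtopology k" "\<forall>x\<in>topspace X. k (0, x) = f x"
      "\<forall>x\<in>topspace X. k (1, x) = g x" "\<forall>t\<in>{0..1}. (\<lambda>x. k (t, x)) ` A \<subseteq> {p}"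
      unfolding hom by (elim exE conjE)
    define q where "q = restrict k ({0..1} \<times> topspace X)"
    have "q \<in> homotopies X A p" unfolding q_def
      by (rule restrict_in_homotopies[OF k(1) _ A]) (use k(4) in blast)
    moreover have "slice X 0 q = f"
      using slice_restrict[of 0 X k] slice_eqI[OF f, of k 0] k(2) by (simp add: q_def)
    moreover have "slice X 1 q = g"
      using slice_restrict[of 1 X k] slice_eqI[OF g, of k 1] k(3) by (simp add: q_def)
    ultimately show "z \<in> (\<lambda>h. (slice X 0 h, slice X 1 h)) ` homotopies X A p" using z by (intro image_eqI) auto
  next
    fix z assume "z \<in> (\<lambda>h. (slice X 0 h, slice X 1 h)) ` homotopies X A p"
    then obtain h where h: "h \<in> homotopies X A p" and z: "z = (slice X 0 h, slice X 1 h)" by blast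
    have "homotopic_with (\<lambda>k. k ` A \<subseteq> {p}) X mtopology (slice X 0 h) (slice X 1 h)"
      unfolding hom
    proof (intro exI[of _ h] conjI ballI)
      show "continuous_map (prod_topology \<I> X) mtopology h" using h by (rule homotopies_continuous)
      fix t :: real assume "t \<in> {0..1}"
      then show "(\<lambda>x. h (t, x)) ` A \<subseteq> {p}" using homotopies_base[OF h] by auto
    qed (simp_all add: slice_def)
    then show "z \<in> homotopy_rel X A mtopology p"
      using z slice_in_pair_maps[OF h _ A] by (simp add: homotopy_rel_def)
  qed
qed

lemma equiv_homotopy_rel: "equiv (pair_maps X A mtopology p) (homotopy_rel X A mtopology p)"
proof (rule equivI)
  show "homotopy_rel X A mtopology p \<subseteq> pair_maps X A mtopology p \<times> pair_maps X A mtopology p"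
    by (auto simp: homotopy_rel_def)
  show "refl_on (pair_maps X A mtopology p) (homotopy_rel X A mtopology p)"
    by (auto simp: refl_on_def homotopy_rel_def pair_maps_def homotopic_with_refl)
  show "sym (homotopy_rel X A mtopology p)"
    by (auto simp: sym_def homotopy_rel_def homotopic_with_sym)
  show "trans (homotopy_rel X A mtopology p)"
    by (auto simp: trans_def homotopy_rel_def intro: homotopic_with_trans)
qed

theorem idealistic_homotopy_rel:
  fixes X :: "'x topology"
  assumes "locally_compact_pair X A"
  shows "idealistic (map_space X A mtopology p) (homotopy_rel X A mtopology p)"
proof -
  have PX: "Polish_space X" and lc: "locally_compact_space X" and "closedin X A"
    using assms by (auto simp: locally_compact_pair_def)
  then have A: "A \<subseteq> topspace X" by (simp add: closedin_subset)
  have met: "metrizable_space X" using PX by (simp add: Polish_space_def completely_metrizable_imp_metrizable_space)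
  have HX: "Hausdorff_space X" using met by (rule metrizable_imp_Hausdorff_space)
  have scX: "second_countable X" using PX by (rule Polish_space_imp_second_countable)
  let ?Z = "prod_topology \<I> X"
  have lcI: "locally_compact_space \<I>"
    using compact_imp_locally_compact_space[of \<I>] by (simp add: compact_space_subtopology)
  have scI: "second_countable \<I>"
    by (rule second_countable_subtopology[OF second_countable_euclidean])
  have Z: "second_countable ?Z" "locally_compact_space ?Z" "Hausdorff_space ?Z"
    using scI scX lcI lc HX by (auto simp: second_countable_prod_topology locally_compact_space_prod_topology
        Hausdorff_space_prod_topology Hausdorff_space_subtopology)
  have AZ: "{0..1} \<times> A \<subseteq> topspace ?Z" using A by auto
  have cmY: "completely_metrizable_space (map_space X A mtopology p)"
    by (rule completely_metrizable_map_space[OF scX lc HX complete A])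
  have "second_countable (map_space X A mtopology p)"
    by (rule second_countable_map_space[OF scX lc HX sc])
  then have PY: "Polish_space (map_space X A mtopology p)"
    using cmY by (simp add: Polish_space_def second_countable_imp_separable_space)
  show ?thesis
  proof (rule idealistic_criterion[where H = "homotopy_space X A p" and \<tau> = "homotopy_topology X A p"
        and ?e0.0 = "slice X 0" and ?e1.0 = "slice X 1"])
    show "equiv (topspace (map_space X A mtopology p)) (homotopy_rel X A mtopology p)"
      by (simp add: topspace_map_space equiv_homotopy_rel)
    show "second_countable (homotopy_space X A p)"
      unfolding homotopy_space_def by (rule second_countable_map_space[OF Z sc])
    show "completely_metrizable_space (homotopy_space X A p)"
      unfolding homotopy_space_def by (rule completely_metrizable_map_space[OF Z complete AZ])
    show "Hausdorff_space (map_space X A mtopology p)"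
      using cmY by (simp add: completely_metrizable_imp_metrizable_space metrizable_imp_Hausdorff_space)
    show "homotopy_rel X A mtopology p = (\<lambda>h. (slice X 0 h, slice X 1 h)) ` topspace (homotopy_space X A p)"
      by (simp add: topspace_homotopy_space homotopy_rel_eq_slices[OF A])
    show "topspace (homotopy_topology X A p) = topspace (map_space X A mtopology p)"
      by (simp add: topspace_homotopy_topology topspace_map_space)
  qed (use PY A met lc in \<open>auto intro: continuous_map_slice open_map_start openin_homotopy_topology_finer
        continuous_map_end open_map_end\<close>)
qed

end

section \<open>The metric of the realization\<close>

definition supp :: "('v \<Rightarrow> real) \<Rightarrow> 'v set" where
  "supp x = {v. x v \<noteq> 0}"

definition l1_dist :: "('v \<Rightarrow> real) \<Rightarrow> ('v \<Rightarrow> real) \<Rightarrow> real" where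
  "l1_dist x y = (\<Sum>v\<in>supp x \<union> supp y. \<bar>x v - y v\<bar>)"

lemma l1_dist_eq_sum:
  assumes "finite G" "supp x \<subseteq> G" "supp y \<subseteq> G"
  shows "l1_dist x y = (\<Sum>v\<in>G. \<bar>x v - y v\<bar>)"
  unfolding l1_dist_def by (rule sum.mono_neutral_left) (use assms in \<open>auto simp: supp_def\<close>)

lemma continuous_on_coordinate: "continuous_on UNIV (\<lambda>x :: 'v \<Rightarrow> real. x v)"
  by (rule continuous_on_product_coordinates)

lemma closed_closed_simplex: "closed (closed_simplex s)"
proof -
  have "closed_simplex s = (\<Inter>v. {x. 0 \<le> x v}) \<inter> (\<Inter>v\<in>-s. {x. x v = 0}) \<inter> {x. sum x s = 1}"
    unfolding closed_simplex_def by auto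
  moreover have "closed {x :: 'a \<Rightarrow> real. 0 \<le> x v}" for v
    by (intro closed_Collect_le continuous_on_coordinate continuous_on_const)
  moreover have "closed {x :: 'a \<Rightarrow> real. x v = 0}" for v
    by (intro closed_Collect_eq continuous_on_coordinate continuous_on_const)
  moreover have "closed {x :: 'a \<Rightarrow> real. sum x s = 1}"
    by (intro closed_Collect_eq continuous_on_sum continuous_on_coordinate continuous_on_const)
  ultimately show ?thesis by (simp add: closed_INT closed_Int)
qed

section \<open>The realization as a metric space\<close>

locale simplicial_complex =
  fixes K :: "nat set set"
  assumes asc: "abstract_simplicial_complex K" and lf: "locally_finite_complex K"
begin

lemma finite_simplex: "s \<in> K \<Longrightarrow> finite s"
  using asc unfolding abstract_simplicial_complex_def by blast

lemma face_closed: "s \<in> K \<Longrightarrow> t \<subseteq> s \<Longrightarrow> t \<noteq> {} \<Longrightarrow> t \<in> K"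
  using asc unfolding abstract_simplicial_complex_def by blast

definition S :: "(nat \<Rightarrow> real) set" where "S = (\<Union>s\<in>K. closed_simplex s)"

text \<open>The support of a point is its carrier, the smallest simplex that contains it. This
  describes the points of the realization without choosing a simplex.\<close>

lemma S_iff: "x \<in> S \<longleftrightarrow> (\<forall>v. 0 \<le> x v) \<and> supp x \<in> K \<and> sum x (supp x) = 1"
proof
  assume "x \<in> S"
  then obtain s where s: "s \<in> K" "x \<in> closed_simplex s" by (auto simp: S_def)
  then have fin: "finite s" by (simp add: finite_simplex)
  have sub: "supp x \<subseteq> s" using s(2) by (auto simp: closed_simplex_def supp_def)
  have "sum x (supp x) = sum x s"
    by (rule sum.mono_neutral_left[OF fin sub]) (simp add: supp_def)
  then have sum1: "sum x (supp x) = 1" using s(2) by (simp add: closed_simplex_def)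
  then have "supp x \<noteq> {}" by auto
  then have "supp x \<in> K" using face_closed[OF s(1) sub] by blast
  then show "(\<forall>v. 0 \<le> x v) \<and> supp x \<in> K \<and> sum x (supp x) = 1"
    using s(2) sum1 by (simp add: closed_simplex_def)
next
  assume "(\<forall>v. 0 \<le> x v) \<and> supp x \<in> K \<and> sum x (supp x) = 1"
  then have "x \<in> closed_simplex (supp x)" "supp x \<in> K" by (auto simp: closed_simplex_def supp_def)
  then show "x \<in> S" by (auto simp: S_def)
qed

lemma nonneg_S: "x \<in> S \<Longrightarrow> 0 \<le> x v" by (simp add: S_iff)

lemma finite_supp: "x \<in> S \<Longrightarrow> finite (supp x)"
  by (simp add: S_iff finite_simplex)

lemma sum_S:
  assumes "x \<in> S" "finite G" "supp x \<subseteq> G"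
  shows "sum x G = 1"
proof -
  have "sum x (supp x) = sum x G"
    by (rule sum.mono_neutral_left[OF assms(2,3)]) (simp add: supp_def)
  then show ?thesis using assms(1) unfolding S_iff by simp
qed

lemma in_S_I:
  assumes "\<And>v. 0 \<le> x v" "finite G" "supp x \<subseteq> G" "sum x G = 1" "supp x \<subseteq> s" "s \<in> K"
  shows "x \<in> S"
proof -
  have "sum x (supp x) = sum x G" by (rule sum.mono_neutral_left) (use assms in \<open>auto simp: supp_def\<close>)
  moreover from this have "supp x \<noteq> {}" using assms(4) by auto
  then have "supp x \<in> K" using face_closed[OF assms(6,5)] by blast
  ultimately show ?thesis using assms by (simp add: S_iff)
qed

lemma l1_dist_zero_iff:
  assumes "x \<in> S" "y \<in> S"
  shows "l1_dist x y = 0 \<longleftrightarrow> x = y"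
proof
  assume z: "l1_dist x y = 0"
  have "finite (supp x \<union> supp y)" using assms by (simp add: finite_supp)
  then have d0: "\<forall>v\<in>supp x \<union> supp y. \<bar>x v - y v\<bar> = 0"
    using z unfolding l1_dist_def by (subst (asm) sum_nonneg_eq_0_iff) auto
  have "x v = y v" for v
  proof (cases "v \<in> supp x \<union> supp y")
    case True
    then show ?thesis using bspec[OF d0 True] by simp
  next
    case False
    then show ?thesis by (simp add: supp_def)
  qed
  then show "x = y" by (rule ext)
qed (simp add: l1_dist_def)

lemma l1_dist_triangle:
  assumes "x \<in> S" "y \<in> S" "z \<in> S"
  shows "l1_dist x z \<le> l1_dist x y + l1_dist y z"
proof -
  define G where "G = supp x \<union> supp y \<union> supp z"
  have fin: "finite G" using assms by (simp add: G_def finite_supp)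
  have sub: "supp x \<subseteq> G" "supp y \<subseteq> G" "supp z \<subseteq> G" by (auto simp: G_def)
  have "(\<Sum>v\<in>G. \<bar>x v - z v\<bar>) \<le> (\<Sum>v\<in>G. \<bar>x v - y v\<bar> + \<bar>y v - z v\<bar>)" by (intro sum_mono) auto
  then show ?thesis by (simp add: l1_dist_eq_sum[OF fin] sub sum.distrib)
qed

sublocale l1: Metric_space S l1_dist
proof
  show "0 \<le> l1_dist x y" for x y by (simp add: l1_dist_def sum_nonneg)
  show "l1_dist x y = l1_dist y x" for x y
    unfolding l1_dist_def by (rule sum.cong) auto
qed (simp_all add: l1_dist_zero_iff l1_dist_triangle)

lemma coordinate_le_l1: 
  assumes "x \<in> S" "y \<in> S"
  shows "\<bar>x v - y v\<bar> \<le> l1_dist x y"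
proof (cases "v \<in> supp x \<union> supp y")
  case True
  then show ?thesis unfolding l1_dist_def
    by (intro member_le_sum[of v _ "\<lambda>v. \<bar>x v - y v\<bar>"]) (use assms finite_supp in auto)
next
  case False
  then show ?thesis by (simp add: supp_def)
qed

lemma continuous_map_coordinate: "continuous_map l1.mtopology euclideanreal (\<lambda>x. x v)"
  unfolding l1.continuous_map_from_metric
proof (intro conjI ballI allI impI)
  fix x U assume x: "x \<in> S" and U: "openin euclideanreal U \<and> x v \<in> U"
  then obtain r where r: "r > 0" "ball (x v) r \<subseteq> U" using openE[of U "x v"] by auto
  have "y v \<in> U" if "y \<in> S" "l1_dist x y < r" for y
    using coordinate_le_l1[OF x that(1), of v] that(2) r(2) by (auto simp: dist_real_def subset_iff)
  then show "\<exists>r>0. \<forall>y. y \<in> S \<and> l1_dist x y < r \<longrightarrow> y v \<in> U" using r(1) by blast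
qed auto

text \<open>Both points have total mass 1, so the mass of \<open>y\<close> outside the carrier of
  \<open>x\<close> is what \<open>y\<close> lacks on the carrier. Hence finitely many coordinates,
  depending on \<open>x\<close> alone, control the distance.\<close>

lemma l1_dist_le_partial:
  assumes "x \<in> S" "y \<in> S"
  shows "l1_dist x y \<le> 2 * (\<Sum>v\<in>supp x. \<bar>x v - y v\<bar>)"
proof -
  let ?F = "supp x" let ?G = "supp x \<union> supp y"
  have fin: "finite ?F" "finite ?G" using assms by (simp_all add: finite_supp)
  have split: "sum f ?G = sum f ?F + sum f (?G - ?F)" for f :: "nat \<Rightarrow> real"
    using sum.subset_diff[of ?F ?G f] fin by auto
  have "(\<Sum>v\<in>?G - ?F. \<bar>x v - y v\<bar>) = sum y (?G - ?F)"
    using nonneg_S[OF assms(2)] by (intro sum.cong) (auto simp: supp_def)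
  also have "\<dots> = 1 - sum y ?F" using split[of y] sum_S[OF assms(2) fin(2)] by simp
  also have "\<dots> = (\<Sum>v\<in>?F. x v - y v)" using sum_S[OF assms(1) fin(1)] by (simp add: sum_subtractf)
  also have "\<dots> \<le> (\<Sum>v\<in>?F. \<bar>x v - y v\<bar>)" by (intro sum_mono) auto
  finally show ?thesis unfolding l1_dist_def using split[of "\<lambda>v. \<bar>x v - y v\<bar>"] by simp
qed

text \<open>On probability vectors, coordinatewise convergence implies convergence in the
  \<open>l\<^sup>1\<close>-distance (Scheffe's lemma).\<close>

lemma mtopology_l1: "l1.mtopology = top_of_set S"
  unfolding topology_eq
proof (intro allI iffI)
  fix U assume U: "openin (top_of_set S) U"
  have "continuous_map l1.mtopology (powertop_real UNIV) (\<lambda>x. x)"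
    unfolding continuous_map_componentwise_UNIV using continuous_map_coordinate by blast
  then have "continuous_map l1.mtopology (top_of_set S) (\<lambda>x. x)"
    by (simp add: continuous_map_in_subtopology euclidean_product_topology)
  from openin_continuous_map_preimage[OF this U] have "openin l1.mtopology {x \<in> S. x \<in> U}" by simp
  moreover have "{x \<in> S. x \<in> U} = U" using openin_subset[OF U] by auto
  ultimately show "openin l1.mtopology U" by simp
next
  fix U assume U: "openin l1.mtopology U"
  show "openin (top_of_set S) U"
  proof (subst openin_subopen, intro ballI)
    fix x assume x: "x \<in> U"
    then have xS: "x \<in> S" using U by (auto simp: l1.openin_mtopology)
    obtain r where r: "r > 0" "l1.mball x r \<subseteq> U"
      using conjunct2[OF U[unfolded l1.openin_mtopology], rule_format, OF x] by (elim exE conjE)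
    define W where "W = {y. (\<Sum>v\<in>supp x. \<bar>x v - y v\<bar>) < r/2}"
    have "open W" unfolding W_def
      by (intro open_Collect_less continuous_on_sum continuous_on_const
          continuous_on_rabs continuous_on_diff continuous_on_coordinate)
    then have "openin (top_of_set S) (S \<inter> W)" by (rule openin_open_Int)
    moreover have "x \<in> S \<inter> W" using xS r(1) by (simp add: W_def)
    moreover have "S \<inter> W \<subseteq> U"
    proof
      fix y assume y: "y \<in> S \<inter> W"
      then have "l1_dist x y < r" using l1_dist_le_partial[OF xS, of y] by (simp add: W_def)
      then show "y \<in> U" using xS y r(2) by (auto simp: subset_iff)
    qed
    ultimately show "\<exists>T. openin (top_of_set S) T \<and> x \<in> T \<and> T \<subseteq> U" by blast
  qed
qed

section \<open>Consequences of local finiteness: weak topology and completeness\<close>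

lemma finite_star: "finite {s \<in> K. v \<in> s}"
  using lf by (simp add: locally_finite_complex_def)

text \<open>A point with positive coordinate at \<open>v\<close> has a neighbourhood that meets only
  simplices containing \<open>v\<close>. There are finitely many of these, so the conditions on
  single simplices can be intersected.\<close>

lemma realization_eq: "realization K = top_of_set S"
  unfolding topology_eq
proof (intro allI iffI)
  fix U assume "openin (top_of_set S) U"
  then obtain V where V: "open V" "U = S \<inter> V" by (auto simp: openin_open)
  have "U \<inter> closed_simplex s = closed_simplex s \<inter> V" if "s \<in> K" for s using that V(2) by (auto simp: S_def)
  then show "openin (realization K) U"
    unfolding openin_realization euclidean_product_topology using V by (auto simp: S_def openin_open_Int)
next
  fix U assume "openin (realization K) U"
  then have US: "U \<subseteq> S" and Us: "\<And>s. s \<in> K \<Longrightarrow> openin (top_of_set (closed_simplex s)) (U \<inter> closed_simplex s)"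
    unfolding openin_realization euclidean_product_topology by (auto simp: S_def)
  have "\<forall>s\<in>K. \<exists>W. open W \<and> U \<inter> closed_simplex s = closed_simplex s \<inter> W"
    using Us unfolding openin_open by blast
  from bchoice[OF this] obtain W where W: "\<And>s. s \<in> K \<Longrightarrow> open (W s)"
    "\<And>s. s \<in> K \<Longrightarrow> U \<inter> closed_simplex s = closed_simplex s \<inter> W s" by blast
  show "openin (top_of_set S) U"
  proof (subst openin_subopen, intro ballI)
    fix x assume x: "x \<in> U"
    then have xS: "x \<in> S" using US by blast
    then have "supp x \<noteq> {}" using S_iff[of x] by auto
    then obtain v where "x v \<noteq> 0" by (auto simp: supp_def)
    then have v: "x v > 0" using nonneg_S[OF xS, of v] by simp
    \<comment> \<open>For a simplex through \<open>x\<close> the given trace of \<open>U\<close> is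
      used; the other simplices at \<open>v\<close> are closed sets without \<open>x\<close> and are
      simply avoided.\<close>
    define N where "N = {y :: nat \<Rightarrow> real. 0 < y v} \<inter>
      (\<Inter>s\<in>{s \<in> K. v \<in> s}. if x \<in> closed_simplex s then W s else - closed_simplex s)"
    have "open (\<Inter>s\<in>{s \<in> K. v \<in> s}. if x \<in> closed_simplex s then W s else - closed_simplex s)"
      by (intro open_INT finite_star) (use W(1) closed_closed_simplex in auto)
    moreover have "open {y :: nat \<Rightarrow> real. 0 < y v}"
      by (intro open_Collect_less continuous_on_const continuous_on_coordinate)
    ultimately have "open N" unfolding N_def by (rule open_Int[rotated])
    then have "openin (top_of_set S) (S \<inter> N)" by (rule openin_open_Int)
    moreover have "x \<in> S \<inter> N" using xS v W(2) x by (auto simp: N_def)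
    moreover have "S \<inter> N \<subseteq> U"
    proof
      fix y assume y: "y \<in> S \<inter> N"
      then obtain s where s: "s \<in> K" "y \<in> closed_simplex s" by (auto simp: S_def)
      have "0 < y v" using y by (simp add: N_def)
      then have "v \<in> s" using s(2) by (auto simp: closed_simplex_def)
      then have "y \<in> (if x \<in> closed_simplex s then W s else - closed_simplex s)"
        using y s(1) unfolding N_def by blast
      then have "y \<in> W s" using s(2) by (auto split: if_splits)
      then show "y \<in> U" using W(2)[OF s(1)] s(2) by blast
    qed
    ultimately show "\<exists>T. openin (top_of_set S) T \<and> x \<in> T \<and> T \<subseteq> U" by blast
  qed
qed

text \<open>Coordinatewise limits exist, but mass might escape. The Cauchy condition keeps some
  coordinate \<open>v\<close> of the limit positive; then a tail of the sequence lies in the union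
  of the finitely many closed simplices at \<open>v\<close>, which is closed.\<close>

lemma mcomplete_l1: "l1.mcomplete"
  unfolding l1.mcomplete_def
proof (intro allI impI)
  fix \<sigma> assume cau: "l1.MCauchy \<sigma>"
  have \<sigma>S: "\<sigma> n \<in> S" for n using cau by (auto simp: l1.MCauchy_def)
  have small: "\<exists>N. \<forall>n n'. N \<le> n \<longrightarrow> N \<le> n' \<longrightarrow> l1_dist (\<sigma> n) (\<sigma> n') < e" if "e > 0" for e
    using cau that unfolding l1.MCauchy_def by simp
  have "Cauchy (\<lambda>n. \<sigma> n v)" for v
  proof (rule CauchyI)
    fix e :: real assume "0 < e"
    then obtain N where N: "\<forall>n n'. N \<le> n \<longrightarrow> N \<le> n' \<longrightarrow> l1_dist (\<sigma> n) (\<sigma> n') < e" using small by blast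
    have "norm (\<sigma> m v - \<sigma> n v) < e" if "m \<ge> N" "n \<ge> N" for m n
      using coordinate_le_l1[OF \<sigma>S \<sigma>S, of m v n] N that by fastforce
    then show "\<exists>M. \<forall>m\<ge>M. \<forall>n\<ge>M. norm (\<sigma> m v - \<sigma> n v) < e" by blast
  qed
  then have "\<forall>v. \<exists>l. (\<lambda>n. \<sigma> n v) \<longlonglongrightarrow> l" by (simp add: Cauchy_convergent_iff convergent_def)
  then obtain x where x: "\<And>v. (\<lambda>n. \<sigma> n v) \<longlonglongrightarrow> x v" by metis
  have xlim: "limitin euclidean \<sigma> x sequentially"
    unfolding euclidean_product_topology[symmetric] limitin_componentwise using x by simp
  \<comment> \<open>With distance below \<open>1/2\<close>, every later point keeps at least half of
    its mass on the carrier of \<open>\<sigma> N\<close>. This passes to the limit because the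
    carrier is finite.\<close>
  obtain N where N: "\<And>n. N \<le> n \<Longrightarrow> l1_dist (\<sigma> N) (\<sigma> n) < 1/2" using small[of "1/2"] by auto
  let ?F = "supp (\<sigma> N)"
  have fin: "finite ?F" using finite_supp \<sigma>S by blast
  have "1/2 \<le> sum (\<sigma> n) ?F" if n: "N \<le> n" for n
  proof -
    have "(\<Sum>v\<in>?F. \<bar>\<sigma> N v - \<sigma> n v\<bar>) \<le> l1_dist (\<sigma> N) (\<sigma> n)" unfolding l1_dist_def
      by (rule sum_mono2) (use finite_supp \<sigma>S in auto)
    moreover have "(\<Sum>v\<in>?F. \<sigma> N v - \<sigma> n v) \<le> (\<Sum>v\<in>?F. \<bar>\<sigma> N v - \<sigma> n v\<bar>)" by (intro sum_mono) auto
    ultimately have "sum (\<sigma> N) ?F - sum (\<sigma> n) ?F < 1/2" using N[OF n] by (simp add: sum_subtractf)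
    then show ?thesis using sum_S[OF \<sigma>S fin] by simp
  qed
  moreover have "(\<lambda>n. sum (\<sigma> n) ?F) \<longlonglongrightarrow> sum x ?F" by (intro tendsto_sum x)
  ultimately have "1/2 \<le> sum x ?F" by (intro Lim_bounded2) auto
  then have "\<not> (\<forall>v\<in>?F. x v \<le> 0)" using sum_nonpos[of ?F x] by auto
  then obtain v where v: "x v > 0" by (auto simp: not_le)
  then have "\<forall>\<^sub>F n in sequentially. 0 < \<sigma> n v" using x[of v] by (simp add: order_tendstoD)
  moreover define Q where "Q = (\<Union>s\<in>{s \<in> K. v \<in> s}. closed_simplex s)"
  have "\<sigma> n \<in> Q" if pos: "0 < \<sigma> n v" for n
  proof -
    obtain s where s: "s \<in> K" "\<sigma> n \<in> closed_simplex s" using \<sigma>S[of n] by (auto simp: S_def)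
    have "v \<in> s" using s(2) pos by (auto simp: closed_simplex_def)
    then show ?thesis using s by (auto simp: Q_def)
  qed
  ultimately have evQ: "\<forall>\<^sub>F n in sequentially. \<sigma> n \<in> Q" by (auto elim: eventually_mono)
  have "closed Q" unfolding Q_def using finite_star closed_closed_simplex by (intro closed_UN) auto
  then have "x \<in> Q" using xlim evQ by (intro Lim_in_closed_set[of Q \<sigma> sequentially x]) (auto simp: limitin_canonical_iff)
  then have xS: "x \<in> S" by (auto simp: Q_def S_def)
  have "limitin (top_of_set S) \<sigma> x sequentially"
    using xlim xS \<sigma>S by (simp add: limitin_subtopology)
  then show "\<exists>x. limitin l1.mtopology \<sigma> x sequentially" unfolding mtopology_l1 by blast
qed

text \<open>Two points at distance less than 2 have a common vertex in their supports, so both lie in a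
  simplex together with the normalized minimum \<open>m\<close> of their coordinates. The path runs straight
  from \<open>x\<close> to \<open>m\<close> and then straight to \<open>y\<close>; the factor \<open>\<theta>\<close> slows it down to the constant path
  before \<open>m\<close> ceases to exist.\<close>

definition \<theta> :: "(nat \<Rightarrow> real) \<Rightarrow> (nat \<Rightarrow> real) \<Rightarrow> real" where
  "\<theta> x y = max 0 (min 1 (3 - 2 * l1_dist x y))"

text \<open>The total mass of the minimum is \<open>1 - l1_dist x y / 2\<close>, by
  \<open>sum_min\<close>. The value \<open>1/4\<close> is attained at distance \<open>3/2\<close>,
  from which on \<open>\<theta>\<close> vanishes; so the maximum changes the denominator only where
  the path is constant, and makes it positive everywhere.\<close>

definition m :: "(nat \<Rightarrow> real) \<Rightarrow> (nat \<Rightarrow> real) \<Rightarrow> nat \<Rightarrow> real" where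
  "m x y v = min (x v) (y v) / max (1/4) (1 - l1_dist x y / 2)"

text \<open>\<open>a\<close> and \<open>b\<close> are the weights of \<open>x\<close> and
  \<open>y\<close>. In the first half \<open>b\<close> is 0 and \<open>a\<close> falls from 1 to 0,
  in the second half \<open>a\<close> is 0 and \<open>b\<close> grows; writing them as maxima gives
  one formula that is visibly continuous.\<close>

definition L :: "(nat \<Rightarrow> real) \<Rightarrow> (nat \<Rightarrow> real) \<Rightarrow> real \<Rightarrow> nat \<Rightarrow> real" where
  "L x y t v = (let a = max 0 (1 - 2 * (t * \<theta> x y)); b = max 0 (2 * (t * \<theta> x y) - 1)
     in a * x v + (1 - a - b) * m x y v + b * y v)"

section \<open>Short paths in the realization\<close>

lemma sum_min:
  assumes "x \<in> S" "y \<in> S"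
  shows "(\<Sum>v\<in>supp x \<union> supp y. min (x v) (y v)) = 1 - l1_dist x y / 2"
proof -
  let ?G = "supp x \<union> supp y"
  have fin: "finite ?G" using assms by (simp add: finite_supp)
  have "(\<Sum>v\<in>?G. min (x v) (y v)) = (\<Sum>v\<in>?G. (x v + y v - \<bar>x v - y v\<bar>) / 2)"
    by (intro sum.cong) (auto simp: min_def)
  also have "\<dots> = (sum x ?G + sum y ?G - l1_dist x y) / 2"
    by (simp add: sum_divide_distrib[symmetric] sum.distrib sum_subtractf l1_dist_def)
  also have "\<dots> = 1 - l1_dist x y / 2" using sum_S[OF assms(1) fin] sum_S[OF assms(2) fin] by simp
  finally show ?thesis .
qed

lemma L_main:
  assumes x: "x \<in> S" and y: "y \<in> S" and t: "t \<in> {0..1}"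
  shows "L x y t \<in> S" "l1_dist x (L x y t) \<le> l1_dist x y"
proof -
  define D where "D = l1_dist x y"
  define a where "a = max 0 (1 - 2 * (t * \<theta> x y))"
  define b where "b = max 0 (2 * (t * \<theta> x y) - 1)"
  have L: "L x y t = (\<lambda>v. a * x v + (1 - a - b) * m x y v + b * y v)"
    by (rule ext) (simp add: L_def a_def b_def Let_def)
  have \<theta>: "0 \<le> \<theta> x y" "\<theta> x y \<le> 1" by (auto simp: \<theta>_def)
  have s: "0 \<le> t * \<theta> x y" "t * \<theta> x y \<le> 1" using t \<theta> by (auto intro: mult_le_one)
  have ab: "0 \<le> a" "0 \<le> b" "a + b \<le> 1" using s by (auto simp: a_def b_def)
  have "L x y t \<in> S \<and> l1_dist x (L x y t) \<le> l1_dist x y"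
  proof (cases "D \<ge> 3/2")
    case True
    then have "\<theta> x y = 0" by (simp add: \<theta>_def D_def)
    then have "a = 1" "b = 0" by (auto simp: a_def b_def)
    then have "L x y t = x" by (simp add: L)
    then show ?thesis using x l1.nonneg[of x y] l1.mdist_zero[OF x] by simp
  next
    case False
    define c where "c = 1 - D / 2"
    have c: "1/4 \<le> c" "0 < c" "c \<le> 1" using False l1.nonneg[of x y] by (auto simp: c_def D_def)
    have m: "m x y v = min (x v) (y v) / c" for v using c by (simp add: m_def c_def D_def max_def)
    have m0: "0 \<le> m x y v" for v using nonneg_S[OF x] nonneg_S[OF y] c by (simp add: m)
    let ?G = "supp x \<union> supp y"
    have fin: "finite ?G" using x y by (simp add: finite_supp)
    have smin: "(\<Sum>v\<in>?G. min (x v) (y v)) = c" using sum_min[OF x y] by (simp add: c_def D_def)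
    have sm: "sum (m x y) ?G = 1"
      using smin c by (simp add: m sum_divide_distrib[symmetric])
    have sx: "sum x ?G = 1" and sy: "sum y ?G = 1" using sum_S[OF x fin] sum_S[OF y fin] by auto
    have mz: "m x y v = 0" if "x v = 0 \<or> y v = 0" for v
      using that nonneg_S[OF x, of v] nonneg_S[OF y, of v] by (auto simp: m min_def)
    have suppG: "supp (L x y t) \<subseteq> ?G" using mz by (auto simp: supp_def L)
    \<comment> \<open>\<open>m x y\<close> vanishes wherever one of the points does. So the first
      half of the path stays in the carrier of \<open>x\<close>, and the second half in that of
      \<open>y\<close>.\<close>
    have "\<exists>s\<in>K. supp (L x y t) \<subseteq> s"
    proof (cases "2 * (t * \<theta> x y) \<le> 1")
      case True
      then have "b = 0" by (simp add: b_def)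
      then have "supp (L x y t) \<subseteq> supp x" using mz by (auto simp: supp_def L)
      then show ?thesis using x by (auto simp: S_iff)
    next
      case False
      then have "a = 0" by (simp add: a_def)
      then have "supp (L x y t) \<subseteq> supp y" using mz by (auto simp: supp_def L)
      then show ?thesis using y by (auto simp: S_iff)
    qed
    then obtain s where s: "s \<in> K" "supp (L x y t) \<subseteq> s" by blast
    have "sum (L x y t) ?G = a * sum x ?G + (1 - a - b) * sum (m x y) ?G + b * sum y ?G"
      by (simp add: L sum.distrib sum_distrib_left)
    then have sL: "sum (L x y t) ?G = 1" using sx sy sm by simp
    have "0 \<le> L x y t v" for v using ab m0 nonneg_S[OF x] nonneg_S[OF y] by (simp add: L)
    then have LS: "L x y t \<in> S" using fin suppG sL s(2,1) by (rule in_S_I)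
    \<comment> \<open>Normalization by \<open>c \<le> 1\<close> only enlarges the minimum, so both
      \<open>x\<close> and \<open>m\<close> lie above it and their difference is bounded by the sum
      of the two excesses. Summed over all coordinates this bound is \<open>2 - 2 * c\<close>, which
      is the distance \<open>D\<close> of \<open>x\<close> and \<open>y\<close>.\<close>
    have coord: "\<bar>x v - L x y t v\<bar> \<le> (1 - a - b) * (x v + m x y v - 2 * min (x v) (y v)) + b * \<bar>x v - y v\<bar>" for v
    proof -
      have "min (x v) (y v) * c \<le> min (x v) (y v) * 1"
        using nonneg_S[OF x, of v] nonneg_S[OF y, of v] c by (intro mult_left_mono) auto
      then have mge: "min (x v) (y v) \<le> m x y v" using c by (simp add: m field_simps)
      have "\<bar>x v - L x y t v\<bar> = \<bar>(1 - a - b) * (x v - m x y v) + b * (x v - y v)\<bar>"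
        by (rule arg_cong[of _ _ abs]) (simp add: L algebra_simps)
      also have "\<dots> \<le> (1 - a - b) * \<bar>x v - m x y v\<bar> + b * \<bar>x v - y v\<bar>"
        using ab by (intro order_trans[OF abs_triangle_ineq]) (simp add: abs_mult)
      also have "\<dots> \<le> (1 - a - b) * (x v + m x y v - 2 * min (x v) (y v)) + b * \<bar>x v - y v\<bar>"
        using ab mge by (intro add_right_mono mult_left_mono) linarith+
      finally show ?thesis .
    qed
    have "l1_dist x (L x y t) = (\<Sum>v\<in>?G. \<bar>x v - L x y t v\<bar>)"
      by (rule l1_dist_eq_sum[OF fin]) (use suppG in auto)
    also have "\<dots> \<le> (\<Sum>v\<in>?G. (1 - a - b) * (x v + m x y v - 2 * min (x v) (y v)) + b * \<bar>x v - y v\<bar>)"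
      by (intro sum_mono coord)
    also have "\<dots> = (1 - a - b) * (sum x ?G + sum (m x y) ?G - 2 * (\<Sum>v\<in>?G. min (x v) (y v))) + b * D"
      by (simp add: sum.distrib sum_subtractf sum_distrib_left[symmetric] l1_dist_def D_def)
    also have "\<dots> = (1 - a - b) * D + b * D" using sx sm smin by (simp add: c_def)
    also have "\<dots> = (1 - a) * D" by (simp add: algebra_simps)
    also have "\<dots> \<le> 1 * D" using ab l1.nonneg[of x y] by (intro mult_right_mono) (auto simp: D_def)
    finally show ?thesis using LS by (simp add: D_def)
  qed
  then show "L x y t \<in> S" "l1_dist x (L x y t) \<le> l1_dist x y" by auto
qed

text \<open>Since the metric topology is that of coordinatewise convergence
  (\<open>mtopology_l1\<close>), it suffices to look at single coordinates, where the formula is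
  built from continuous operations with a denominator of at least \<open>1/4\<close>.\<close>

lemma continuous_map_L_realization:
  "continuous_map (prod_topology (prod_topology l1.mtopology l1.mtopology) (top_of_set {0..1})) l1.mtopology
     (\<lambda>((x, y), t). L x y t)"
proof -
  let ?Z = "prod_topology (prod_topology l1.mtopology l1.mtopology) (top_of_set {0..1::real})"
  have cx: "continuous_map ?Z l1.mtopology (\<lambda>z. fst (fst z))"
    and cy: "continuous_map ?Z l1.mtopology (\<lambda>z. snd (fst z))"
    using continuous_map_compose[OF continuous_map_fst continuous_map_fst, unfolded o_def]
      continuous_map_compose[OF continuous_map_fst continuous_map_snd, unfolded o_def] .
  have ct: "continuous_map ?Z euclideanreal snd"
    using continuous_map_snd[of _ "top_of_set {0..1::real}"] by (auto simp: continuous_map_in_subtopology)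
  have cd: "continuous_map ?Z euclideanreal (\<lambda>z. l1_dist (fst (fst z)) (snd (fst z)))"
    by (rule l1.continuous_map_d[OF cx cy])
  have c1: "continuous_map ?Z euclideanreal (\<lambda>z. fst (fst z) v)"
    and c2: "continuous_map ?Z euclideanreal (\<lambda>z. snd (fst z) v)" for v
    using continuous_map_compose[OF cx continuous_map_coordinate[of v], unfolded o_def]
      continuous_map_compose[OF cy continuous_map_coordinate[of v], unfolded o_def] .
  have c\<theta>: "continuous_map ?Z euclideanreal (\<lambda>z. \<theta> (fst (fst z)) (snd (fst z)))"
    unfolding \<theta>_def
    by (intro continuous_map_real_max continuous_map_real_min continuous_map_diff continuous_map_real_mult cd) auto
  have cm: "continuous_map ?Z euclideanreal (\<lambda>z. m (fst (fst z)) (snd (fst z)) v)" for v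
    unfolding m_def
    by (intro continuous_map_real_divide continuous_map_real_max continuous_map_real_min continuous_map_diff c1 c2 cd) auto
  have "continuous_map ?Z euclideanreal (\<lambda>z. L (fst (fst z)) (snd (fst z)) (snd z) v)" for v
    unfolding L_def Let_def
    by (intro continuous_map_add continuous_map_real_mult continuous_map_real_max continuous_map_diff c1 c2 cm c\<theta> ct) auto
  then have "continuous_map ?Z (powertop_real UNIV) (\<lambda>z. L (fst (fst z)) (snd (fst z)) (snd z))"
    unfolding continuous_map_componentwise_UNIV by blast
  moreover have "L (fst (fst z)) (snd (fst z)) (snd z) \<in> S" if "z \<in> topspace ?Z" for z
    using that by (intro L_main) auto
  ultimately have "continuous_map ?Z (top_of_set S) (\<lambda>z. L (fst (fst z)) (snd (fst z)) (snd z))"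
    by (auto simp: continuous_map_in_subtopology euclidean_product_topology)
  then show ?thesis unfolding mtopology_l1 by (simp add: case_prod_unfold)
qed

end

text \<open>A polyhedron is only homeomorphic to a realization. Pulling back the metric and the
  paths, instead of transporting maps and homotopies, makes \<open>P\<close> itself a metric
  topology, so the result for metric targets applies to its map space directly.\<close>

lemma path_connecting_metric_pullback:
  assumes "path_connecting_metric N e L" and hg: "homeomorphic_maps P (Metric_space.mtopology N e) h g"
  shows "path_connecting_metric (topspace P) (\<lambda>a b. e (h a) (h b)) (\<lambda>a b t. g (L (h a) (h b) t))"
    and "Metric_space.mtopology (topspace P) (\<lambda>a b. e (h a) (h b)) = P"
proof -
  interpret N: path_connecting_metric N e L by (rule assms(1))
  have ch: "continuous_map P N.mtopology h" and cg: "continuous_map N.mtopology P g"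
    and gh: "\<And>x. x \<in> topspace P \<Longrightarrow> g (h x) = x" and hg': "\<And>y. y \<in> N \<Longrightarrow> h (g y) = y"
    using hg by (auto simp: homeomorphic_maps_def)
  have hN: "h x \<in> N" if "x \<in> topspace P" for x using ch that by (auto simp: continuous_map_def)
  have gP: "g y \<in> topspace P" if "y \<in> N" for y using cg that by (auto simp: continuous_map_def)
  interpret P: Metric_space "topspace P" "\<lambda>a b. e (h a) (h b)"
  proof
    show "(e (h x) (h y) = 0) = (x = y)" if "x \<in> topspace P" "y \<in> topspace P" for x y
      using N.zero[OF hN[OF that(1)] hN[OF that(2)]] gh that by metis
    show "e (h x) (h z) \<le> e (h x) (h y) + e (h y) (h z)"
      if "x \<in> topspace P" "y \<in> topspace P" "z \<in> topspace P" for x y z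
      using that by (intro N.triangle hN)
  qed (auto simp: N.commute)
  show top: "P.mtopology = P" unfolding topology_eq
  proof (intro allI iffI)
    fix U assume U: "openin P U"
    then have UP: "U \<subseteq> topspace P" by (rule openin_subset)
    have o: "openin N.mtopology {y \<in> N. g y \<in> U}"
      using openin_continuous_map_preimage[OF cg U] by simp
    have "\<exists>r>0. P.mball x r \<subseteq> U" if x: "x \<in> U" for x
    proof -
      have xP: "x \<in> topspace P" using x UP by blast
      have "h x \<in> {y \<in> N. g y \<in> U}" using hN[OF xP] gh[OF xP] x by simp
      then obtain r where r: "r > 0" "N.mball (h x) r \<subseteq> {y \<in> N. g y \<in> U}"
        using conjunct2[OF o[unfolded N.openin_mtopology]] by blast
      have "P.mball x r \<subseteq> U"
      proof
        fix y assume y: "y \<in> P.mball x r"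
        then have "h y \<in> N.mball (h x) r" using hN by simp
        then have "g (h y) \<in> U" using r(2) by blast
        then show "y \<in> U" using gh y by simp
      qed
      with r(1) show ?thesis by blast
    qed
    then show "openin P.mtopology U" using UP by (simp add: P.openin_mtopology)
  next
    fix U assume U: "openin P.mtopology U"
    show "openin P U"
    proof (subst openin_subopen, intro ballI)
      fix x assume x: "x \<in> U"
      have xP: "x \<in> topspace P" using openin_subset[OF U] x by auto
      obtain r where r: "r > 0" "P.mball x r \<subseteq> U"
        using conjunct2[OF U[unfolded P.openin_mtopology], rule_format, OF x] by (elim exE conjE)
      have "openin P {y \<in> topspace P. h y \<in> N.mball (h x) r}"
        by (rule openin_continuous_map_preimage[OF ch N.openin_mball])
      moreover have "{y \<in> topspace P. h y \<in> N.mball (h x) r} \<subseteq> P.mball x r" using xP by auto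
      moreover have "x \<in> {y \<in> topspace P. h y \<in> N.mball (h x) r}" using xP hN[OF xP] r(1) by simp
      ultimately show "\<exists>T. openin P T \<and> x \<in> T \<and> T \<subseteq> U" using r(2) by (meson subset_trans)
    qed
  qed
  show "path_connecting_metric (topspace P) (\<lambda>a b. e (h a) (h b)) (\<lambda>a b t. g (L (h a) (h b) t))"
  proof
    show "P.mcomplete" unfolding P.mcomplete_def
    proof (intro allI impI)
      fix \<sigma> assume cau: "P.MCauchy \<sigma>"
      then have \<sigma>: "\<sigma> n \<in> topspace P" for n by (auto simp: P.MCauchy_def)
      have "N.MCauchy (h \<circ> \<sigma>)" using cau hN \<sigma> unfolding P.MCauchy_def N.MCauchy_def by auto
      then obtain l where l: "limitin N.mtopology (h \<circ> \<sigma>) l sequentially"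
        using N.complete unfolding N.mcomplete_def by blast
      have "limitin P (g \<circ> (h \<circ> \<sigma>)) (g l) sequentially" using continuous_map_limit[OF cg l] by (simp add: o_def)
      moreover have "g \<circ> (h \<circ> \<sigma>) = \<sigma>" using gh \<sigma> by auto
      ultimately show "\<exists>l. limitin P.mtopology \<sigma> l sequentially" unfolding top by auto
    qed
    have "homeomorphic_map N.mtopology P g" using hg unfolding homeomorphic_maps_map by blast
    then have og: "open_map N.mtopology P g" by (rule homeomorphic_imp_open_map)
    have img: "g ` topspace N.mtopology = topspace P"
    proof
      show "topspace P \<subseteq> g ` topspace N.mtopology"
      proof
        fix x assume "x \<in> topspace P"
        then show "x \<in> g ` topspace N.mtopology" using gh hN by (intro image_eqI[of x g "h x"]) auto
      qed
    qed (use gP in auto)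
    show "second_countable P.mtopology"
      unfolding top by (rule second_countable_open_map_image[OF cg og img N.sc])
    let ?Z = "prod_topology (prod_topology P P) \<I>"
    have cx: "continuous_map ?Z P (\<lambda>z. fst (fst z))" and cy: "continuous_map ?Z P (\<lambda>z. snd (fst z))"
      using continuous_map_compose[OF continuous_map_fst continuous_map_fst, unfolded o_def]
        continuous_map_compose[OF continuous_map_fst continuous_map_snd, unfolded o_def] .
    have ct: "continuous_map ?Z euclideanreal snd"
      using continuous_map_snd[of _ \<I>] by (auto simp: continuous_map_in_subtopology)
    have "continuous_map ?Z N.mtopology (\<lambda>z. L (h (fst (fst z))) (h (snd (fst z))) (snd z))"
      by (rule N.continuous_map_L[OF continuous_map_compose[OF cx ch, unfolded o_def]
            continuous_map_compose[OF cy ch, unfolded o_def] ct]) auto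
    from continuous_map_compose[OF this cg]
    show "continuous_map (prod_topology (prod_topology P.mtopology P.mtopology) \<I>) P.mtopology
        (\<lambda>((x, y), t). g (L (h x) (h y) t))"
      unfolding top by (simp add: o_def case_prod_unfold)
    fix x y assume x: "x \<in> topspace P" and y: "y \<in> topspace P"
    show "g (L (h x) (h y) 0) = x" using N.L_0[OF hN[OF x] hN[OF y]] gh[OF x] by simp
    show "g (L (h x) (h y) 1) = y" if "e (h x) (h y) \<le> 1"
      using N.L_1[OF hN[OF x] hN[OF y] that] gh[OF y] by simp
    show "e (h x) (h (g (L (h x) (h y) t))) \<le> e (h x) (h y)" if t: "t \<in> {0..1}" for t
      using N.L_d[OF hN[OF x] hN[OF y] t] hg'[OF N.L_in_M[OF hN[OF x] hN[OF y] t]] by simp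
  qed
qed

context simplicial_complex
begin

lemma path_connecting_metric_realization: "path_connecting_metric S l1_dist L"
proof
  show "l1.mcomplete" by (rule mcomplete_l1)
  show "second_countable l1.mtopology"
    unfolding mtopology_l1 by (rule second_countable_subtopology[OF second_countable_euclidean])
  show "continuous_map (prod_topology (prod_topology l1.mtopology l1.mtopology) \<I>) l1.mtopology (\<lambda>((x, y), t). L x y t)"
    by (rule continuous_map_L_realization)
  show "L x y 0 = x" for x y by (rule ext) (simp add: L_def)
  show "L x y 1 = y" if "l1_dist x y \<le> 1" for x y
  proof -
    have "\<theta> x y = 1" using that by (simp add: \<theta>_def)
    then show ?thesis by (intro ext) (simp add: L_def)
  qed
  show "l1_dist x (L x y t) \<le> l1_dist x y" if "x \<in> S" "y \<in> S" "t \<in> {0..1}" for x y t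
    using that by (rule L_main)
qed

end

theorem theorem4p15:
  fixes X :: "'a topology" and A :: "'a set"
    and P :: "'b topology" and p :: 'b
  assumes "locally_compact_pair X A"
    and "pointed_polyhedron P p"
  shows "idealistic (map_space X A P p) (homotopy_rel X A P p)"
proof -
  obtain K :: "nat set set" and h where K: "abstract_simplicial_complex K" "locally_finite_complex K"
    and "homeomorphic_map P (realization K) h"
    using assms(2) unfolding pointed_polyhedron_def by blast
  then obtain g where hg: "homeomorphic_maps P (realization K) h g"
    by (auto simp: homeomorphic_map_maps)
  interpret simplicial_complex K using K by unfold_locales
  have "homeomorphic_maps P l1.mtopology h g" using hg by (simp only: realization_eq mtopology_l1)
  note pull = path_connecting_metric_pullback[OF path_connecting_metric_realization this]
  show ?thesis using path_connecting_metric.idealistic_homotopy_rel[OF pull(1) assms(1), of p] unfolding pull(2) .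
qed

end
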